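(* Let $\mathcal{T}\subset\mathbb{R}^2$ be the isoperimetrix of a symmetric Minkowski geometry, with support function $\tilde h$ and area $\alpha$, and let $K\subset\mathbb{R}^2$ be a compact convex set with nonempty interior, with area $A$ and boundary curve $\partial K$ of Minkowski length $\mathcal{L}$. Set $\mathcal{B}(r)=r\mathcal{L}-A-\alpha r^2$ for $r\in\mathbb{R}$. Let $\mathcal{O}$ be the center, $\rho_{\text{in}}$ the inner radius and $\rho_{\text{out}}$ the outer radius of the relative minimal annulus enclosing $\partial K$. Then $\mathcal{B}(r)\ge 0$ for all $r\in[\rho_{\text{in}},\rho_{\text{out}}]$. Consequently, if $h$ is the support function of $K$ based at $\mathcal{O}$, then, since $\rho_{\text{in}}\le \frac{h}{\tilde h}\le\rho_{\text{out}}$, one has $\mathcal{B}\left(\frac{h}{\tilde h}\right)\ge 0$ everywhere on $\partial K$; that is, $\mathcal{O}$ is a relative positive center of $\partial K$. In particular every convex curve has at least one relative positive center.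
   Context: Minkowski geometry: the unit disk $\mathcal{U}$ is a convex body in $\mathbb{R}^2$, symmetric through the origin, with smooth boundary given in polar coordinates by $r(\phi)$. The isoperimetrix $\mathcal{T}$ is the polar reciprocal of $\mathcal{U}$ rotated by ninety degrees, so it is a convex body symmetric through the origin whose Euclidean support function is $\tilde h(\theta)=1/r(\theta+\pi/2)$. It is assumed that $\tilde h$ is smooth, positive, $\pi$-periodic, and that $\tilde h+\tilde h''>0$ (so $\partial\mathcal{T}$ has finite positive curvature $\tilde k=1/(\tilde h+\tilde h'')$). $\alpha$ denotes the Euclidean area of $\mathcal{T}$. Support function of $K$ based at a point $\mathcal{O}$: $h(\theta)=\max_{x\in K}\langle x-\mathcal{O},(\cos\theta,\sin\theta)\rangle$. The quotient $h/\tilde h$ is the relative support function; at a point of $\partial K$ it is evaluated at the angle $\theta$ of the outward normal there (at a corner, at every angle of a supporting line's outward normal). $A$ is the Euclidean area of $K$, and the Minkowski length of $\partial K$ is $\mathcal{L}=\int_0^{2\pi}(h\tilde h-h'\tilde h')\,d\theta$ (twice the mixed area of $K$ and $\mathcal{T}$, normalized so that $\int_0^{2\pi}(\tilde h^2-\tilde h'^2)\,d\theta=2\alpha$); for smooth $\partial K$ it equals $\int_{\partial K}\tilde h\,ds$, where $ds$ is Euclidean arc length. Relative minimal annulus: among all points $\mathcal{O}$ and numbers $0\le\rho_{\text{in}}\le\rho_{\text{out}}$ with $\mathcal{O}+\rho_{\text{in}}\mathcal{T}\subseteq K\subseteq\mathcal{O}+\rho_{\text{out}}\mathcal{T}$,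 choose the one minimizing $\rho_{\text{out}}-\rho_{\text{in}}$; the region between the two homothets is the relative minimal annulus, with center $\mathcal{O}$, inner radius $\rho_{\text{in}}$ and outer radius $\rho_{\text{out}}$. Relative positive center of $\partial K$: a point $\mathcal{O}$ such that the relative support function based at $\mathcal{O}$ satisfies $\mathcal{B}(h/\tilde h)\ge 0$ at every point of $\partial K$. *)

theory Defs
  imports "HOL-Analysis.Analysis"
begin

definition dir :: "real \<Rightarrow> real^2" where
  "dir \<theta> = vector [cos \<theta>, sin \<theta>]"

definition rot90 :: "real^2 \<Rightarrow> real^2" where
  "rot90 x = vector [- x $ 2, x $ 1]"

definition smooth_fun :: "(real \<Rightarrow> real) \<Rightarrow> bool" where
  "smooth_fun f \<longleftrightarrow> (\<forall>n x. ((deriv ^^ n) f) differentiable (at x))"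

definition support :: "(real^2) set \<Rightarrow> real^2 \<Rightarrow> real \<Rightarrow> real" where
  "support K p \<theta> = (SUP x\<in>K. (x - p) \<bullet> dir \<theta>)"

definition radial :: "(real^2) set \<Rightarrow> real \<Rightarrow> real" where
  "radial U \<phi> = Sup {t. 0 \<le> t \<and> t *\<^sub>R dir \<phi> \<in> U}"

definition polar_reciprocal :: "(real^2) set \<Rightarrow> (real^2) set" where
  "polar_reciprocal U = {y. \<forall>x\<in>U. x \<bullet> y \<le> 1}"

definition isoperimetrix :: "(real^2) set \<Rightarrow> (real^2) set" where
  "isoperimetrix U = rot90 ` polar_reciprocal U"

text \<open>Smoothness of \<open>radial U\<close> and of the support function of the isoperimetrix are equivalent, by
  the relation between the two in \<open>support_isoperimetrix\<close> below, where positivity and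
  periodicity of the support function are derived as well.\<close>

definition minkowski_unit_disk :: "(real^2) set \<Rightarrow> bool" where
  "minkowski_unit_disk U \<longleftrightarrow>
     compact U \<and> convex U \<and> interior U \<noteq> {} \<and> (\<forall>x\<in>U. - x \<in> U) \<and>
     smooth_fun (radial U) \<and>
     (let h = support (isoperimetrix U) 0
      in smooth_fun h \<and> (\<forall>\<theta>. h \<theta> + deriv (deriv h) \<theta> > 0))"

text \<open>The length does not depend on the base point, here the origin. For a general convex body the
  support function is only Lipschitz, so its derivative exists almost everywhere; the unspecified
  value of \<^const>\<open>deriv\<close> on the exceptional null set does not affect the integral.\<close>

definition minkowski_length :: "(real^2) set \<Rightarrow> (real^2) set \<Rightarrow> real" where
  "minkowski_length T K =
     integral {0..2*pi} (\<lambda>\<theta>. support K 0 \<theta> * support T 0 \<theta>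
                             - deriv (support K 0) \<theta> * deriv (support T 0) \<theta>)"

definition bonnesen :: "(real^2) set \<Rightarrow> (real^2) set \<Rightarrow> real \<Rightarrow> real" where
  "bonnesen T K r =
     r * minkowski_length T K - measure lborel K - measure lborel T * r\<^sup>2"

definition homothet :: "(real^2) set \<Rightarrow> real^2 \<Rightarrow> real \<Rightarrow> (real^2) set" where
  "homothet T p \<rho> = (\<lambda>t. p + \<rho> *\<^sub>R t) ` T"

definition relative_annulus ::
    "(real^2) set \<Rightarrow> (real^2) set \<Rightarrow> real^2 \<Rightarrow> real \<Rightarrow> real \<Rightarrow> bool" where
  "relative_annulus T K p \<rho>\<^sub>i \<rho>\<^sub>o \<longleftrightarrow>
     0 \<le> \<rho>\<^sub>i \<and> \<rho>\<^sub>i \<le> \<rho>\<^sub>o \<and> homothet T p \<rho>\<^sub>i \<subseteq> K \<and> K \<subseteq> homothet T p \<rho>\<^sub>o"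

definition relative_minimal_annulus ::
    "(real^2) set \<Rightarrow> (real^2) set \<Rightarrow> real^2 \<Rightarrow> real \<Rightarrow> real \<Rightarrow> bool" where
  "relative_minimal_annulus T K p \<rho>\<^sub>i \<rho>\<^sub>o \<longleftrightarrow>
     relative_annulus T K p \<rho>\<^sub>i \<rho>\<^sub>o \<and>
     (\<forall>q \<sigma>\<^sub>i \<sigma>\<^sub>o. relative_annulus T K q \<sigma>\<^sub>i \<sigma>\<^sub>o \<longrightarrow> \<rho>\<^sub>o - \<rho>\<^sub>i \<le> \<sigma>\<^sub>o - \<sigma>\<^sub>i)"

text \<open>\<open>\<theta>\<close> is the angle of an outward normal of \<open>K\<close> at the boundary point \<open>x\<close>; at a corner there
  are many such angles.\<close>

definition outward_normal_angle :: "(real^2) set \<Rightarrow> real^2 \<Rightarrow> real \<Rightarrow> bool" where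
  "outward_normal_angle K x \<theta> \<longleftrightarrow>
     x \<in> frontier K \<and> (\<forall>y\<in>K. y \<bullet> dir \<theta> \<le> x \<bullet> dir \<theta>)"

definition relative_positive_center ::
    "(real^2) set \<Rightarrow> (real^2) set \<Rightarrow> real^2 \<Rightarrow> bool" where
  "relative_positive_center T K p \<longleftrightarrow>
     (\<forall>x \<theta>. outward_normal_angle K x \<theta> \<longrightarrow>
        0 \<le> bonnesen T K (support K p \<theta> / support T 0 \<theta>))"

lemma inner_real2: "(x::real^2) \<bullet> y = x$1 * y$1 + x$2 * y$2"
  by (simp add: inner_vec_def sum_2)

lemma norm_dir [simp]: "norm (dir \<theta>) = 1"
  by (simp add: norm_eq_sqrt_inner inner_real2 dir_def flip: power2_eq_square)

lemma inner_rot90_dir: "rot90 y \<bullet> dir (\<theta> + pi/2) = y \<bullet> dir \<theta>"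
  by (simp add: inner_real2 dir_def rot90_def cos_add sin_add)

lemma dir_add_pi: "dir (\<theta> + pi) = - dir \<theta>"
  by (simp add: dir_def vec_eq_iff forall_2)

lemma zero_in_interior_symmetric:
  assumes "convex U" "interior U \<noteq> {}" "\<And>x. x \<in> U \<Longrightarrow> - x \<in> U"
  shows "(0::real^2) \<in> interior U"
proof -
  obtain x where x: "x \<in> interior U" using assms(2) by blast
  have eq: "uminus ` U = U"
    using assms(3) by force
  have "- x \<in> interior U"
    using x interior_negations[of U] eq by auto
  then have "(1/2) *\<^sub>R x + (1/2) *\<^sub>R (- x) \<in> interior U"
    using x assms(1) convex_interior[of U] by (intro convexD) auto
  then show ?thesis by simp
qed

lemma radial_props:
  assumes "compact U" "convex U" "0 \<in> interior U"
  shows radial_pos: "radial U \<phi> > 0"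
    and radial_mem: "radial U \<phi> *\<^sub>R dir \<phi> \<in> U"
    and radial_ge: "\<And>t. 0 \<le> t \<Longrightarrow> t *\<^sub>R dir \<phi> \<in> U \<Longrightarrow> t \<le> radial U \<phi>"
proof -
  let ?S = "{t. 0 \<le> t \<and> t *\<^sub>R dir \<phi> \<in> U}"
  obtain e where e: "e > 0" "cball 0 e \<subseteq> U"
    using assms(3) mem_interior_cball by blast
  have eS: "e \<in> ?S" using e by auto
  obtain B where B: "\<And>x. x \<in> U \<Longrightarrow> norm x \<le> B"
    using assms(1) compact_imp_bounded bounded_iff by metis
  have bdd: "bdd_above ?S"
    by (rule bdd_aboveI[of _ B]) (use B in force)
  have "closed ((\<lambda>t. t *\<^sub>R dir \<phi>) -` U)"
    using assms(1) by (intro closed_vimage compact_imp_closed continuous_intros)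
  then have cl: "closed ?S"
    by (simp add: Collect_conj_eq closed_Int closed_Collect_le vimage_def)
  have "Sup ?S \<in> ?S"
    by (rule closed_contains_Sup[OF _ bdd cl]) (use eS in blast)
  then show "radial U \<phi> *\<^sub>R dir \<phi> \<in> U" by (simp add: radial_def)
  show ge: "t \<le> radial U \<phi>" if "0 \<le> t" "t *\<^sub>R dir \<phi> \<in> U" for t
    unfolding radial_def by (rule cSup_upper[OF _ bdd]) (use that in auto)
  show "radial U \<phi> > 0" using ge[of e] eS e(1) by auto
qed

lemma radial_add_pi:
  assumes "\<And>x. x \<in> U \<Longrightarrow> - x \<in> U"
  shows "radial U (\<phi> + pi) = radial U \<phi>"
proof -
  have "- x \<in> U \<longleftrightarrow> x \<in> U" for x using assms[of x] assms[of "- x"] by auto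
  then show ?thesis by (simp add: radial_def dir_add_pi)
qed

lemma support_polar_reciprocal:
  assumes "compact U" "convex U" "0 \<in> interior U"
  shows "(SUP y\<in>polar_reciprocal U. y \<bullet> dir \<phi>) = 1 / radial U \<phi>"
proof (rule cSup_eq_maximum)
  note R = radial_props[OF assms, where \<phi> = \<phi>]
  let ?z = "radial U \<phi> *\<^sub>R dir \<phi>"
  show "w \<le> 1 / radial U \<phi>" if w: "w \<in> (\<lambda>y. y \<bullet> dir \<phi>) ` polar_reciprocal U" for w
  proof -
    obtain y where y: "y \<in> polar_reciprocal U" "w = y \<bullet> dir \<phi>" using w by blast
    then have "?z \<bullet> y \<le> 1" using R(2) by (auto simp: polar_reciprocal_def)
    then show ?thesis using R(1) y(2) by (simp add: field_simps inner_commute)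
  qed
  have "?z \<notin> interior U"
  proof
    assume "?z \<in> interior U"
    then obtain e where e: "e > 0" "cball ?z e \<subseteq> U" using mem_interior_cball by blast
    have z': "(radial U \<phi> + e) *\<^sub>R dir \<phi> \<in> cball ?z e"
      using e(1) by (simp add: dist_norm algebra_simps)
    have "radial U \<phi> + e \<le> radial U \<phi>"
      by (rule R(3)) (use R(1) e z' in auto)
    then show False using e(1) by simp
  qed
  moreover have "rel_interior U = interior U"
    using assms(3) by (intro rel_interior_nonempty_interior) auto
  ultimately have "?z \<notin> rel_interior U" by simp
  then obtain a where a: "a \<noteq> 0" "\<And>y. y \<in> U \<Longrightarrow> a \<bullet> ?z \<le> a \<bullet> y"
    using supporting_hyperplane_rel_boundary[OF assms(2) R(2)] by metis
  obtain e where e: "e > 0" "cball 0 e \<subseteq> U"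
    using assms(3) mem_interior_cball by blast
  have "- ((e / norm a) *\<^sub>R a) \<in> U" using e by (intro subsetD[OF e(2)]) (simp add: a(1))
  then have "a \<bullet> ?z \<le> - (e / norm a) * (a \<bullet> a)"
    using a(2) by fastforce
  also have "\<dots> < 0" using e a(1) by simp
  finally have neg: "a \<bullet> ?z < 0" .
  define y where "y = (1 / (a \<bullet> ?z)) *\<^sub>R a"
  have "x \<bullet> y \<le> 1" if "x \<in> U" for x
  proof -
    have "a \<bullet> ?z \<le> a \<bullet> x" using a(2) that by blast
    then show ?thesis using neg unfolding y_def
      by (simp add: inner_commute[of x] divide_le_eq_1 del: inner_scaleR_right)
  qed
  then have "y \<in> polar_reciprocal U" by (simp add: polar_reciprocal_def)
  moreover have "y \<bullet> dir \<phi> = 1 / radial U \<phi>"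
    using neg R(1) by (auto simp: y_def)
  ultimately show "1 / radial U \<phi> \<in> (\<lambda>y. y \<bullet> dir \<phi>) ` polar_reciprocal U"
    by (metis imageI)
qed

lemma support_isoperimetrix:
  assumes "minkowski_unit_disk U"
  shows "support (isoperimetrix U) 0 \<theta> = 1 / radial U (\<theta> + pi/2)"
    and "support (isoperimetrix U) 0 \<theta> > 0"
    and "support (isoperimetrix U) 0 (\<theta> + pi) = support (isoperimetrix U) 0 \<theta>"
proof -
  have U: "compact U" "convex U" "interior U \<noteq> {}" and sym: "\<And>x. x \<in> U \<Longrightarrow> - x \<in> U"
    using assms by (auto simp: minkowski_unit_disk_def)
  note 0 = zero_in_interior_symmetric[OF U(2,3) sym]
  have eq: "support (isoperimetrix U) 0 \<theta> = 1 / radial U (\<theta> + pi/2)" for \<theta>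
  proof -
    have "support (isoperimetrix U) 0 \<theta> = 1 / radial U (\<theta> - pi/2)"
      using inner_rot90_dir[of _ "\<theta> - pi/2"] support_polar_reciprocal[OF U(1,2) 0]
      by (simp add: support_def isoperimetrix_def image_image)
    also have "radial U (\<theta> - pi/2) = radial U (\<theta> + pi/2)"
      using radial_add_pi[OF sym, of "\<theta> - pi/2"] by (simp add: algebra_simps)
    finally show ?thesis .
  qed
  show "support (isoperimetrix U) 0 \<theta> = 1 / radial U (\<theta> + pi/2)" by (rule eq)
  show "support (isoperimetrix U) 0 \<theta> > 0"
    using radial_props(1)[OF U(1,2) 0] by (simp add: eq)
  show "support (isoperimetrix U) 0 (\<theta> + pi) = support (isoperimetrix U) 0 \<theta>"
    using radial_add_pi[OF sym, of "\<theta> + pi/2"] by (simp add: eq algebra_simps)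
qed

end

theory Submission
  imports Defs "HOL-Real_Asymp.Real_Asymp"
begin

text \<open>
  Let \<open>h\<close> be the support function of \<open>K\<close> based at the center of a minimal annulus, \<open>p\<close> that of
  \<open>T\<close>, and call \<open>\<integral> (g'\<^sup>2 - g\<^sup>2)\<close> over a full turn the energy of \<open>g\<close>. The Minkowski length is minus
  the polar form of the energy at \<open>(h, p)\<close>, and the area of a body is at most minus half the energy
  of its support function (\<open>area_le_energy\<close>; circumscribed polygons give this inequality, and as both
  areas enter \<open>\<B>\<close> with a minus sign it is the direction that matters). Hence \<open>2 \<B>(r)\<close> is at least
  the energy of \<open>g = h - r p\<close> (\<open>bonnesen_ge_energy\<close>), and it has to be shown that this energy is not
  negative when \<open>r\<close> lies between the two radii \<open>a \<le> b\<close>.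

  Minimality of the annulus forces \<open>\<partial>K\<close> to touch the outer, the inner, the outer and the inner
  homothet in this cyclic order (\<open>alternating_contacts\<close>). Otherwise one arc of angles contains
  all inner contacts and its complement all outer ones. As the polar body of \<open>T\<close> is strictly
  convex, some combination of \<open>cos\<close>, \<open>sin\<close> and \<open>p\<close> changes sign exactly at the ends of that arc;
  subtracting a small multiple of it from \<open>h\<close> amounts to moving the center and shifting both radii by
  the same amount, and makes the annulus thinner.

  Always \<open>- (r - a) p \<le> g \<le> (b - r) p\<close>, with equality on one side at each contact. So, up to the
  sign of \<open>g\<close> and with \<open>R = max (r - a) (b - r)\<close>, the function \<open>g\<close> satisfies \<open>\<bar>g\<bar> \<le> R p\<close>, equals
  \<open>R p\<close> at two angles, and is at most \<open>0\<close> at some angle in each of the two arcs between them. Four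
  zeros of \<open>g\<close> then cut the circle into four arcs. On an arc from a zero \<open>y\<close> to a zero \<open>z\<close> the energy
  is at least minus twice the area of the sector of \<open>R T\<close> between the directions \<open>y - \<pi>/2\<close> and
  \<open>z - \<pi>/2\<close> (\<open>energy_ge_arc\<close>), and if \<open>\<bar>g\<bar> = R p\<close> somewhere on the arc this bound improves by the
  whole area of \<open>R T\<close> (\<open>energy_ge_touching_arc\<close>); here the symmetry of \<open>T\<close> enters. The four sectors
  fill \<open>R T\<close> once, so the two gains outweigh the four losses (\<open>energy_nonneg_alternating\<close>).
\<close>

section \<open>Lipschitz functions and their almost everywhere derivatives\<close>

text \<open>The support function of a convex body fails to be differentiable at the normal angles of the
  segments of its boundary. Being Lipschitz with a derivative off a null set is what survives, it is
  preserved by sums and products, and it is enough for the fundamental theorem of calculus.\<close>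

definition lip_deriv :: "real \<Rightarrow> real \<Rightarrow> (real \<Rightarrow> real) \<Rightarrow> (real \<Rightarrow> real) \<Rightarrow> bool" where
  "lip_deriv a b f f' \<longleftrightarrow> (\<exists>L. L-lipschitz_on {a..b} f) \<and>
     (\<exists>N. negligible N \<and> (\<forall>x\<in>{a<..<b} - N. (f has_real_derivative f' x) (at x)))"

lemma lip_derivI:
  assumes "L-lipschitz_on {a..b} f" "negligible N"
    and "\<And>x. a < x \<Longrightarrow> x < b \<Longrightarrow> x \<notin> N \<Longrightarrow> (f has_real_derivative f' x) (at x)"
  shows "lip_deriv a b f f'"
  unfolding lip_deriv_def using assms by auto

lemma lip_deriv_subinterval:
  assumes "lip_deriv a b f f'" "a \<le> c" "d \<le> b"
  shows "lip_deriv c d f f'"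
proof -
  have "{c..d} \<subseteq> {a..b}" "{c<..<d} \<subseteq> {a<..<b}" using assms by auto
  with assms(1) show ?thesis
    unfolding lip_deriv_def by (meson DiffE DiffI lipschitz_on_subset subsetD)
qed

lemma lip_deriv_continuous: "lip_deriv a b f f' \<Longrightarrow> continuous_on {a..b} f"
  unfolding lip_deriv_def by (auto intro: lipschitz_on_continuous_on)

lemma lip_deriv_bounded:
  assumes "lip_deriv a b f f'"
  obtains B where "\<And>x. x \<in> {a..b} \<Longrightarrow> \<bar>f x\<bar> \<le> B"
proof -
  have "bounded (f ` {a..b})"
    using lip_deriv_continuous[OF assms] compact_continuous_image compact_imp_bounded by blast
  then show thesis using that unfolding bounded_real by (metis imageI)
qed

lemma lip_deriv_add:
  assumes "lip_deriv a b f f'" "lip_deriv a b g g'"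
  shows "lip_deriv a b (\<lambda>x. f x + g x) (\<lambda>x. f' x + g' x)"
proof -
  obtain L M A B where *: "L-lipschitz_on {a..b} f" "M-lipschitz_on {a..b} g" "negligible A" "negligible B"
    "\<forall>x\<in>{a<..<b} - A. (f has_real_derivative f' x) (at x)"
    "\<forall>x\<in>{a<..<b} - B. (g has_real_derivative g' x) (at x)"
    using assms unfolding lip_deriv_def by blast
  show ?thesis
    by (rule lip_derivI[of "L + M" _ _ _ "A \<union> B"])
       (use * in \<open>auto intro!: derivative_intros lipschitz_on_add\<close>)
qed

lemma lip_deriv_mult:
  assumes "lip_deriv a b f f'" "lip_deriv a b g g'"
  shows "lip_deriv a b (\<lambda>x. f x * g x) (\<lambda>x. f' x * g x + f x * g' x)"
proof -
  obtain L M A B where *: "L-lipschitz_on {a..b} f" "M-lipschitz_on {a..b} g" "negligible A" "negligible B"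
    "\<forall>x\<in>{a<..<b} - A. (f has_real_derivative f' x) (at x)"
    "\<forall>x\<in>{a<..<b} - B. (g has_real_derivative g' x) (at x)"
    using assms unfolding lip_deriv_def by blast
  obtain F where F: "\<And>x. x \<in> {a..b} \<Longrightarrow> \<bar>f x\<bar> \<le> F" using lip_deriv_bounded[OF assms(1)] by blast
  obtain G where G: "\<And>x. x \<in> {a..b} \<Longrightarrow> \<bar>g x\<bar> \<le> G" using lip_deriv_bounded[OF assms(2)] by blast
  note nn = lipschitz_on_nonneg[OF *(1)] lipschitz_on_nonneg[OF *(2)]
  have "(L * \<bar>G\<bar> + \<bar>F\<bar> * M)-lipschitz_on {a..b} (\<lambda>x. f x * g x)"
  proof (rule lipschitz_onI)
    fix x y assume xy: "x \<in> {a..b}" "y \<in> {a..b}"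
    have "f x * g x - f y * g y = (f x - f y) * g x + f y * (g x - g y)" by (simp add: algebra_simps)
    then have "\<bar>f x * g x - f y * g y\<bar> \<le> \<bar>f x - f y\<bar> * \<bar>g x\<bar> + \<bar>f y\<bar> * \<bar>g x - g y\<bar>"
      by (metis abs_mult abs_triangle_ineq)
    also have "\<dots> \<le> (L * \<bar>x - y\<bar>) * \<bar>G\<bar> + \<bar>F\<bar> * (M * \<bar>x - y\<bar>)"
      using lipschitz_onD[OF *(1) xy] lipschitz_onD[OF *(2) xy] F[OF xy(2)] G[OF xy(1)] nn
      by (intro add_mono mult_mono) (auto simp: dist_real_def)
    finally show "dist (f x * g x) (f y * g y) \<le> (L * \<bar>G\<bar> + \<bar>F\<bar> * M) * dist x y"
      by (simp add: dist_real_def algebra_simps)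
  qed (use nn in auto)
  then show ?thesis
    by (rule lip_derivI[where N = "A \<union> B"])
       (use * in \<open>auto intro!: derivative_eq_intros simp: mult.commute add.commute\<close>)
qed

lemma lip_deriv_C1:
  assumes "\<And>x. x \<in> {a..b} \<Longrightarrow> (f has_real_derivative f' x) (at x)" "continuous_on {a..b} f'"
  shows "lip_deriv a b f f'"
proof -
  have "bounded (f' ` {a..b})"
    using assms(2) compact_continuous_image compact_imp_bounded by blast
  then obtain B where B: "\<And>x. x \<in> {a..b} \<Longrightarrow> \<bar>f' x\<bar> \<le> B" unfolding bounded_real by (metis imageI)
  have "\<bar>B\<bar>-lipschitz_on {a..b} f"
  proof (rule bounded_derivative_imp_lipschitz)
    show "(f has_derivative (\<lambda>h. f' x * h)) (at x within {a..b})" if "x \<in> {a..b}" for x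
      using assms(1)[OF that] has_field_derivative_def has_derivative_at_withinI by blast
    show "onorm ((*) (f' x)) \<le> \<bar>B\<bar>" if "x \<in> {a..b}" for x
      by (rule onorm_le) (use B[OF that] in \<open>auto simp: abs_mult intro!: mult_right_mono\<close>)
  qed auto
  then show ?thesis
    by (rule lip_derivI[where N = "{}"]) (use assms in auto)
qed

lemma tendsto_mean_value_right:
  assumes "continuous_on UNIV (F :: real \<Rightarrow> real)"
  shows "(\<lambda>n. real (Suc n) * integral {c..c + 1 / real (Suc n)} F) \<longlonglongrightarrow> F c"
proof -
  have "((\<lambda>u. integral {c..u} F) has_vector_derivative F c) (at c within {c..c+1})"
    by (rule integral_has_vector_derivative) (use assms in \<open>auto intro: continuous_on_subset\<close>)
  then have "((\<lambda>y. (integral {c..y} F - integral {c..c} F) / (y - c)) \<longlongrightarrow> F c) (at c within {c..c+1})"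
    by (simp add: has_real_derivative_iff_has_vector_derivative[symmetric] has_field_derivative_iff)
  moreover have "filterlim (\<lambda>n. c + 1 / real (Suc n)) (at c within {c..c+1}) sequentially"
    unfolding filterlim_at
  proof
    have "(\<lambda>n. c + 1 / real (Suc n)) \<longlonglongrightarrow> c + 0"
      by (intro tendsto_intros LIMSEQ_Suc[OF lim_1_over_n])
    then show "(\<lambda>n. c + 1 / real (Suc n)) \<longlonglongrightarrow> c" by simp
  qed (auto simp: field_simps)
  ultimately have "(\<lambda>n. (integral {c..c + 1 / real (Suc n)} F - integral {c..c} F) /
      (c + 1 / real (Suc n) - c)) \<longlonglongrightarrow> F c"
    by (rule filterlim_compose)
  then show ?thesis by (simp add: mult.commute)
qed


text \<open>Extend \<open>f\<close> by constants beyond \<open>[a, b]\<close>. Its difference quotients with step \<open>1/n\<close> are bounded by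
  the Lipschitz constant and converge to \<open>f'\<close> almost everywhere; their integrals telescope to a mean of
  \<open>f\<close> over an interval of length \<open>1/n\<close> to the right of \<open>b\<close> minus one to the right of \<open>a\<close>. Dominated
  convergence identifies the two limits.\<close>

lemma lip_deriv_ftc:
  assumes "a \<le> b" "lip_deriv a b f f'"
  shows "(f' has_integral (f b - f a)) {a..b}"
proof -
  obtain L N where L: "L-lipschitz_on {a..b} f" and N: "negligible N"
    "\<And>x. a < x \<Longrightarrow> x < b \<Longrightarrow> x \<notin> N \<Longrightarrow> (f has_real_derivative f' x) (at x)"
    using assms(2) unfolding lip_deriv_def by auto
  define F where "F = (\<lambda>x. f (max a (min b x)))"
  have LF: "L-lipschitz_on UNIV F"
  proof (rule lipschitz_onI)
    fix x y :: real
    have "dist (F x) (F y) \<le> L * dist (max a (min b x)) (max a (min b y))"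
      unfolding F_def by (rule lipschitz_onD[OF L]) (use assms(1) in auto)
    also have "\<dots> \<le> L * dist x y"
      using lipschitz_on_nonneg[OF L] by (intro mult_left_mono) (auto simp: dist_real_def)
    finally show "dist (F x) (F y) \<le> L * dist x y" .
  qed (rule lipschitz_on_nonneg[OF L])
  have cF: "continuous_on S F" for S
    using lipschitz_on_continuous_on[OF LF] continuous_on_subset by blast
  let ?N = "N \<union> {a,b}"
  define q where "q = (\<lambda>n x. real (Suc n) * (F (x + 1 / real (Suc n)) - F x))"
  define q' where "q' = (\<lambda>n x. if x \<in> ?N then 0 else q n x)"
  define g where "g = (\<lambda>x. if x \<in> ?N then 0 else f' x)"
  have neg: "negligible ?N" using N(1) by (simp add: negligible_insert negligible_Un)
  have cq: "continuous_on {a..b} (q n)" for n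
    unfolding q_def by (intro continuous_intros continuous_on_compose2[OF cF[of UNIV]]) auto
  have iq: "q n integrable_on {a..b}" for n
    using cq by (rule integrable_continuous_real)
  have iq': "q' n integrable_on {a..b}" for n
    by (rule integrable_spike[OF iq neg]) (simp add: q'_def)
  have qint: "integral {a..b} (q' n) = integral {a..b} (q n)" for n
    by (rule integral_spike[OF neg]) (simp add: q'_def)
  have bd: "norm (q' n x) \<le> L" for n x
  proof -
    have "\<bar>F (x + 1 / real (Suc n)) - F x\<bar> \<le> L * (1 / real (Suc n))"
      using lipschitz_onD[OF LF, of "x + 1 / real (Suc n)" x] by (simp add: dist_real_def)
    then have "real (Suc n) * \<bar>F (x + 1 / real (Suc n)) - F x\<bar> \<le> real (Suc n) * (L * (1 / real (Suc n)))"
      by (rule mult_left_mono) simp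
    then have "\<bar>q n x\<bar> \<le> L" unfolding q_def by (simp add: abs_mult)
    then show ?thesis using lipschitz_on_nonneg[OF L] by (simp add: q'_def)
  qed
  have conv: "(\<lambda>n. q' n x) \<longlonglongrightarrow> g x" if x: "x \<in> {a..b}" for x
  proof (cases "x \<in> ?N")
    case False
    with x have ab: "a < x" "x < b" "x \<notin> N" by (auto simp: less_le)
    have "(F has_real_derivative f' x) (at x)"
    proof (rule has_field_derivative_transform_within_open[OF N(2)[OF ab], of "{a<..<b}"])
      show "\<And>y. y \<in> {a<..<b} \<Longrightarrow> f y = F y" by (simp add: F_def)
    qed (use ab in auto)
    then have "((\<lambda>h. (F (x + h) - F x) / h) \<longlongrightarrow> f' x) (at 0)"
      by (simp add: DERIV_def)
    moreover have "filterlim (\<lambda>n. 1 / real (Suc n)) (at 0) sequentially"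
      unfolding filterlim_at using LIMSEQ_Suc[OF lim_1_over_n]
      by (auto simp del: of_nat_Suc)
    ultimately have "(\<lambda>n. (F (x + 1 / real (Suc n)) - F x) / (1 / real (Suc n))) \<longlonglongrightarrow> f' x"
      by (rule filterlim_compose)
    then show ?thesis using False by (simp add: q'_def g_def q_def mult.commute)
  qed (simp add: q'_def g_def)
  note dc = dominated_convergence[of q' "{a..b}" "\<lambda>_. L" g, OF iq' _ bd conv]
  have g: "g integrable_on {a..b}" "(\<lambda>n. integral {a..b} (q n)) \<longlonglongrightarrow> integral {a..b} g"
    using dc by (auto simp: qint)
  have "integral {a..b} (q n) = real (Suc n) * integral {b..b + 1 / real (Suc n)} F
      - real (Suc n) * integral {a..a + 1 / real (Suc n)} F" for n
  proof -
    let ?d = "1 / real (Suc n)"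
    have iF: "F integrable_on {u..v}" for u v using cF by (rule integrable_continuous_real)
    have s: "integral {a..b} (\<lambda>x. F (x + ?d)) = integral {a + ?d..b + ?d} F"
      using integral_shift_real_ivl[where f = F and a = "a + ?d" and b = "b + ?d" and c = "?d"] by simp
    have i2: "(\<lambda>x. F (x + ?d)) integrable_on {a..b}"
      by (intro integrable_continuous_real continuous_on_compose2[OF cF[of UNIV]] continuous_intros) auto
    have "integral {a..a + ?d} F + integral {a + ?d..b + ?d} F = integral {a..b + ?d} F"
      by (rule Henstock_Kurzweil_Integration.integral_combine) (use assms(1) iF in auto)
    moreover have "integral {a..b} F + integral {b..b + ?d} F = integral {a..b + ?d} F"
      by (rule Henstock_Kurzweil_Integration.integral_combine) (use assms(1) iF in auto)
    ultimately have "integral {a + ?d..b + ?d} F - integral {a..b} F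
        = integral {b..b + ?d} F - integral {a..a + ?d} F" by linarith
    moreover have "integral {a..b} (q n) = real (Suc n) * (integral {a..b} (\<lambda>x. F (x + ?d)) - integral {a..b} F)"
      unfolding q_def Henstock_Kurzweil_Integration.integral_diff[OF i2 iF[of a b], symmetric]
      by (rule integral_mult_right)
    ultimately show ?thesis by (simp only: s right_diff_distrib)
  qed
  moreover have "(\<lambda>n. real (Suc n) * integral {b..b + 1 / real (Suc n)} F
      - real (Suc n) * integral {a..a + 1 / real (Suc n)} F) \<longlonglongrightarrow> F b - F a"
    by (intro tendsto_diff tendsto_mean_value_right cF)
  ultimately have "integral {a..b} g = F b - F a"
    using g(2) LIMSEQ_unique by (metis (no_types, lifting) ext)
  then have "(g has_integral (f b - f a)) {a..b}"
    using g(1) assms(1) by (simp add: has_integral_iff F_def)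
  then show ?thesis
    by (rule has_integral_spike[OF neg, rotated]) (simp add: g_def)
qed

text \<open>Off a null set each derivative is bounded by the Lipschitz constant, so the product is a bounded
  measurable function there.\<close>

lemma lip_deriv_prod_integrable:
  assumes "lip_deriv a b f f'" "lip_deriv a b g g'" "a \<le> b"
  shows "(\<lambda>x. f' x * g' x) integrable_on {a..b}"
proof -
  obtain L M A B where *: "L-lipschitz_on {a..b} f" "M-lipschitz_on {a..b} g" "negligible A" "negligible B"
    "\<forall>x\<in>{a<..<b} - A. (f has_real_derivative f' x) (at x)"
    "\<forall>x\<in>{a<..<b} - B. (g has_real_derivative g' x) (at x)"
    using assms unfolding lip_deriv_def by blast
  have bd: "\<bar>u' x\<bar> \<le> C" if "C-lipschitz_on {a..b} u" "x \<in> {a<..<b}" "(u has_real_derivative u' x) (at x)"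
    for u u' C x
  proof -
    have "(\<lambda>h. \<bar>(u (x + h) - u x) / h\<bar>) \<midarrow>0\<rightarrow> \<bar>u' x\<bar>"
      using that(3) by (intro tendsto_rabs) (simp add: DERIV_def)
    moreover have "eventually (\<lambda>h. \<bar>(u (x + h) - u x) / h\<bar> \<le> C) (at 0)"
    proof -
      have "eventually (\<lambda>h. h \<in> {a - x<..<b - x}) (at 0)"
        by (rule eventually_at_in_open') (use that(2) in auto)
      moreover have "eventually (\<lambda>h::real. h \<noteq> 0) (at 0)" by (simp add: eventually_at_filter)
      ultimately show ?thesis
      proof eventually_elim
        case (elim h)
        then have "\<bar>u (x + h) - u x\<bar> \<le> C * \<bar>h\<bar>"
          using lipschitz_onD[OF that(1), of "x + h" x] that(2) by (auto simp: dist_real_def)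
        then show ?case using elim by (simp add: abs_divide field_simps)
      qed
    qed
    ultimately show ?thesis by (rule tendsto_upperbound) auto
  qed
  let ?N = "A \<union> B \<union> {a,b}"
  have neg: "negligible ?N" using *(3,4) by (simp add: negligible_insert negligible_Un)
  have m: "f' \<in> borel_measurable (lebesgue_on {a..b})" "g' \<in> borel_measurable (lebesgue_on {a..b})"
    using lip_deriv_ftc[OF assms(3,1)] lip_deriv_ftc[OF assms(3,2)] integrable_imp_measurable by blast+
  have "(\<lambda>x. f' x * g' x) \<in> borel_measurable (lebesgue_on {a..b})"
    using m by (rule borel_measurable_times)
  then have m': "(\<lambda>x. f' x * g' x) \<in> borel_measurable (lebesgue_on ({a..b} - ?N))"
    by (rule measurable_restrict_mono) auto
  have "(\<lambda>x. f' x * g' x) integrable_on ({a..b} - ?N)"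
  proof (rule measurable_bounded_by_integrable_imp_integrable[OF m'])
    show "(\<lambda>_. L * M) integrable_on ({a..b} - ?N)"
      by (rule integrable_spike_set[of _ "{a..b}"]) (auto intro: negligible_subset[OF neg])
    show "norm (f' x * g' x) \<le> L * M" if "x \<in> {a..b} - ?N" for x
    proof -
      have "x \<in> {a<..<b}" using that by auto
      then have "\<bar>f' x\<bar> \<le> L" "\<bar>g' x\<bar> \<le> M" using that * bd[of L f x f'] bd[of M g x g'] by auto
      then show ?thesis by (simp add: abs_mult mult_mono)
    qed
    have "{a..b} - ?N \<in> sets lebesgue"
      by (intro sets.Diff) (use neg in \<open>auto simp: negligible_iff_null_sets null_sets_def\<close>)
    then show "{a..b} - ?N \<in> sets lebesgue" .
  qed
  then show ?thesis
    by (rule integrable_spike_set) (auto intro: negligible_subset[OF neg])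
qed

section \<open>Lower bounds for the energy\<close>

definition energy :: "real \<Rightarrow> real \<Rightarrow> (real \<Rightarrow> real) \<Rightarrow> (real \<Rightarrow> real) \<Rightarrow> real" where
  "energy a b g g' = integral {a..b} (\<lambda>x. (g' x)\<^sup>2 - (g x)\<^sup>2)"

lemma energy_integrable:
  assumes "lip_deriv a b g g'" "a \<le> b"
  shows "(\<lambda>x. (g' x)\<^sup>2 - (g x)\<^sup>2) integrable_on {a..b}"
proof -
  have "(\<lambda>x. g' x * g' x) integrable_on {a..b}"
    by (rule lip_deriv_prod_integrable[OF assms(1,1,2)])
  moreover have "(\<lambda>x. (g x)\<^sup>2) integrable_on {a..b}"
    by (intro integrable_continuous_real continuous_intros lip_deriv_continuous[OF assms(1)])
  ultimately show ?thesis
    unfolding power2_eq_square by (rule integrable_diff)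
qed

lemma energy_combine:
  assumes "lip_deriv a b g g'" "a \<le> c" "c \<le> b"
  shows "energy a c g g' + energy c b g g' = energy a b g g'"
  unfolding energy_def
  by (rule Henstock_Kurzweil_Integration.integral_combine[OF assms(2,3) energy_integrable])
     (use assms in auto)

text \<open>Legendre's method: for every \<open>l\<close>, the integrand \<open>g'\<^sup>2 - g\<^sup>2\<close> exceeds
  \<open>(l g\<^sup>2)' - (l' + l\<^sup>2 + 1) g\<^sup>2\<close> by the square \<open>(g' - l g)\<^sup>2\<close>. The choice of \<open>l\<close> decides which
  functions \<open>g\<close> are compared with: equality holds for \<open>g' = l g\<close>.\<close>

lemma energy_ge_legendre:
  assumes "a \<le> b" "lip_deriv a b g g'"
    and "\<And>x. x \<in> {a..b} \<Longrightarrow> (l has_real_derivative l' x) (at x)" "continuous_on {a..b} l'"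
  shows "energy a b g g' \<ge> l b * (g b)\<^sup>2 - l a * (g a)\<^sup>2
           - integral {a..b} (\<lambda>x. (l' x + (l x)\<^sup>2 + 1) * (g x)\<^sup>2)"
proof -
  have l: "lip_deriv a b l l'" by (rule lip_deriv_C1[OF assms(3,4)])
  let ?e = "\<lambda>x. (g' x)\<^sup>2 - (g x)\<^sup>2" and ?q = "\<lambda>x. (l' x + (l x)\<^sup>2 + 1) * (g x)\<^sup>2"
    and ?d = "\<lambda>x. l' x * (g x * g x) + l x * (g' x * g x + g x * g' x)"
  have d: "(?d has_integral (l b * (g b * g b) - l a * (g a * g a))) {a..b}"
    by (rule lip_deriv_ftc[OF assms(1) lip_deriv_mult[OF l lip_deriv_mult[OF assms(2,2)]]])
  have e: "(?e has_integral energy a b g g') {a..b}"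
    unfolding energy_def by (rule integrable_integral[OF energy_integrable[OF assms(2,1)]])
  have q: "(?q has_integral integral {a..b} ?q) {a..b}"
    by (intro integrable_integral integrable_continuous_real continuous_intros assms(4)
        lip_deriv_continuous[OF l] lip_deriv_continuous[OF assms(2)])
  have "((\<lambda>x. ?e x - ?d x + ?q x) has_integral
      (energy a b g g' - (l b * (g b * g b) - l a * (g a * g a)) + integral {a..b} ?q)) {a..b}"
    by (intro has_integral_add has_integral_diff e d q)
  moreover have "?e x - ?d x + ?q x = (g' x - l x * g x)\<^sup>2" for x by algebra
  ultimately have "0 \<le> energy a b g g' - (l b * (g b * g b) - l a * (g a * g a)) + integral {a..b} ?q"
    using has_integral_nonneg[of "\<lambda>x. (g' x - l x * g x)\<^sup>2"] by auto
  then show ?thesis by (simp add: power2_eq_square)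
qed

text \<open>The comparison functions are the multiples of \<open>sin (z - x)\<close>, which solve \<open>g'' + g = 0\<close> and vanish
  at \<open>z\<close>. Their logarithmic derivative is singular at \<open>z\<close>, so the zero is first moved to \<open>z + e\<close>.\<close>

lemma energy_ge_cot:
  assumes "a < z" "z < a + pi" "lip_deriv a z g g'" "g z = 0"
  shows "energy a z g g' \<ge> cot (z - a) * (g a)\<^sup>2"
proof -
  have *: "energy a z g g' \<ge> cot (z + e - a) * (g a)\<^sup>2" if e: "0 < e" "e < a + pi - z" for e
  proof -
    let ?l = "\<lambda>x. - cot (z + e - x)" and ?l' = "\<lambda>x. - inverse ((sin (z + e - x))\<^sup>2)"
    have s: "sin (z + e - x) > 0" if "x \<in> {a..z}" for x
      by (rule sin_gt_zero) (use that e in auto)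
    have "energy a z g g' \<ge> ?l z * (g z)\<^sup>2 - ?l a * (g a)\<^sup>2
        - integral {a..z} (\<lambda>x. (?l' x + (?l x)\<^sup>2 + 1) * (g x)\<^sup>2)"
    proof (rule energy_ge_legendre[OF _ assms(3)])
      show "(?l has_real_derivative ?l' x) (at x)" if "x \<in> {a..z}" for x
        by (rule derivative_eq_intros DERIV_cot[THEN DERIV_chain2] refl | use s[OF that] in force)+
      show "continuous_on {a..z} ?l'"
        by (intro continuous_intros) (use s in force)
    qed (use assms in simp)
    moreover have "integral {a..z} (\<lambda>x. (?l' x + (?l x)\<^sup>2 + 1) * (g x)\<^sup>2) = integral {a..z} (\<lambda>_. 0)"
    proof (rule integral_cong)
      fix x assume "x \<in> {a..z}"
      then have nz: "sin (z + e - x) \<noteq> 0" using s by force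
      have "(sin (z + e - x))\<^sup>2 + (cos (z + e - x))\<^sup>2 = 1" by simp
      with nz have "?l' x + (?l x)\<^sup>2 + 1 = 0"
        by (simp add: cot_def field_simps)
      then show "(?l' x + (?l x)\<^sup>2 + 1) * (g x)\<^sup>2 = 0" by simp
    qed
    ultimately show ?thesis using assms(4) by simp
  qed
  have "((\<lambda>e. cot (z + e - a) * (g a)\<^sup>2) \<longlongrightarrow> cot (z + 0 - a) * (g a)\<^sup>2) (at_right 0)"
    by (intro tendsto_intros) (use sin_gt_zero[of "z - a"] assms in auto)
  moreover have "\<forall>\<^sub>F e in at_right 0. cot (z + e - a) * (g a)\<^sup>2 \<le> energy a z g g'"
    unfolding eventually_at_right_field using * assms(2) by (intro exI[of _ "a + pi - z"]) auto
  ultimately have "cot (z + 0 - a) * (g a)\<^sup>2 \<le> energy a z g g'"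
    by (rule tendsto_upperbound) simp
  then show ?thesis by simp
qed

section \<open>Energy relative to a smooth convex curve\<close>

text \<open>Think of \<open>p\<close> as the support function of a convex body with the origin in its interior, whose
  boundary point with normal angle \<open>t\<close> is \<open>X(t) = p(t) (cos t, sin t) + p'(t) (- sin t, cos t)\<close> and has
  radius of curvature \<open>p(t) + p''(t)\<close>. The increment of \<open>J\<close> is twice the area swept by the radius
  from the origin to \<open>X(t)\<close>.\<close>

locale oval =
  fixes p p' p'' J :: "real \<Rightarrow> real"
  assumes dp: "\<And>x. (p has_real_derivative p' x) (at x)"
    and dp': "\<And>x. (p' has_real_derivative p'' x) (at x)"
    and cont: "continuous_on UNIV p''"
    and pos: "\<And>x. p x > 0"
    and curv: "\<And>x. p x + p'' x > 0"
    and dJ: "\<And>x. (J has_real_derivative p x * (p x + p'' x)) (at x)"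
begin

lemma cont_p: "continuous_on S p" and cont_p': "continuous_on S p'" and cont_p'': "continuous_on S p''"
  using dp dp' cont continuous_on_subset
  by (blast intro: DERIV_continuous_on DERIV_subset)+

lemma J_mono: "x \<le> y \<Longrightarrow> J x \<le> J y"
  by (rule DERIV_nonneg_imp_nondecreasing) (use dJ pos curv in \<open>auto intro!: exI mult_nonneg_nonneg less_imp_le\<close>)

text \<open>The equation says that \<open>X(t)\<close> is orthogonal to \<open>(cos z, sin z)\<close>, and the interval for \<open>t\<close> selects the
  point of the curve in direction \<open>z - \<pi>/2\<close>. Equivalently, the multiple of \<open>sin (z - x)\<close> that agrees
  with \<open>p\<close> at \<open>x = t\<close> is tangent to \<open>p\<close> there.\<close>

definition tangent_angle :: "real \<Rightarrow> real \<Rightarrow> bool" where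
  "tangent_angle z t \<longleftrightarrow> z - pi < t \<and> t < z \<and> p' t * sin (z - t) + p t * cos (z - t) = 0"

text \<open>The extremal competitor follows \<open>p\<close> up to the angle \<open>t\<close> and then leaves it along the tangent
  sine that vanishes at \<open>z\<close>. Accordingly Legendre's method is applied with the logarithmic derivative of
  \<open>p\<close> before \<open>t\<close> and with that of the sine after \<open>t\<close>; the two agree at \<open>t\<close>, so the boundary terms
  there cancel.\<close>

lemma energy_ge_before_tangent:
  assumes "a \<le> t" "tangent_angle z t" "lip_deriv a z g g'" "g z = 0"
    and "\<And>x. x \<in> {a..z} \<Longrightarrow> \<bar>g x\<bar> \<le> p x"
  shows "energy a z g g' \<ge> - (p' a / p a) * (g a)\<^sup>2 - (J t - J a)"
proof -
  have t: "t < z" "z < t + pi" and root: "p' t * sin (z - t) + p t * cos (z - t) = 0"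
    using assms(2) by (auto simp: tangent_angle_def)
  have st: "sin (z - t) > 0" by (rule sin_gt_zero) (use t in auto)
  let ?l = "\<lambda>x. p' x / p x" and ?l' = "\<lambda>x. (p'' x * p x - p' x * p' x) / (p x * p x)"
  have nz: "p x \<noteq> 0" for x using pos[of x] by simp
  have "energy a t g g' \<ge> ?l t * (g t)\<^sup>2 - ?l a * (g a)\<^sup>2
        - integral {a..t} (\<lambda>x. (?l' x + (?l x)\<^sup>2 + 1) * (g x)\<^sup>2)"
  proof (rule energy_ge_legendre[OF assms(1)])
    show "lip_deriv a t g g'" by (rule lip_deriv_subinterval[OF assms(3)]) (use t in auto)
    show "(?l has_real_derivative ?l' x) (at x)" for x
      by (rule DERIV_divide[OF dp' dp nz])
    show "continuous_on {a..t} ?l'"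
      by (intro continuous_intros cont_p cont_p' cont_p'') (use nz in auto)
  qed
  moreover have "integral {a..t} (\<lambda>x. (?l' x + (?l x)\<^sup>2 + 1) * (g x)\<^sup>2) \<le> J t - J a"
  proof -
    have "((\<lambda>x. p x * (p x + p'' x)) has_integral J t - J a) {a..t}"
      by (rule fundamental_theorem_of_calculus[OF assms(1)])
         (use dJ in \<open>auto simp: has_real_derivative_iff_has_vector_derivative[symmetric]
            intro: has_field_derivative_at_within\<close>)
    moreover have "(?l' x + (?l x)\<^sup>2 + 1) * (g x)\<^sup>2 \<le> p x * (p x + p'' x)" if "x \<in> {a..t}" for x
    proof -
      have "?l' x + (?l x)\<^sup>2 + 1 = (p x + p'' x) / p x"
        using nz[of x] by (simp add: field_simps power2_eq_square)
      moreover have "(g x)\<^sup>2 \<le> (p x)\<^sup>2"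
        using assms(5)[of x] that t by (simp add: abs_le_square_iff[symmetric])
      then have "(p x + p'' x) / p x * (g x)\<^sup>2 \<le> (p x + p'' x) / p x * (p x)\<^sup>2"
        using pos[of x] curv[of x] by (intro mult_left_mono) auto
      moreover have "(p x + p'' x) / p x * (p x)\<^sup>2 = p x * (p x + p'' x)"
        using nz[of x] by (simp add: power2_eq_square)
      ultimately show ?thesis by simp
    qed
    moreover have "(\<lambda>x. (?l' x + (?l x)\<^sup>2 + 1) * (g x)\<^sup>2) integrable_on {a..t}"
      by (intro integrable_continuous_real continuous_intros cont_p cont_p' cont_p''
          lip_deriv_continuous[OF lip_deriv_subinterval[OF assms(3)]]) (use t nz in auto)
    ultimately show ?thesis
      using integral_le by (metis (no_types, lifting) has_integral_iff)
  qed
  moreover have "energy t z g g' \<ge> cot (z - t) * (g t)\<^sup>2"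
    by (rule energy_ge_cot[OF t lip_deriv_subinterval[OF assms(3)] assms(4)]) (use assms(1) in auto)
  moreover have "cot (z - t) = - ?l t"
    using st nz[of t] root unfolding cot_def by (simp add: field_simps add_eq_0_iff)
  moreover have "energy a t g g' + energy t z g g' = energy a z g g'"
    by (rule energy_combine) (use assms t in auto)
  ultimately show ?thesis by simp
qed

text \<open>The difference of the two sides vanishes at \<open>a = t\<close>, and its derivative in \<open>a\<close> is the square
  \<open>(p cot (z - a) + p')\<^sup>2\<close>.\<close>

lemma cot_ge_after_tangent:
  assumes "t \<le> a" "a < z" "tangent_angle z t"
  shows "(p a)\<^sup>2 * cot (z - a) \<ge> - p a * p' a + (J a - J t)"
proof -
  have t: "t < z" "z < t + pi" and root: "p' t * sin (z - t) + p t * cos (z - t) = 0"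
    using assms(3) by (auto simp: tangent_angle_def)
  define D where "D = (\<lambda>x. (p x)\<^sup>2 * cot (z - x) + p x * p' x - J x)"
  have "D t \<le> D a"
  proof (rule DERIV_nonneg_imp_nondecreasing[OF assms(1)], goal_cases)
    case (1 x)
    have s: "sin (z - x) > 0" by (rule sin_gt_zero) (use 1 t assms in auto)
    have "(D has_real_derivative (2 * p x * p' x * cot (z - x) + (p x)\<^sup>2 * inverse ((sin (z - x))\<^sup>2)
        + (p' x * p' x + p x * p'' x) - p x * (p x + p'' x))) (at x)"
      unfolding D_def
      by (rule derivative_eq_intros dp dp' dJ DERIV_cot[THEN DERIV_chain2] refl | use s in force)+
    moreover have "inverse ((sin (z - x))\<^sup>2) = 1 + (cot (z - x))\<^sup>2"
    proof -
      have "(sin (z - x))\<^sup>2 + (cos (z - x))\<^sup>2 = 1" by simp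
      with s show ?thesis by (simp add: cot_def field_simps)
    qed
    moreover have "2 * p x * p' x * cot (z - x) + (p x)\<^sup>2 * (1 + (cot (z - x))\<^sup>2)
        + (p' x * p' x + p x * p'' x) - p x * (p x + p'' x) = (p x * cot (z - x) + p' x)\<^sup>2"
      by algebra
    ultimately show ?case by (metis zero_le_power2)
  qed
  moreover have "p t * cot (z - t) + p' t = 0"
    using sin_gt_zero[of "z - t"] t root by (simp add: cot_def field_simps)
  then have "D t = - J t"
    unfolding D_def by algebra
  ultimately show ?thesis by (simp add: D_def)
qed

text \<open>One bound for both positions of the contact \<open>a\<close>, before or after the angle \<open>t\<close> at which the
  tangent sine leaves \<open>p\<close>.\<close>

lemma energy_ge_from_touch:
  assumes "a < z" "tangent_angle z t" "lip_deriv a z g g'" "g z = 0"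
    and "\<And>x. x \<in> {a..z} \<Longrightarrow> \<bar>g x\<bar> \<le> p x" "\<bar>g a\<bar> = p a"
  shows "energy a z g g' \<ge> - p a * p' a - (J t - J a)"
proof -
  have sq: "(g a)\<^sup>2 = (p a)\<^sup>2" using assms(6) by (metis power2_abs)
  show ?thesis
  proof (cases "a \<le> t")
    case True
    have "(p' a / p a) * (p a)\<^sup>2 = p a * p' a" using pos[of a] by (simp add: power2_eq_square)
    then show ?thesis
      using energy_ge_before_tangent[OF True assms(2-5)] sq by simp
  next
    case False
    have "cot (z - a) * (p a)\<^sup>2 \<le> energy a z g g'"
      using energy_ge_cot[OF assms(1) _ assms(3,4)] False assms(2) sq
      by (auto simp: tangent_angle_def)
    then show ?thesis
      using cot_ge_after_tangent[OF _ assms(1,2)] False by (simp add: mult.commute)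
  qed
qed

text \<open>The left side of the equation defining \<open>tangent_angle z\<close> increases strictly on \<open>(z - \<pi>, z)\<close>, its
  derivative being \<open>(p + p'') sin (z - x)\<close>, and at the angle \<open>s\<close> belonging to a smaller \<open>y\<close> it is not
  positive.\<close>

lemma tangent_angle_mono:
  assumes "tangent_angle y s" "tangent_angle z t" "y \<le> z"
  shows "s \<le> t"
proof (rule ccontr)
  assume "\<not> s \<le> t"
  then have st: "t < s" by simp
  note ** = assms(1,2)[unfolded tangent_angle_def]
  define m where "m = (\<lambda>x. p' x * sin (z - x) + p x * cos (z - x))"
  have "m t < m s"
  proof (rule DERIV_pos_imp_increasing[OF st], goal_cases)
    case (1 x)
    have "sin (z - x) > 0" by (rule sin_gt_zero) (use 1 ** assms(3) in auto)
    moreover have "(m has_real_derivative (p x + p'' x) * sin (z - x)) (at x)"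
      unfolding m_def
      by (rule derivative_eq_intros dp dp' refl | simp add: algebra_simps)+
    ultimately show ?case using curv[of x] by (metis mult_pos_pos)
  qed
  moreover have "m t = 0" using ** by (simp add: m_def)
  ultimately have "m s > 0" by simp
  moreover have "sin (y - s) > 0" by (rule sin_gt_zero) (use ** in auto)
  moreover have "sin (y - s) * m s = - p s * sin (z - y)"
  proof -
    have "sin (y - s) * m s = (p' s * sin (y - s) + p s * cos (y - s)) * sin (z - s)
        + p s * (sin (y - s) * cos (z - s) - cos (y - s) * sin (z - s))"
      by (simp add: m_def algebra_simps)
    also have "\<dots> = p s * sin ((y - s) - (z - s))"
      using ** by (subst sin_diff) simp
    also have "\<dots> = - p s * sin (z - y)"
      using sin_minus[of "z - y"] by simp
    finally show ?thesis .
  qed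
  moreover have "sin (z - y) \<ge> 0" by (rule sin_ge_zero) (use ** assms(3) st in auto)
  ultimately show False
    using pos[of s] by (metis mult_minus_left mult_nonneg_nonneg mult_pos_pos less_le_not_le neg_0_le_iff_le order_less_imp_le neg_le_0_iff_le)
qed

text \<open>Start the comparison at the zero \<open>y\<close>. If \<open>y\<close> lies before the angle \<open>t\<close> belonging to \<open>z\<close>, the
  estimate up to \<open>t\<close> costs at most \<open>J t - J y\<close>; otherwise the arc is shorter than \<open>\<pi>\<close> and the
  energy is not negative by Wirtinger's inequality.\<close>

lemma energy_ge_arc:
  assumes "y \<le> z" "tangent_angle y s" "tangent_angle z t" "lip_deriv y z g g'" "g y = 0" "g z = 0"
    and "\<And>x. x \<in> {y..z} \<Longrightarrow> \<bar>g x\<bar> \<le> p x"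
  shows "energy y z g g' \<ge> - (J t - J s)"
proof -
  have "s \<le> t" by (rule tangent_angle_mono) fact+
  consider "y = z" | "y < z" "y \<le> t" | "y < z" "t < y" using assms(1) by force
  then show ?thesis
  proof cases
    case 1
    then show ?thesis using J_mono[OF \<open>s \<le> t\<close>] by (simp add: energy_def)
  next
    case 2
    have "energy y z g g' \<ge> - (J t - J y)"
      using energy_ge_before_tangent[OF 2(2) assms(3,4,6,7)] assms(5) by simp
    moreover have "J s \<le> J y" by (rule J_mono) (use assms(2) in \<open>auto simp: tangent_angle_def\<close>)
    ultimately show ?thesis by simp
  next
    case 3
    have "energy y z g g' \<ge> 0"
      using energy_ge_cot[OF 3(1) _ assms(4,6)] 3 assms(3,5) by (auto simp: tangent_angle_def)
    then show ?thesis using J_mono[OF \<open>s \<le> t\<close>] by simp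
  qed
qed

lemma tangent_angle_exists:
  "\<exists>t. tangent_angle z t"
proof -
  define m where "m = (\<lambda>x. p' x * sin (z - x) + p x * cos (z - x))"
  have "m (z - pi) < 0" "0 < m z"
    using pos[of "z - pi"] pos[of z] by (auto simp: m_def)
  moreover have "continuous_on {z - pi..z} m"
    unfolding m_def by (intro continuous_intros cont_p cont_p')
  ultimately obtain t where "z - pi \<le> t" "t \<le> z" "m t = 0"
    using IVT'[of m "z - pi" 0 z] pi_gt_zero by force
  moreover from this have "t \<noteq> z - pi" "t \<noteq> z" using \<open>m (z - pi) < 0\<close> \<open>0 < m z\<close> by auto
  ultimately show ?thesis unfolding tangent_angle_def m_def by (metis less_le)
qed

end

lemma lip_deriv_reflect:
  assumes "lip_deriv a b g g'"
  shows "lip_deriv (- b) (- a) (\<lambda>x. g (- x)) (\<lambda>x. - g' (- x))"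
proof -
  obtain L N where L: "L-lipschitz_on {a..b} g" and N: "negligible N"
    "\<And>x. a < x \<Longrightarrow> x < b \<Longrightarrow> x \<notin> N \<Longrightarrow> (g has_real_derivative g' x) (at x)"
    using assms unfolding lip_deriv_def by auto
  show ?thesis
  proof (rule lip_derivI)
    show "L-lipschitz_on {- b..- a} (\<lambda>x. g (- x))"
    proof (rule lipschitz_onI)
      fix x y assume "x \<in> {- b..- a}" "y \<in> {- b..- a}"
      then show "dist (g (- x)) (g (- y)) \<le> L * dist x y"
        using lipschitz_onD[OF L, of "- x" "- y"] by (auto simp: dist_real_def abs_minus_commute)
    qed (rule lipschitz_on_nonneg[OF L])
    show "negligible (uminus ` N)"
      by (rule negligible_differentiable_image_negligible) (use N(1) in \<open>auto intro: derivative_intros\<close>)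
    show "((\<lambda>x. g (- x)) has_real_derivative - g' (- x)) (at x)"
      if "- b < x" "x < - a" "x \<notin> uminus ` N" for x
    proof -
      have "- x \<notin> N" using that(3) by force
      then have "(g has_real_derivative g' (- x)) (at (- x))" using that by (intro N(2)) auto
      then show ?thesis by (simp add: DERIV_mirror)
    qed
  qed
qed

context oval
begin

lemma oval_reflected: "oval (\<lambda>x. p (- x)) (\<lambda>x. - p' (- x)) (\<lambda>x. p'' (- x)) (\<lambda>x. - J (- x))"
proof
  fix x
  show "((\<lambda>x. p (- x)) has_real_derivative - p' (- x)) (at x)"
    using dp[of "- x"] by (simp add: DERIV_mirror)
  show "((\<lambda>x. - p' (- x)) has_real_derivative p'' (- x)) (at x)"
    using DERIV_minus[of "\<lambda>x. p' (- x)" "- p'' (- x)" x] dp'[of "- x"] by (simp add: DERIV_mirror)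
  show "((\<lambda>x. - J (- x)) has_real_derivative p (- x) * (p (- x) + p'' (- x))) (at x)"
    using DERIV_minus[of "\<lambda>x. J (- x)" "- (p (- x) * (p (- x) + p'' (- x)))" x] dJ[of "- x"] by (simp add: DERIV_mirror)
next
  show "continuous_on UNIV (\<lambda>x. p'' (- x))"
    by (intro continuous_on_compose2[OF cont] continuous_intros) auto
qed (use pos curv in auto)

text \<open>The mirror image of \<open>energy_ge_from_touch\<close>. After the reflection the tangent sine that vanishes at
  \<open>z\<close> leaves \<open>p\<close> to the right of \<open>z\<close>, at the normal angle of the point in direction \<open>z + \<pi>/2\<close>, which
  is the direction attached to \<open>z + \<pi>\<close>.\<close>

lemma energy_ge_to_touch:
  assumes "z < a" "tangent_angle (z + pi) s" "lip_deriv z a g g'" "g z = 0"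
    and "\<And>x. x \<in> {z..a} \<Longrightarrow> \<bar>g x\<bar> \<le> p x" "\<bar>g a\<bar> = p a"
  shows "energy z a g g' \<ge> p a * p' a - (J a - J s)"
proof -
  interpret R: oval "\<lambda>x. p (- x)" "\<lambda>x. - p' (- x)" "\<lambda>x. p'' (- x)" "\<lambda>x. - J (- x)"
    by (rule oval_reflected)
  have e: "z + pi - s = (z - s) + pi" by simp
  have "R.tangent_angle (- z) (- s)"
    using assms(2) unfolding tangent_angle_def R.tangent_angle_def e
    using sin_minus[of "z - s"] cos_minus[of "z - s"] by auto
  then have "energy (- a) (- z) (\<lambda>x. g (- x)) (\<lambda>x. - g' (- x))
      \<ge> - p (- (- a)) * (- p' (- (- a))) - (- J (- (- s)) - (- J (- (- a))))"
    using assms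
    by (intro R.energy_ge_from_touch lip_deriv_reflect) auto
  moreover have "energy (- a) (- z) (\<lambda>x. g (- x)) (\<lambda>x. - g' (- x)) = energy z a g g'"
    unfolding energy_def using Henstock_Kurzweil_Integration.integral_reflect_real[of a z "\<lambda>x. (g' x)\<^sup>2 - (g x)\<^sup>2"] by simp
  ultimately show ?thesis by simp
qed

end

text \<open>For a centrally symmetric body, \<open>J pi - J 0\<close> is twice the area of one half, that is, the area of
  the whole body.\<close>

locale symmetric_oval = oval +
  assumes sym: "\<And>x. p (x + pi) = p x"
begin

lemma p'_add_pi: "p' (x + pi) = p' x"
proof -
  have "((\<lambda>y. p (y + pi)) has_real_derivative p' (x + pi)) (at x)"
    using dp[of "x + pi"] by (simp add: DERIV_shift)
  then show ?thesis using dp[of x] DERIV_unique by (simp add: sym)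
qed

lemma p''_add_pi: "p'' (x + pi) = p'' x"
proof -
  have "((\<lambda>y. p' (y + pi)) has_real_derivative p'' (x + pi)) (at x)"
    using dp'[of "x + pi"] by (simp add: DERIV_shift)
  then show ?thesis using dp'[of x] DERIV_unique by (simp add: p'_add_pi)
qed

lemma J_add_pi: "J (x + pi) = J x + (J pi - J 0)"
proof -
  have "((\<lambda>y. J (y + pi) - J y) has_real_derivative 0) (at y)" for y
  proof -
    have "((\<lambda>y. J (y + pi)) has_real_derivative p (y + pi) * (p (y + pi) + p'' (y + pi))) (at y)"
      using dJ[of "y + pi"] by (simp only: DERIV_shift)
    from DERIV_diff[OF this dJ[of y]] show ?thesis by (simp add: sym p''_add_pi)
  qed
  then have "J (x + pi) - J x = J (0 + pi) - J 0"
    by (intro DERIV_isconst_all[of "\<lambda>y. J (y + pi) - J y"]) auto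
  then show ?thesis by simp
qed

lemma tangent_angle_add_pi: "tangent_angle z t \<Longrightarrow> tangent_angle (z + pi) (t + pi)"
  unfolding tangent_angle_def by (simp add: sym p'_add_pi)

text \<open>The boundary terms \<open>p p'\<close> at the contact \<open>a\<close> cancel between the two sides. What remains is the
  increment of \<open>J\<close> from \<open>s + \<pi>\<close> to \<open>t\<close> instead of from \<open>s\<close> to \<open>t\<close>, which by symmetry is smaller by the
  area of the body.\<close>

lemma energy_ge_touching_arc:
  assumes "y < a" "a < z" "tangent_angle y s" "tangent_angle z t" "lip_deriv y z g g'" "g y = 0" "g z = 0"
    and "\<And>x. x \<in> {y..z} \<Longrightarrow> \<bar>g x\<bar> \<le> p x" "\<bar>g a\<bar> = p a"
  shows "energy y z g g' \<ge> (J pi - J 0) - (J t - J s)"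
proof -
  have "energy y a g g' \<ge> p a * p' a - (J a - J (s + pi))"
    using assms by (intro energy_ge_to_touch tangent_angle_add_pi lip_deriv_subinterval[OF assms(5)]) auto
  moreover have "energy a z g g' \<ge> - p a * p' a - (J t - J a)"
    using assms by (intro energy_ge_from_touch lip_deriv_subinterval[OF assms(5)]) auto
  moreover have "energy y a g g' + energy a z g g' = energy y z g g'"
    by (rule energy_combine) (use assms in auto)
  ultimately show ?thesis using J_add_pi[of s] by simp
qed

text \<open>The zeros between the four given angles cut a full turn into four arcs, two of which contain a
  contact. The increments of \<open>J\<close> add up to twice the area of the body, the gain of the two touching arcs.\<close>

lemma energy_nonneg_alternating:
  assumes ord: "a1 < a2" "a2 < a3" "a3 < a4" "a4 < a1 + 2 * pi"
    and lip: "\<And>u v. lip_deriv u v g g'"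
    and per: "\<And>x. g (x + 2 * pi) = g x" "\<And>x. g' (x + 2 * pi) = g' x"
    and bound: "\<And>x. \<bar>g x\<bar> \<le> p x"
    and top: "g a1 = p a1" "g a3 = p a3" and bot: "g a2 \<le> 0" "g a4 \<le> 0"
  shows "\<exists>c. 0 \<le> energy c (c + 2 * pi) g g'"
proof -
  have cg: "continuous_on S g" for S
  proof -
    have "isCont g x" for x
      using lip_deriv_continuous[OF lip[of "x - 1" "x + 1"]]
      by (intro continuous_on_interior[of "{x - 1..x + 1}"]) auto
    then show ?thesis by (simp add: continuous_at_imp_continuous_on)
  qed
  have t: "g a1 > 0" "g a3 > 0" using top pos by auto
  obtain z1 where z1: "a1 \<le> z1" "z1 \<le> a2" "g z1 = 0"
    using IVT2'[of g a2 0 a1] t bot ord cg by auto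
  obtain z2 where z2: "a2 \<le> z2" "z2 \<le> a3" "g z2 = 0"
    using IVT'[of g a2 0 a3] t bot ord cg by auto
  obtain z3 where z3: "a3 \<le> z3" "z3 \<le> a4" "g z3 = 0"
    using IVT2'[of g a4 0 a3] t bot ord cg by auto
  have "g (a1 + 2 * pi) > 0" using per(1) t by simp
  then obtain z4 where z4: "a4 \<le> z4" "z4 \<le> a1 + 2 * pi" "g z4 = 0"
    using IVT'[of g a4 0 "a1 + 2 * pi"] bot ord cg by auto
  define z0 where "z0 = z4 - 2 * pi"
  have g0: "g z0 = 0" using per(1)[of z0] z4 by (simp add: z0_def)
  obtain s0 where s0: "tangent_angle z0 s0" using tangent_angle_exists by blast
  obtain s1 where s1: "tangent_angle z1 s1" using tangent_angle_exists by blast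
  obtain s2 where s2: "tangent_angle z2 s2" using tangent_angle_exists by blast
  obtain s3 where s3: "tangent_angle z3 s3" using tangent_angle_exists by blast
  (* The angle for z4 is taken as that of z0 plus a full turn, so that the increments of J telescope. *)
  have s4: "tangent_angle z4 (s0 + pi + pi)"
    using tangent_angle_add_pi[OF tangent_angle_add_pi[OF s0]] by (simp add: z0_def)
  have ne: "z0 < a1" "a1 < z1" "z2 < a3" "a3 < z3"
    using g0 z1 z2 z3 z4 t by (auto simp: z0_def less_le)
  define al where "al = J pi - J 0"
  have "energy z0 z1 g g' \<ge> al - (J s1 - J s0)"
    by (rule energy_ge_touching_arc[folded al_def, OF ne(1,2) s0 s1 lip g0 z1(3) bound]) (use top pos[of a1] in simp)
  moreover have "energy z1 z2 g g' \<ge> - (J s2 - J s1)"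
    by (rule energy_ge_arc[OF _ s1 s2 lip z1(3) z2(3) bound]) (use z1 z2 in simp)
  moreover have "energy z2 z3 g g' \<ge> al - (J s3 - J s2)"
    by (rule energy_ge_touching_arc[folded al_def, OF ne(3,4) s2 s3 lip z2(3) z3(3) bound]) (use top pos[of a3] in simp)
  moreover have "energy z3 z4 g g' \<ge> - (J (s0 + pi + pi) - J s3)"
    by (rule energy_ge_arc[OF _ s3 s4 lip z3(3) z4(3) bound]) (use z3 z4 in simp)
  moreover have "energy z0 z1 g g' + energy z1 z2 g g' = energy z0 z2 g g'"
    "energy z0 z2 g g' + energy z2 z3 g g' = energy z0 z3 g g'"
    "energy z0 z3 g g' + energy z3 z4 g g' = energy z0 z4 g g'"
    by (rule energy_combine[OF lip]; use z1 z2 z3 z4 ne in simp)+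
  moreover have "J (s0 + pi + pi) = J s0 + 2 * al" using J_add_pi[of s0] J_add_pi[of "s0 + pi"] by (simp add: al_def)
  ultimately have "0 \<le> energy z0 z4 g g'" by linarith
  then show ?thesis by (intro exI[of _ z0]) (simp add: z0_def)
qed

end

section \<open>Support functions\<close>

lemma inner_dir: "(x::real^2) \<bullet> dir \<theta> = x$1 * cos \<theta> + x$2 * sin \<theta>"
  by (simp add: inner_real2 dir_def)

lemma dir_add_2pi: "dir (\<theta> + 2 * pi) = dir \<theta>"
  by (simp add: dir_def)

lemma dist_dir_le: "norm (dir a - dir b) \<le> \<bar>a - b\<bar>"
proof -
  have "(norm (dir a - dir b))\<^sup>2 = (cos a - cos b)\<^sup>2 + (sin a - sin b)\<^sup>2"
    unfolding power2_norm_eq_inner inner_real2 dir_def by (simp add: power2_eq_square)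
  also have "\<dots> = ((sin a)\<^sup>2 + (cos a)\<^sup>2) + ((sin b)\<^sup>2 + (cos b)\<^sup>2) - 2 * cos (a - b)"
    unfolding cos_diff by algebra
  also have "\<dots> = 2 - 2 * cos (a - b)" by simp
  also have "cos (a - b) = cos (2 * ((a - b) / 2))" by (rule arg_cong[of _ _ cos]) (simp add: field_simps)
  also have "2 - 2 * cos (2 * ((a - b) / 2)) = (2 * sin ((a - b) / 2))\<^sup>2" by (subst cos_double_sin) (simp add: power2_eq_square)
  also have "\<dots> \<le> (a - b)\<^sup>2"
  proof -
    have "\<bar>2 * sin ((a - b) / 2)\<bar> \<le> \<bar>a - b\<bar>" using abs_sin_x_le_abs_x[of "(a - b) / 2"] by simp
    then show ?thesis by (simp only: abs_le_square_iff)
  qed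
  finally show ?thesis by (simp add: abs_le_square_iff[symmetric])
qed

text \<open>Between two normal directions less than \<open>\<pi>\<close> apart, a direction is a nonnegative combination of the two;
  inequalities for support functions at the two ends pass to the angles between them.\<close>

lemma dir_combination: "sin (b - a) *\<^sub>R dir \<theta> = sin (b - \<theta>) *\<^sub>R dir a + sin (\<theta> - a) *\<^sub>R dir b"
proof -
  have "sin (b - a) * cos \<theta> = sin (b - \<theta>) * cos a + sin (\<theta> - a) * cos b"
    "sin (b - a) * sin \<theta> = sin (b - \<theta>) * sin a + sin (\<theta> - a) * sin b"
    unfolding sin_diff by (simp_all add: algebra_simps)
  then show ?thesis by (simp add: dir_def vec_eq_iff forall_2)
qed

lemma polar_form:
  obtains \<phi> where "(x::real^2) = norm x *\<^sub>R dir \<phi>"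
proof (cases "x = 0")
  case False
  then have n: "norm x \<noteq> 0" by simp
  have "(norm x)\<^sup>2 = (x$1)\<^sup>2 + (x$2)\<^sup>2"
    unfolding power2_norm_eq_inner inner_real2 by (simp add: power2_eq_square)
  then have "((x$1)\<^sup>2 + (x$2)\<^sup>2) / (norm x)\<^sup>2 = 1"
    using n by (metis divide_self power_not_zero)
  then have "(x$1 / norm x)\<^sup>2 + (x$2 / norm x)\<^sup>2 = 1"
    by (simp only: power_divide add_divide_distrib)
  then obtain t where "x$1 / norm x = cos t" "x$2 / norm x = sin t" using sincos_total_2pi by metis
  then have "x$1 = norm x * cos t" "x$2 = norm x * sin t" using n by (simp_all add: field_simps)
  then show ?thesis by (intro that[of t]) (simp add: vec_eq_iff forall_2 dir_def)
qed (use that in simp)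

lemma
  assumes "compact K" "K \<noteq> {}"
  shows support_upper: "x \<in> K \<Longrightarrow> (x - c) \<bullet> dir \<theta> \<le> support K c \<theta>"
    and support_attained: "\<exists>x\<in>K. (x - c) \<bullet> dir \<theta> = support K c \<theta>"
proof -
  have "continuous_on K (\<lambda>x. (x - c) \<bullet> dir \<theta>)" by (intro continuous_intros)
  then obtain m where m: "m \<in> K" "\<And>x. x \<in> K \<Longrightarrow> (x - c) \<bullet> dir \<theta> \<le> (m - c) \<bullet> dir \<theta>"
    using continuous_attains_sup[OF assms] by blast
  then have "support K c \<theta> = (m - c) \<bullet> dir \<theta>"
    unfolding support_def by (intro cSup_eq_maximum) auto
  then show "x \<in> K \<Longrightarrow> (x - c) \<bullet> dir \<theta> \<le> support K c \<theta>" "\<exists>x\<in>K. (x - c) \<bullet> dir \<theta> = support K c \<theta>"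
    using m by auto
qed

lemma support_le_iff:
  assumes "compact K" "K \<noteq> {}"
  shows "support K c \<theta> \<le> s \<longleftrightarrow> (\<forall>x\<in>K. (x - c) \<bullet> dir \<theta> \<le> s)"
  using support_upper[OF assms, of _ c \<theta>] support_attained[OF assms, of c \<theta>] by fastforce

lemma support_eq_origin:
  assumes "compact K" "K \<noteq> {}"
  shows "support K c \<theta> = support K 0 \<theta> - c \<bullet> dir \<theta>"
proof (rule antisym)
  show "support K c \<theta> \<le> support K 0 \<theta> - c \<bullet> dir \<theta>"
    using support_upper[OF assms, of _ 0 \<theta>] by (subst support_le_iff[OF assms]) (auto simp: inner_diff_left)
  obtain x where "x \<in> K" "(x - 0) \<bullet> dir \<theta> = support K 0 \<theta>" using support_attained[OF assms] by blast
  then show "support K 0 \<theta> - c \<bullet> dir \<theta> \<le> support K c \<theta>"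
    using support_upper[OF assms, of x c \<theta>] by (simp add: inner_diff_left)
qed

lemma support_add_2pi: "support K c (\<theta> + 2 * pi) = support K c \<theta>"
  by (simp only: support_def dir_add_2pi)

lemma deriv_periodic:
  assumes "\<And>x. f (x + T) = f (x :: real)"
  shows "deriv f (x + T) = deriv f x"
  by (simp add: deriv_def DERIV_shift assms)

lemma support_lipschitz:
  assumes "compact K" "K \<noteq> {}"
  shows "\<exists>L. \<forall>S. L-lipschitz_on S (support K c)"
proof -
  obtain R where R: "\<And>x. x \<in> K \<Longrightarrow> norm (x - c) \<le> R"
  proof -
    have "bounded ((\<lambda>x. x - c) ` K)" using assms(1) by (intro compact_imp_bounded compact_continuous_image continuous_intros)
    then show thesis using that unfolding bounded_iff by (metis imageI)
  qed
  have R0: "0 \<le> R" using R assms(2) by (metis all_not_in_conv norm_ge_zero order_trans)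
  have le: "support K c a - support K c b \<le> R * \<bar>a - b\<bar>" for a b
  proof -
    obtain x where x: "x \<in> K" "(x - c) \<bullet> dir a = support K c a" using support_attained[OF assms] by blast
    have "support K c a - support K c b \<le> (x - c) \<bullet> (dir a - dir b)"
      using x(2) support_upper[OF assms x(1), of c b] by (simp add: inner_diff_right)
    also have "\<dots> \<le> norm (x - c) * norm (dir a - dir b)" by (rule norm_cauchy_schwarz)
    also have "\<dots> \<le> R * \<bar>a - b\<bar>" by (intro mult_mono R x(1) dist_dir_le R0) auto
    finally show ?thesis .
  qed
  have "R-lipschitz_on S (support K c)" for S
  proof (rule lipschitz_onI)
    show "dist (support K c a) (support K c b) \<le> R * dist a b" for a b
      using le[of a b] le[of b a] by (simp add: dist_real_def abs_le_iff abs_minus_commute[of b a])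
  qed (rule R0)
  then show ?thesis by blast
qed

lemma continuous_on_support: "compact K \<Longrightarrow> K \<noteq> {} \<Longrightarrow> continuous_on S (support K c)"
  using support_lipschitz lipschitz_on_continuous_on by blast

text \<open>Adding \<open>R \<theta>\<^sup>2 / 2\<close>, where \<open>R\<close> bounds \<open>K\<close>, turns each function \<open>(x - c) \<bullet> dir \<theta>\<close> into a convex
  one, and so their supremum. A point of \<open>K\<close> attaining the support function yields a subgradient, which
  is monotone in \<open>\<theta>\<close> and therefore continuous off a countable set; where it is continuous, the difference
  quotients are squeezed between its values.\<close>

lemma support_differentiable_off_countable:
  assumes "compact K" "K \<noteq> {}"
  shows "countable {\<theta>. \<not> support K c differentiable at \<theta>}"
proof -
  obtain R where R: "\<And>x. x \<in> K \<Longrightarrow> norm (x - c) \<le> R"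
  proof -
    have "bounded ((\<lambda>x. x - c) ` K)" using assms(1) by (intro compact_imp_bounded compact_continuous_image continuous_intros)
    then show thesis using that unfolding bounded_iff by (metis imageI)
  qed
  obtain X where X: "\<And>\<theta>. X \<theta> \<in> K" "\<And>\<theta>. (X \<theta> - c) \<bullet> dir \<theta> = support K c \<theta>"
    using support_attained[OF assms] by metis
  define H where "H = (\<lambda>\<theta>. support K c \<theta> + R * \<theta>\<^sup>2 / 2)"
  define k where "k = (\<lambda>\<theta>. (X \<theta> - c)$2 * cos \<theta> - (X \<theta> - c)$1 * sin \<theta> + R * \<theta>)"
  have sub: "H \<psi> - H \<theta> \<ge> k \<theta> * (\<psi> - \<theta>)" for \<theta> \<psi>
  proof -
    define y where "y = X \<theta> - c"
    define f where "f = (\<lambda>t. y \<bullet> dir t + R * t\<^sup>2 / 2)"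
    define f' where "f' = (\<lambda>t. y$2 * cos t - y$1 * sin t + R * t)"
    have f': "(f has_real_derivative f' t) (at t)" for t
      unfolding f_def f'_def inner_dir by (rule derivative_eq_intros refl | simp)+
    have f'': "(f' has_real_derivative (R - y \<bullet> dir t)) (at t)" for t
      unfolding f'_def inner_dir by (rule derivative_eq_intros refl | simp)+
    have "R - y \<bullet> dir t \<ge> 0" for t
      using norm_cauchy_schwarz[of y "dir t"] R[OF X(1)[of \<theta>]] by (simp add: y_def)
    then have "convex_on UNIV f"
      by (intro f''_ge0_imp_convex[of UNIV f f' "\<lambda>t. R - y \<bullet> dir t"]) (use f' f'' in auto)
    then have "f \<psi> - f \<theta> \<ge> f' \<theta> * (\<psi> - \<theta>)"
      by (rule convex_on_imp_above_tangent) (use f' in auto)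
    moreover have "f \<psi> \<le> H \<psi>" using support_upper[OF assms X(1)] by (simp add: f_def H_def y_def)
    moreover have "f \<theta> = H \<theta>" using X(2) by (simp add: f_def H_def y_def)
    ultimately show ?thesis by (simp add: f'_def k_def y_def)
  qed
  have "mono k"
  proof (rule monoI)
    fix a b :: real assume "a \<le> b"
    show "k a \<le> k b"
    proof (cases "a = b")
      case False
      have "k a * (b - a) \<le> k b * (b - a)" using sub[of b a] sub[of a b] by (simp add: algebra_simps)
      then show ?thesis using False \<open>a \<le> b\<close> by simp
    qed simp
  qed
  then have "countable {a. \<not> isCont k a}" by (rule mono_ctble_discont)
  moreover have "support K c differentiable at \<theta>" if ck: "isCont k \<theta>" for \<theta>
  proof -
    have "((\<lambda>h. (H (\<theta> + h) - H \<theta>) / h) \<longlongrightarrow> k \<theta>) (at 0)"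
    proof (rule tendsto_sandwich[of "\<lambda>h. min (k \<theta>) (k (\<theta> + h))" _ _ "\<lambda>h. max (k \<theta>) (k (\<theta> + h))"])
      have "(\<lambda>h. k (\<theta> + h)) \<midarrow>0\<rightarrow> k \<theta>" using ck by (simp add: isCont_iff)
      then show "(\<lambda>h. min (k \<theta>) (k (\<theta> + h))) \<midarrow>0\<rightarrow> k \<theta>" "(\<lambda>h. max (k \<theta>) (k (\<theta> + h))) \<midarrow>0\<rightarrow> k \<theta>"
        using tendsto_min[OF tendsto_const[of "k \<theta>"]] tendsto_max[OF tendsto_const[of "k \<theta>"]] by fastforce+
      have *: "min (k \<theta>) (k (\<theta> + h)) \<le> (H (\<theta> + h) - H \<theta>) / h \<and> (H (\<theta> + h) - H \<theta>) / h \<le> max (k \<theta>) (k (\<theta> + h))"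
        if "h \<noteq> 0" for h
      proof -
        have "H (\<theta> + h) - H \<theta> \<ge> k \<theta> * h" "H (\<theta> + h) - H \<theta> \<le> k (\<theta> + h) * h"
          using sub[of \<theta> "\<theta> + h"] sub[of "\<theta> + h" \<theta>] by auto
        then have "if h > 0 then k \<theta> \<le> (H (\<theta> + h) - H \<theta>) / h \<and> (H (\<theta> + h) - H \<theta>) / h \<le> k (\<theta> + h)
            else k (\<theta> + h) \<le> (H (\<theta> + h) - H \<theta>) / h \<and> (H (\<theta> + h) - H \<theta>) / h \<le> k \<theta>"
          using that by (auto simp: pos_le_divide_eq pos_divide_le_eq neg_le_divide_eq neg_divide_le_eq)
        then show ?thesis by (auto split: if_splits)
      qed
      show "\<forall>\<^sub>F h in at 0. min (k \<theta>) (k (\<theta> + h)) \<le> (H (\<theta> + h) - H \<theta>) / h"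
        "\<forall>\<^sub>F h in at 0. (H (\<theta> + h) - H \<theta>) / h \<le> max (k \<theta>) (k (\<theta> + h))"
        using * by (auto simp: eventually_at_filter)
    qed
    then have d: "(H has_real_derivative k \<theta>) (at \<theta>)" by (simp add: DERIV_def)
    have "((\<lambda>t. H t - R * t\<^sup>2 / 2) has_real_derivative (k \<theta> - R * \<theta>)) (at \<theta>)"
      using d by (rule DERIV_diff) (auto intro!: derivative_eq_intros)
    then have "(support K c has_real_derivative (k \<theta> - R * \<theta>)) (at \<theta>)"
      by (simp add: H_def)
    then show ?thesis using real_differentiable_def by blast
  qed
  ultimately show ?thesis by (metis (mono_tags, lifting) Collect_mono countable_subset)
qed

lemma support_lip_deriv:
  assumes "compact K" "K \<noteq> {}"
  shows "lip_deriv a b (support K c) (deriv (support K c))"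
proof -
  obtain L where "L-lipschitz_on {a..b} (support K c)" using support_lipschitz[OF assms] by blast
  then show ?thesis
  proof (rule lip_derivI)
    show "negligible {\<theta>. \<not> support K c differentiable at \<theta>}"
      using support_differentiable_off_countable[OF assms]
      by (simp add: negligible_iff_null_sets null_sets_completionI countable_imp_null_set_lborel)
    show "(support K c has_real_derivative deriv (support K c) x) (at x)"
      if "x \<notin> {\<theta>. \<not> support K c differentiable at \<theta>}" for x
      using that by (simp add: DERIV_deriv_iff_real_differentiable)
  qed
qed

lemma periodic_of_int:
  assumes "\<And>x. f (x + T) = f (x :: real)"
  shows "f (x + of_int k * T) = f x"
proof -
  have n: "f (x + of_nat n * T) = f x" for n x
  proof (induction n)
    case (Suc n)
    have "f (x + of_nat (Suc n) * T) = f ((x + of_nat n * T) + T)" by (simp add: algebra_simps)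
    then show ?case by (simp only: assms Suc)
  qed simp
  show ?thesis
  proof (cases "k \<ge> 0")
    case True
    then show ?thesis using n[of x "nat k"] by simp
  next
    case False
    then show ?thesis using n[of "x + of_int k * T" "nat (- k)"] by simp
  qed
qed

lemma periodic_representative:
  assumes "\<And>x. f (x + T) = f (x :: real)" "T > 0"
  obtains k :: int where "f (x + of_int k * T) = f x" "c \<le> x + of_int k * T" "x + of_int k * T < c + T"
proof -
  define k where "k = - \<lfloor>(x - c) / T\<rfloor>"
  have "of_int (- k) \<le> (x - c) / T" "(x - c) / T < of_int (- k) + 1"
    using floor_correct[of "(x - c) / T"] by (auto simp: k_def)
  then have "of_int (- k) * T \<le> x - c" "x - c < (of_int (- k) + 1) * T"
    using assms(2) by (simp_all only: pos_le_divide_eq pos_divide_less_eq)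
  then have "c \<le> x + of_int k * T" "x + of_int k * T < c + T" by (simp_all add: algebra_simps)
  then show thesis using that periodic_of_int[of f, OF assms(1)] by blast
qed

lemma integral_periodic:
  fixes f :: "real \<Rightarrow> real"
  assumes "\<And>x. f (x + T) = (f x :: real)" "\<And>u v. f integrable_on {u..v}" "T > 0"
  shows "integral {c..c + T} f = integral {0..T} f"
proof -
  define k where "k = \<lfloor>c / T\<rfloor>"
  define r where "r = c - of_int k * T"
  have "of_int k \<le> c / T" "c / T \<le> of_int k + 1"
    using floor_correct[of "c / T"] by (auto simp: k_def)
  then have r: "0 \<le> r" "r \<le> T"
    using assms(3) by (auto simp: r_def pos_le_divide_eq pos_divide_le_eq algebra_simps)
  have "integral {c..c + T} f = integral {r..r + T} (\<lambda>x. f (x + of_int k * T))"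
    using integral_shift_real_ivl[where f = f and a = c and b = "c + T" and c = "of_int k * T"]
    by (simp add: r_def algebra_simps)
  also have "\<dots> = integral {r..r + T} f" by (simp add: periodic_of_int[of f, OF assms(1)])
  also have "\<dots> = integral {r..T} f + integral {T..r + T} f"
    using r assms by (intro Henstock_Kurzweil_Integration.integral_combine[symmetric]) auto
  also have "integral {T..r + T} f = integral {0..r} (\<lambda>x. f (x + T))"
    using integral_shift_real_ivl[where f = f and a = T and b = "r + T" and c = T] by simp
  also have "\<dots> = integral {0..r} f" by (simp add: assms(1))
  also have "integral {r..T} f + integral {0..r} f = integral {0..T} f"
    using Henstock_Kurzweil_Integration.integral_combine[of 0 r T f] r assms by simp
  finally show ?thesis .
qed

section \<open>The area is at most minus half the energy of the support function\<close>

definition tan_dir :: "real \<Rightarrow> real^2" where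
  "tan_dir \<theta> = dir (\<theta> + pi / 2)"

lemma tan_dir_nth: "tan_dir \<theta> $ 1 = - sin \<theta>" "tan_dir \<theta> $ 2 = cos \<theta>"
  by (simp_all add: tan_dir_def dir_def cos_add sin_add)

lemma dir_nth: "dir \<theta> $ 1 = cos \<theta>" "dir \<theta> $ 2 = sin \<theta>"
  by (simp_all add: dir_def)

lemma dir_shift: "dir (\<theta> + d) = cos d *\<^sub>R dir \<theta> + sin d *\<^sub>R tan_dir \<theta>"
  by (simp add: vec_eq_iff forall_2 dir_nth tan_dir_nth cos_add sin_add mult.commute)

lemma orthonormal_expansion: "(y::real^2) = (y \<bullet> dir \<theta>) *\<^sub>R dir \<theta> + (y \<bullet> tan_dir \<theta>) *\<^sub>R tan_dir \<theta>"
proof -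
  have 1: "(sin \<theta>)\<^sup>2 + (cos \<theta>)\<^sup>2 = 1" by simp
  have "(y$1 * cos \<theta> + y$2 * sin \<theta>) * cos \<theta> + (y$1 * (- sin \<theta>) + y$2 * cos \<theta>) * (- sin \<theta>) = y$1"
    "(y$1 * cos \<theta> + y$2 * sin \<theta>) * sin \<theta> + (y$1 * (- sin \<theta>) + y$2 * cos \<theta>) * cos \<theta> = y$2"
    using 1 by algebra+
  then show ?thesis by (simp add: vec_eq_iff forall_2 inner_real2 dir_nth tan_dir_nth)
qed

text \<open>For the polygon whose sides lie on the tangent lines with normal angles spaced by \<open>d\<close>, this is the
  triangle spanned by the origin and the side with normal angle \<open>\<theta>\<close>: the two coefficients of
  \<open>tan_dir \<theta>\<close> are the positions of the intersections with the two neighbouring tangent lines.\<close>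

definition tangent_triangle :: "(real \<Rightarrow> real) \<Rightarrow> real \<Rightarrow> real \<Rightarrow> (real^2) set" where
  "tangent_triangle h d \<theta> = convex hull {0,
     h \<theta> *\<^sub>R dir \<theta> + ((h \<theta> * cos d - h (\<theta> - d)) / sin d) *\<^sub>R tan_dir \<theta>,
     h \<theta> *\<^sub>R dir \<theta> + ((h (\<theta> + d) - h \<theta> * cos d) / sin d) *\<^sub>R tan_dir \<theta>}"

lemma measure_tangent_triangle:
  "measure lborel (tangent_triangle h d \<theta>) = \<bar>h \<theta> * (h (\<theta> + d) + h (\<theta> - d) - 2 * h \<theta> * cos d) / sin d\<bar> / 2"
proof -
  define s t where "s = (h \<theta> * cos d - h (\<theta> - d)) / sin d" and "t = (h (\<theta> + d) - h \<theta> * cos d) / sin d"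
  have 1: "(sin \<theta>)\<^sup>2 + (cos \<theta>)\<^sup>2 = 1" by simp
  have "((h \<theta> * cos \<theta> + t * - sin \<theta>) - 0) * ((h \<theta> * sin \<theta> + s * cos \<theta>) - 0)
      - ((h \<theta> * cos \<theta> + s * - sin \<theta>) - 0) * ((h \<theta> * sin \<theta> + t * cos \<theta>) - 0) = - (h \<theta> * (t - s))"
    using 1 by algebra
  moreover have "h \<theta> * (t - s) = h \<theta> * (h (\<theta> + d) + h (\<theta> - d) - 2 * h \<theta> * cos d) / sin d"
    unfolding s_def t_def by (simp add: diff_divide_distrib[symmetric] algebra_simps)
  ultimately show ?thesis
    unfolding tangent_triangle_def s_def[symmetric] t_def[symmetric] content_triangle
    by (simp add: dir_nth tan_dir_nth)
qed

lemma mem_tangent_triangle: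
  assumes y: "y \<bullet> dir \<theta> = h \<theta>" "y \<bullet> dir (\<theta> + d) \<le> h (\<theta> + d)" "y \<bullet> dir (\<theta> - d) \<le> h (\<theta> - d)"
    and d: "sin d > 0" and m: "0 \<le> m" "m \<le> 1"
  shows "m *\<^sub>R y \<in> tangent_triangle h d \<theta>"
proof -
  define s t where "s = (h \<theta> * cos d - h (\<theta> - d)) / sin d" and "t = (h (\<theta> + d) - h \<theta> * cos d) / sin d"
  define r where "r = y \<bullet> tan_dir \<theta>"
  have ye: "y = h \<theta> *\<^sub>R dir \<theta> + r *\<^sub>R tan_dir \<theta>"
    using orthonormal_expansion[of y \<theta>] y(1) by (simp add: r_def)
  have "dir (\<theta> - d) = cos d *\<^sub>R dir \<theta> - sin d *\<^sub>R tan_dir \<theta>"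
    using dir_shift[of \<theta> "- d"] by simp
  then have "h \<theta> * cos d - r * sin d \<le> h (\<theta> - d)" "h \<theta> * cos d + r * sin d \<le> h (\<theta> + d)"
    using y by (simp_all add: dir_shift[of \<theta> d] inner_add_right inner_diff_right r_def mult.commute)
  then have "s \<le> r" "r \<le> t"
    using d by (simp_all add: s_def t_def pos_le_divide_eq pos_divide_le_eq algebra_simps)
  then have "r \<in> closed_segment s t" by (simp add: closed_segment_eq_real_ivl)
  then obtain l where l: "0 \<le> l" "l \<le> 1" "r = (1 - l) * s + l * t" by (auto simp: closed_segment_def)
  let ?v = "\<lambda>r. h \<theta> *\<^sub>R dir \<theta> + r *\<^sub>R tan_dir \<theta>"
  have "m *\<^sub>R y = (1 - m) *\<^sub>R 0 + (m * (1 - l)) *\<^sub>R ?v s + (m * l) *\<^sub>R ?v t"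
    unfolding ye l(3) by (simp add: algebra_simps)
  moreover have "0 \<le> m * (1 - l)" "0 \<le> m * l" "0 \<le> 1 - m" using m l by auto
  moreover have "(1 - m) + m * (1 - l) + m * l = 1" by (simp add: algebra_simps)
  ultimately show ?thesis
    unfolding tangent_triangle_def s_def[symmetric] t_def[symmetric] convex_hull_3 by blast
qed

text \<open>Given \<open>x\<close>, choose the tangent line for which \<open>x \<bullet> dir \<theta> / h \<theta>\<close> is largest, say \<open>m\<close>. Then \<open>x / m\<close>
  lies on this line and violates none of the other inequalities, so it belongs to the side of the polygon
  on this line.\<close>

lemma covered_by_tangent_triangles:
  fixes h :: "real \<Rightarrow> real"
  assumes n: "n \<ge> 5" and d: "d = 2 * pi / real n"
    and h: "\<And>\<theta>. h \<theta> > 0" "\<And>\<theta>. h (\<theta> + 2 * pi) = h \<theta>"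
    and K: "\<And>x \<theta>. x \<in> K \<Longrightarrow> x \<bullet> dir \<theta> \<le> h \<theta>"
  shows "K \<subseteq> (\<Union>i<n. tangent_triangle h d (c + real i * d))"
proof
  fix x assume x: "x \<in> K"
  have d0: "0 < d" "d < pi / 2" using n pi_gt_zero by (auto simp: d field_simps)
  have sd: "sin d > 0" by (rule sin_gt_zero) (use d0 in auto)
  have nd: "real n * d = 2 * pi" using n by (simp add: d)
  define f where "f = (\<lambda>\<theta>. x \<bullet> dir \<theta> / h \<theta>)"
  have fp: "f (\<theta> + 2 * pi) = f \<theta>" for \<theta> by (simp add: f_def dir_add_2pi h)
  define t where "t = (\<lambda>k::int. c + of_int k * d)"
  have fmod: "f (t k) = f (t (k mod int n))" for k
  proof -
    have "t k = t (k mod int n) + of_int (k div int n) * (2 * pi)"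
    proof -
      have "of_int k = of_int (k mod int n) + of_int (k div int n) * real n"
        by (metis add.commute mult_div_mod_eq mult.commute of_int_add of_int_mult of_int_of_nat_eq)
      then show ?thesis by (simp only: t_def distrib_right mult.assoc nd)
    qed
    then show ?thesis using periodic_of_int[of f, OF fp] by metis
  qed
  obtain i where i: "i < n" "\<And>j. j < n \<Longrightarrow> f (t (int j)) \<le> f (t (int i))"
  proof -
    have fin: "finite ((\<lambda>j. f (t (int j))) ` {..<n})" "(\<lambda>j. f (t (int j))) ` {..<n} \<noteq> {}"
      using n by (auto simp: lessThan_empty_iff)
    obtain i where "i < n" "Max ((\<lambda>j. f (t (int j))) ` {..<n}) = f (t (int i))"
      using Max_in[OF fin] by auto
    moreover have "f (t (int j)) \<le> Max ((\<lambda>j. f (t (int j))) ` {..<n})" if "j < n" for j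
      using Max_ge[OF fin(1)] that by auto
    ultimately show thesis using that by auto
  qed
  define m where "m = f (t (int i))"
  have max: "f (t k) \<le> m" for k
  proof -
    have "0 \<le> k mod int n" "k mod int n < int n" using n by auto
    then show ?thesis using i(2)[of "nat (k mod int n)"] by (simp add: fmod[of k] m_def)
  qed
  have ti: "t (int i) = c + real i * d" by (simp add: t_def)
  have "x \<in> tangent_triangle h d (t (int i))"
  proof (cases "x = 0")
    case True
    then show ?thesis by (simp add: tangent_triangle_def hull_inc)
  next
    case False
    (* Some tangent direction makes an acute angle with x, because d < pi / 2; this gives m > 0. *)
    obtain \<phi> where \<phi>: "x = norm x *\<^sub>R dir \<phi>" by (rule polar_form)
    define k where "k = \<lfloor>(\<phi> - c) / d\<rfloor>"
    have "of_int k \<le> (\<phi> - c) / d" "(\<phi> - c) / d \<le> of_int k + 1"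
      using floor_correct[of "(\<phi> - c) / d"] by (auto simp: k_def)
    then have "0 \<le> \<phi> - t k" "\<phi> - t k \<le> d"
      using d0 by (auto simp: t_def pos_le_divide_eq pos_divide_le_eq algebra_simps)
    then have "cos (\<phi> - t k) > 0" using d0 by (intro cos_gt_zero_pi) auto
    moreover have "x \<bullet> dir (t k) = norm x * cos (\<phi> - t k)"
      by (subst \<phi>) (simp add: inner_real2 dir_nth cos_diff algebra_simps del: norm_dir)
    ultimately have "f (t k) > 0" using False h(1) by (simp add: f_def)
    then have m0: "m > 0" using max[of k] by simp
    have m1: "m \<le> 1" using K[OF x] h(1) by (simp add: m_def f_def)
    define y where "y = (1 / m) *\<^sub>R x"
    have yle: "y \<bullet> dir (t j) \<le> h (t j)" for j
      using max[of j] m0 h(1)[of "t j"] by (simp add: y_def f_def field_simps)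
    have "m *\<^sub>R y \<in> tangent_triangle h d (t (int i))"
    proof (rule mem_tangent_triangle[OF _ _ _ sd less_imp_le[OF m0] m1])
      have "x \<bullet> dir (t (int i)) = m * h (t (int i))"
        using h(1)[of "t (int i)"] by (simp add: m_def f_def)
      then show "y \<bullet> dir (t (int i)) = h (t (int i))" using m0 by (simp add: y_def)
      show "y \<bullet> dir (t (int i) + d) \<le> h (t (int i) + d)"
        using yle[of "int i + 1"] by (simp add: t_def algebra_simps)
      show "y \<bullet> dir (t (int i) - d) \<le> h (t (int i) - d)"
        using yle[of "int i - 1"] by (simp add: t_def algebra_simps)
    qed
    then show ?thesis using m0 by (simp add: y_def)
  qed
  then show "x \<in> (\<Union>i<n. tangent_triangle h d (c + real i * d))"
    using i(1) ti by auto
qed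

lemma support_sum_ge:
  assumes "compact K" "K \<noteq> {}"
  shows "support K c (\<theta> + d) + support K c (\<theta> - d) \<ge> 2 * support K c \<theta> * cos d"
proof -
  obtain x where x: "x \<in> K" "(x - c) \<bullet> dir \<theta> = support K c \<theta>" using support_attained[OF assms] by blast
  have "dir (\<theta> + d) + dir (\<theta> - d) = (2 * cos d) *\<^sub>R dir \<theta>"
    by (simp add: vec_eq_iff forall_2 dir_nth cos_add sin_add cos_diff sin_diff)
  then have "(x - c) \<bullet> dir (\<theta> + d) + (x - c) \<bullet> dir (\<theta> - d) = 2 * cos d * support K c \<theta>"
    by (simp add: inner_add_right[symmetric] x(2))
  then show ?thesis
    using support_upper[OF assms x(1), of c "\<theta> + d"] support_upper[OF assms x(1), of c "\<theta> - d"] by (simp add: mult.commute mult.left_commute)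
qed

lemma area_le_polygon:
  assumes "compact K" "\<And>\<theta>. support K 0 \<theta> > 0" and n: "n \<ge> 5" and d: "d = 2 * pi / real n" and ne: "K \<noteq> {}"
  shows "measure lborel K \<le> (\<Sum>i<n. (\<lambda>\<theta>. support K 0 \<theta> * (support K 0 (\<theta> + d) + support K 0 (\<theta> - d)
           - 2 * support K 0 \<theta> * cos d) / (2 * sin d)) (c + real i * d))"
proof -
  let ?h = "support K 0"
  have d0: "0 < d" "d < pi / 2" using n pi_gt_zero by (auto simp: d field_simps)
  have sd: "sin d > 0" by (rule sin_gt_zero) (use d0 in auto)
  have cpt: "compact (tangent_triangle ?h d \<theta>)" for \<theta>
    unfolding tangent_triangle_def by (intro finite_imp_compact_convex_hull) auto
  have "K \<subseteq> (\<Union>i<n. tangent_triangle ?h d (c + real i * d))"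
    using support_upper[OF assms(1) ne, of _ 0]
    by (intro covered_by_tangent_triangles[OF n d assms(2)] support_add_2pi) auto
  then have "measure lborel K \<le> measure lborel (\<Union>i<n. tangent_triangle ?h d (c + real i * d))"
    by (rule measure_mono_fmeasurable)
       (use assms(1) cpt in \<open>auto intro!: fmeasurable_compact compact_UN borel_compact\<close>)
  also have "\<dots> \<le> (\<Sum>i<n. measure lborel (tangent_triangle ?h d (c + real i * d)))"
    by (rule measure_UNION_le) (use cpt borel_compact in auto)
  also have "\<dots> = (\<Sum>i<n. (\<lambda>\<theta>. ?h \<theta> * (?h (\<theta> + d) + ?h (\<theta> - d) - 2 * ?h \<theta> * cos d) / (2 * sin d)) (c + real i * d))"
  proof (rule sum.cong[OF refl])
    fix i
    let ?t = "c + real i * d"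
    have "0 \<le> ?h ?t * (?h (?t + d) + ?h (?t - d) - 2 * ?h ?t * cos d) / sin d"
      using support_sum_ge[OF assms(1) ne, of 0 ?t d] assms(2)[of ?t] sd
      by (intro divide_nonneg_pos mult_nonneg_nonneg) auto
    note abs_of_nonneg[OF this]
    then show "measure lborel (tangent_triangle ?h d ?t)
      = (\<lambda>\<theta>. ?h \<theta> * (?h (\<theta> + d) + ?h (\<theta> - d) - 2 * ?h \<theta> * cos d) / (2 * sin d)) ?t"
      unfolding measure_tangent_triangle by (simp only: divide_divide_eq_left mult.commute)
  qed
  finally show ?thesis .
qed

text \<open>Averaging the polygon bound over all rotations of the grid of normal angles replaces the sum over the
  grid by an integral over the circle. After shifting the variable, the cross terms
  \<open>h(\<theta>) h(\<theta> + d)\<close> and \<open>h(\<theta>) h(\<theta> - d)\<close> have the same integral, which leaves the square of a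
  difference quotient.\<close>

lemma area_le_difference_quotient:
  assumes "compact K" "\<And>\<theta>. support K 0 \<theta> > 0" and n: "n \<ge> 5" and d: "d = 2 * pi / real n" and ne: "K \<noteq> {}"
  shows "measure lborel K \<le> (1 - cos d) / (d * sin d) * integral {0..2 * pi} (\<lambda>\<theta>. (support K 0 \<theta>)\<^sup>2)
     - d / (2 * sin d) * integral {0..2 * pi} (\<lambda>\<theta>. ((support K 0 (\<theta> + d) - support K 0 \<theta>) / d)\<^sup>2)"
proof -
  define h where "h = support K 0"
  have ch: "continuous_on UNIV h" unfolding h_def by (rule continuous_on_support[OF assms(1) ne])
  note cc = continuous_on_compose2[OF ch]
  have per: "h (\<theta> + 2 * pi) = h \<theta>" for \<theta> by (simp add: h_def support_add_2pi)
  have d0: "0 < d" "d < pi / 2" using n pi_gt_zero by (auto simp: d field_simps)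
  have sd: "sin d > 0" by (rule sin_gt_zero) (use d0 in auto)
  have nd: "real n * d = 2 * pi" using n by (simp add: d)
  define u where "u = (\<lambda>\<theta>. h \<theta> * (h (\<theta> + d) + h (\<theta> - d) - 2 * h \<theta> * cos d) / (2 * sin d))"
  have cu: "continuous_on S u" for S
    unfolding u_def by (intro continuous_intros cc) (use sd in auto)
  have iu: "u integrable_on {a..b}" for a b by (intro integrable_continuous_real cu)
  have "d * measure lborel K = integral {0..d} (\<lambda>_. measure lborel K)"
    using d0 by simp
  also have "\<dots> \<le> integral {0..d} (\<lambda>c. \<Sum>i<n. u (c + real i * d))"
    using area_le_polygon[OF assms] unfolding u_def h_def
    by (intro integral_le integrable_continuous_real continuous_intros cc[unfolded h_def]) (use sd in auto)
  also have "\<dots> = (\<Sum>i<n. integral {0..d} (\<lambda>c. u (c + real i * d)))"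
    by (intro integral_sum integrable_continuous_real continuous_on_compose2[OF cu[of UNIV]] continuous_intros) auto
  also have "\<dots> = (\<Sum>i<n. integral {real i * d..real (Suc i) * d} u)"
  proof (rule sum.cong[OF refl])
    fix i
    show "integral {0..d} (\<lambda>c. u (c + real i * d)) = integral {real i * d..real (Suc i) * d} u"
      using integral_shift_real_ivl[where f = u and a = "real i * d" and b = "real (Suc i) * d" and c = "real i * d"]
      by (simp add: algebra_simps)
  qed
  also have "\<dots> = integral {0..real n * d} u"
  proof (induction n)
    case (Suc m)
    have "integral {0..real m * d} u + integral {real m * d..real (Suc m) * d} u = integral {0..real (Suc m) * d} u"
      using d0 by (intro Henstock_Kurzweil_Integration.integral_combine iu) auto
    then show ?case using Suc by simp
  qed simp
  finally have le: "d * measure lborel K \<le> integral {0..2 * pi} u" by (simp only: nd)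
  let ?I = "\<lambda>f. integral {0..2 * pi} f"
  have ic: "(\<lambda>x. h (x + a) * h (x + b)) integrable_on {u..v}" for a b u v
    by (intro integrable_continuous_real continuous_intros cc) auto
  have ic0: "(\<lambda>x. h x * h (x + b)) integrable_on {u..v}" for b u v using ic[of 0] by simp
  have ic00: "(\<lambda>x. h x * h x) integrable_on {u..v}" for u v using ic[of 0 0] by simp
  have shift: "?I (\<lambda>x. f (x + c)) = ?I f"
    if "continuous_on UNIV f" "\<And>x. f (x + 2 * pi) = f x" for f :: "real \<Rightarrow> real" and c
  proof -
    have "?I (\<lambda>x. f (x + c)) = integral {c..c + 2 * pi} f"
      using integral_shift_real_ivl[where f = f and a = c and b = "c + 2 * pi" and c = c] by simp
    also have "\<dots> = ?I f"
      using that by (intro integral_periodic integrable_continuous_real) (auto intro: continuous_on_subset)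
    finally show ?thesis .
  qed
  have pershift: "h (x + 2 * pi + b) = h (x + b)" for x b using per[of "x + b"] by (simp add: algebra_simps)
  have s1: "?I (\<lambda>x. h (x + d) * h (x + d)) = ?I (\<lambda>x. h x * h x)"
    by (rule shift[of "\<lambda>x. h x * h x"]) (auto simp: per intro!: continuous_intros ch)
  have s2: "?I (\<lambda>x. h x * h (x + - d)) = ?I (\<lambda>x. h x * h (x + d))"
  proof -
    have "?I (\<lambda>x. h (x + d) * h ((x + d) + - d)) = ?I (\<lambda>x. h x * h (x + - d))"
    proof (rule shift)
      show "continuous_on UNIV (\<lambda>x. h x * h (x + - d))" by (intro continuous_intros cc) auto
      show "h (x + 2 * pi) * h (x + 2 * pi + - d) = h x * h (x + - d)" for x by (simp only: per pershift)
    qed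
    then show ?thesis by (simp add: mult.commute)
  qed
  define A B where "A = ?I (\<lambda>x. h x * h x)" and "B = ?I (\<lambda>x. h x * h (x + d))"
  have A: "((\<lambda>x. h x * h x) has_integral A) {0..2 * pi}" "((\<lambda>x. h (x + d) * h (x + d)) has_integral A) {0..2 * pi}"
    and B: "((\<lambda>x. h x * h (x + d)) has_integral B) {0..2 * pi}" "((\<lambda>x. h x * h (x + - d)) has_integral B) {0..2 * pi}"
    unfolding A_def B_def using s1 s2 ic00 ic ic0 by (metis integrable_integral)+
  have "((\<lambda>x. (1 / (2 * sin d)) * ((h x * h (x + d) + h x * h (x + - d)) - (2 * cos d) * (h x * h x)))
      has_integral (1 / (2 * sin d)) * ((B + B) - (2 * cos d) * A)) {0..2 * pi}"
    by (intro has_integral_mult_right has_integral_diff has_integral_add A B)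
  moreover have "u = (\<lambda>x. (1 / (2 * sin d)) * ((h x * h (x + d) + h x * h (x + - d)) - (2 * cos d) * (h x * h x)))"
    unfolding u_def using sd by (auto simp: field_simps)
  ultimately have Iu: "?I u = (1 / (2 * sin d)) * (2 * B - 2 * cos d * A)"
    by (metis integral_unique mult_2)
  have I1: "((\<lambda>x. (1 / d\<^sup>2) * ((h (x + d) * h (x + d) + h x * h x) - 2 * (h x * h (x + d))))
      has_integral (1 / d\<^sup>2) * ((A + A) - 2 * B)) {0..2 * pi}"
    by (intro has_integral_mult_right has_integral_diff has_integral_add A B)
  have I2: "(\<lambda>x. ((h (x + d) - h x) / d)\<^sup>2)
      = (\<lambda>x. (1 / d\<^sup>2) * ((h (x + d) * h (x + d) + h x * h x) - 2 * (h x * h (x + d))))"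
  proof
    fix x
    have "h (x + d) * h (x + d) + h x * h x - 2 * (h x * h (x + d)) = (h (x + d) - h x)\<^sup>2"
      by (simp add: power2_eq_square algebra_simps)
    then show "((h (x + d) - h x) / d)\<^sup>2
      = (1 / d\<^sup>2) * ((h (x + d) * h (x + d) + h x * h x) - 2 * (h x * h (x + d)))"
      by (simp only: power_divide) simp
  qed
  have Iq: "?I (\<lambda>x. ((h (x + d) - h x) / d)\<^sup>2) = (1 / d\<^sup>2) * (2 * A - 2 * B)"
    unfolding I2 integral_unique[OF I1] by simp
  have "measure lborel K \<le> ?I u / d" using le d0 by (simp add: field_simps)
  also have "\<dots> = (1 - cos d) / (d * sin d) * A - d / (2 * sin d) * ((1 / d\<^sup>2) * (2 * A - 2 * B))"
    unfolding Iu using sd d0 by (simp add: field_simps power2_eq_square)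
  finally have "measure lborel K \<le> (1 - cos d) / (d * sin d) * A
      - d / (2 * sin d) * ?I (\<lambda>x. ((h (x + d) - h x) / d)\<^sup>2)"
    unfolding Iq .
  moreover have "A = ?I (\<lambda>x. (h x)\<^sup>2)" by (simp add: A_def power2_eq_square)
  ultimately show ?thesis unfolding h_def by (simp only:)
qed

text \<open>The limit \<open>d \<rightarrow> 0\<close> of the averaged polygon bound. The difference quotients are bounded by the Lipschitz
  constant of \<open>h\<close> and converge to \<open>h'\<close> off a null set.\<close>

lemma area_le_energy_origin:
  assumes "compact K" "\<And>\<theta>. support K 0 \<theta> > 0" and ne: "K \<noteq> {}"
  shows "2 * measure lborel K \<le> - energy 0 (2 * pi) (support K 0) (deriv (support K 0))"
proof -
  define h where "h = support K 0"
  define N where "N = {\<theta>. \<not> h differentiable at \<theta>}"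
  have neg: "negligible N"
    using support_differentiable_off_countable[OF assms(1) ne]
    by (simp add: negligible_iff_null_sets null_sets_completionI countable_imp_null_set_lborel N_def h_def)
  obtain L where L: "\<And>S. L-lipschitz_on S h" using support_lipschitz[OF assms(1) ne] unfolding h_def by blast
  have ch: "continuous_on UNIV h" unfolding h_def by (rule continuous_on_support[OF assms(1) ne])
  let ?I = "\<lambda>f. integral {0..2 * pi} f"
  define d where "d = (\<lambda>n. 2 * pi / real (n + 5))"
  have d0: "d n > 0" for n by (simp add: d_def)
  have dlim: "filterlim d (at 0) sequentially"
    unfolding d_def by real_asymp
  define q where "q = (\<lambda>n x. ((h (x + d n) - h x) / d n)\<^sup>2)"
  define f where "f = (\<lambda>n x. if x \<in> N then 0 else q n x)"
  define g where "g = (\<lambda>x. if x \<in> N then 0 else (deriv h x)\<^sup>2)"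
  have iq: "q n integrable_on {0..2 * pi}" for n
    unfolding q_def using d0[of n]
    by (intro integrable_continuous_real continuous_intros continuous_on_compose2[OF ch]) auto
  have if': "f n integrable_on {0..2 * pi}" for n
    by (rule integrable_spike[OF iq[of n] neg]) (simp add: f_def)
  have bd: "norm (f n x) \<le> L\<^sup>2" for n x
  proof -
    have "\<bar>h (x + d n) - h x\<bar> \<le> L * d n"
      using lipschitz_onD[OF L[of UNIV], of "x + d n" x] d0[of n] by (simp add: dist_real_def)
    then have "\<bar>(h (x + d n) - h x) / d n\<bar> \<le> L" using d0[of n] by (simp add: abs_divide field_simps)
    then have "q n x \<le> L\<^sup>2" unfolding q_def by (metis abs_le_square_iff abs_of_nonneg abs_ge_self order_trans)
    then show ?thesis by (auto simp: f_def q_def)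
  qed
  have conv: "(\<lambda>n. f n x) \<longlonglongrightarrow> g x" for x
  proof (cases "x \<in> N")
    case False
    then have "(h has_real_derivative deriv h x) (at x)"
      by (simp add: N_def DERIV_deriv_iff_real_differentiable)
    then have "((\<lambda>t. (h (x + t) - h x) / t) \<longlongrightarrow> deriv h x) (at 0)" by (simp add: DERIV_def)
    then have "(\<lambda>n. (h (x + d n) - h x) / d n) \<longlonglongrightarrow> deriv h x"
      using dlim by (rule filterlim_compose)
    then show ?thesis using False by (auto simp: f_def g_def q_def intro: tendsto_power)
  qed (simp add: f_def g_def)
  have "(\<lambda>n. ?I (f n)) \<longlonglongrightarrow> ?I g"
    by (rule dominated_convergence(2)[of f _ "\<lambda>_. L\<^sup>2"]) (use if' bd conv in auto)
  moreover have "?I (f n) = ?I (q n)" for n by (rule integral_spike[OF neg]) (simp add: f_def)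
  moreover have "?I g = ?I (\<lambda>x. (deriv h x)\<^sup>2)" by (rule integral_spike[OF neg]) (simp add: g_def)
  ultimately have lim: "(\<lambda>n. ?I (q n)) \<longlonglongrightarrow> ?I (\<lambda>x. (deriv h x)\<^sup>2)" by simp
  have c1: "(\<lambda>n. (1 - cos (d n)) / (d n * sin (d n))) \<longlonglongrightarrow> 1 / 2"
  proof -
    have "((\<lambda>t::real. (1 - cos t) / (t * sin t)) \<longlongrightarrow> 1 / 2) (at 0)" by real_asymp
    then show ?thesis using dlim by (rule filterlim_compose)
  qed
  have c2: "(\<lambda>n. d n / (2 * sin (d n))) \<longlonglongrightarrow> 1 / 2"
  proof -
    have "((\<lambda>t::real. t / (2 * sin t)) \<longlongrightarrow> 1 / 2) (at 0)" by real_asymp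
    then show ?thesis using dlim by (rule filterlim_compose)
  qed
  have "(\<lambda>n. (1 - cos (d n)) / (d n * sin (d n)) * ?I (\<lambda>x. (h x)\<^sup>2) - d n / (2 * sin (d n)) * ?I (q n))
      \<longlonglongrightarrow> 1 / 2 * ?I (\<lambda>x. (h x)\<^sup>2) - 1 / 2 * ?I (\<lambda>x. (deriv h x)\<^sup>2)"
    by (intro tendsto_intros c1 c2 lim)
  moreover have "measure lborel K \<le> (1 - cos (d n)) / (d n * sin (d n)) * ?I (\<lambda>x. (h x)\<^sup>2) - d n / (2 * sin (d n)) * ?I (q n)" for n
    unfolding q_def h_def
    by (rule area_le_difference_quotient[OF assms(1,2) _ _ ne, of "n + 5"]) (auto simp: d_def)
  ultimately have "measure lborel K \<le> 1 / 2 * ?I (\<lambda>x. (h x)\<^sup>2) - 1 / 2 * ?I (\<lambda>x. (deriv h x)\<^sup>2)"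
    by (intro LIMSEQ_le_const) auto
  moreover have "energy 0 (2 * pi) h (deriv h) = ?I (\<lambda>x. (deriv h x)\<^sup>2) - ?I (\<lambda>x. (h x)\<^sup>2)"
  proof -
    have "lip_deriv 0 (2 * pi) h (deriv h)" unfolding h_def by (rule support_lip_deriv[OF assms(1) ne])
    from lip_deriv_prod_integrable[OF this this]
    have "(\<lambda>x. (deriv h x)\<^sup>2) integrable_on {0..2 * pi}" by (simp add: power2_eq_square)
    moreover have "(\<lambda>x. (h x)\<^sup>2) integrable_on {0..2 * pi}"
      by (intro integrable_continuous_real continuous_intros continuous_on_subset[OF ch]) auto
    ultimately show ?thesis
      unfolding energy_def by (rule Henstock_Kurzweil_Integration.integral_diff)
  qed
  ultimately show ?thesis by (simp add: h_def)
qed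

section \<open>The energy bounds the Bonnesen function from below\<close>

lemma lip_deriv_cmult: "lip_deriv a b f f' \<Longrightarrow> lip_deriv a b (\<lambda>x. c * f x) (\<lambda>x. c * f' x)"
  using lip_deriv_mult[OF lip_deriv_C1[of a b "\<lambda>_. c" "\<lambda>_. 0"], of f f'] by simp

lemma lip_deriv_diff:
  "lip_deriv a b f f' \<Longrightarrow> lip_deriv a b g g' \<Longrightarrow> lip_deriv a b (\<lambda>x. f x - g x) (\<lambda>x. f' x - g' x)"
  using lip_deriv_add[of a b f f' "\<lambda>x. (-1) * g x" "\<lambda>x. (-1) * g' x"] lip_deriv_cmult[of a b g g' "-1"] by simp

lemma inner_dir_deriv: "((\<lambda>x. c \<bullet> dir x) has_real_derivative c \<bullet> tan_dir t) (at t)"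
  unfolding inner_dir inner_real2[of c "tan_dir t"] tan_dir_nth
  by (rule derivative_eq_intros refl | simp)+

lemma inner_tan_dir_deriv: "((\<lambda>x. c \<bullet> tan_dir x) has_real_derivative - (c \<bullet> dir t)) (at t)"
  unfolding inner_dir inner_real2[of c "tan_dir _"] tan_dir_nth
  by (rule derivative_eq_intros refl | simp)+

lemma continuous_inner_dir [continuous_intros]: "continuous_on S (\<lambda>x. c \<bullet> dir x)"
  and continuous_inner_tan_dir [continuous_intros]: "continuous_on S (\<lambda>x. c \<bullet> tan_dir x)"
  unfolding inner_dir inner_real2[of c "tan_dir _"] tan_dir_nth by (intro continuous_intros)+

lemma lip_deriv_inner_dir: "lip_deriv a b (\<lambda>x. c \<bullet> dir x) (\<lambda>x. c \<bullet> tan_dir x)"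
  and lip_deriv_inner_tan_dir: "lip_deriv a b (\<lambda>x. c \<bullet> tan_dir x) (\<lambda>x. - (c \<bullet> dir x))"
  by (intro lip_deriv_C1 inner_dir_deriv inner_tan_dir_deriv continuous_intros)+

text \<open>Moving the base point changes \<open>f\<close> by \<open>e = c \<bullet> dir\<close>, and \<open>e'' = - e\<close>. So the integrand changes by the
  derivative of \<open>e e' - 2 f e'\<close>, which is periodic.\<close>

lemma energy_translate:
  assumes f: "lip_deriv 0 (2 * pi) f f'" "f (2 * pi) = f 0"
  shows "energy 0 (2 * pi) (\<lambda>x. f x - c \<bullet> dir x) (\<lambda>x. f' x - c \<bullet> tan_dir x) = energy 0 (2 * pi) f f'"
proof -
  let ?e = "\<lambda>x. c \<bullet> dir x" and ?e' = "\<lambda>x. c \<bullet> tan_dir x"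
  note le = lip_deriv_inner_dir[of 0 "2 * pi" c] and le' = lip_deriv_inner_tan_dir[of 0 "2 * pi" c]
  have per: "?e (2 * pi) = ?e 0" "?e' (2 * pi) = ?e' 0"
    using dir_add_2pi[of 0] dir_add_2pi[of "pi / 2"] by (simp_all add: tan_dir_def add.commute)
  have 1: "((\<lambda>x. (f' x)\<^sup>2 - (f x)\<^sup>2) has_integral energy 0 (2 * pi) f f') {0..2 * pi}"
    unfolding energy_def by (intro integrable_integral energy_integrable f) simp
  have 2: "((\<lambda>x. f' x * ?e' x + f x * - ?e x) has_integral 0) {0..2 * pi}"
    using lip_deriv_ftc[OF _ lip_deriv_mult[OF f(1) le']] by (simp add: per f(2))
  have 3: "((\<lambda>x. ?e' x * ?e' x + ?e x * - ?e x) has_integral 0) {0..2 * pi}"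
    using lip_deriv_ftc[OF _ lip_deriv_mult[OF le le']] by (simp add: per)
  have I: "((\<lambda>x. ((f' x)\<^sup>2 - (f x)\<^sup>2) - 2 * (f' x * ?e' x + f x * - ?e x) + (?e' x * ?e' x + ?e x * - ?e x))
     has_integral (energy 0 (2 * pi) f f' - 2 * 0 + 0)) {0..2 * pi}"
    by (intro has_integral_add has_integral_diff has_integral_mult_right 1 2 3)
  have eq: "(\<lambda>x. ((f' x)\<^sup>2 - (f x)\<^sup>2) - 2 * (f' x * ?e' x + f x * - ?e x) + (?e' x * ?e' x + ?e x * - ?e x))
     = (\<lambda>x. (f' x - ?e' x)\<^sup>2 - (f x - ?e x)\<^sup>2)"
    by (auto simp: power2_eq_square algebra_simps)
  show ?thesis
    using integral_unique[OF I] unfolding eq energy_def[of _ _ "\<lambda>x. f x - ?e x"] by simp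
qed

lemma energy_cong_deriv:
  assumes "lip_deriv a b f f'" "lip_deriv a b f f''"
  shows "energy a b f f' = energy a b f f''"
proof -
  obtain M N where *: "negligible M" "negligible N"
    "\<forall>x\<in>{a<..<b} - M. (f has_real_derivative f' x) (at x)"
    "\<forall>x\<in>{a<..<b} - N. (f has_real_derivative f'' x) (at x)"
    using assms unfolding lip_deriv_def by blast
  have neg: "negligible (M \<union> N \<union> {a,b})" using * by (simp add: negligible_insert negligible_Un)
  show ?thesis unfolding energy_def
  proof (rule integral_spike[OF neg])
    fix x assume "x \<in> {a..b} - (M \<union> N \<union> {a,b})"
    then have "x \<in> {a<..<b} - M" "x \<in> {a<..<b} - N" by auto
    then have "f' x = f'' x" using *(3,4) DERIV_unique by blast
    then show "(f'' x)\<^sup>2 - (f x)\<^sup>2 = (f' x)\<^sup>2 - (f x)\<^sup>2" by simp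
  qed
qed

text \<open>The polygon bound requires the origin in the interior; both sides are invariant under the translation that
  moves an interior point of \<open>K\<close> there.\<close>

lemma area_le_energy:
  assumes K: "compact K" "interior K \<noteq> {}"
  shows "2 * measure lborel K \<le> - energy 0 (2 * pi) (support K 0) (deriv (support K 0))"
proof -
  obtain c where c: "c \<in> interior K" using K(2) by blast
  then have ne: "K \<noteq> {}" using interior_subset by blast
  obtain e where e: "e > 0" "cball c e \<subseteq> K" using c mem_interior_cball by blast
  define K' where "K' = (\<lambda>x. x - c) ` K"
  have K': "compact K'" "K' \<noteq> {}"
    unfolding K'_def using K(1) ne by (auto intro!: compact_continuous_image continuous_intros)
  have sup: "support K' 0 = support K c"
    by (rule ext) (simp add: support_def K'_def image_image)
  have pos: "support K' 0 \<theta> > 0" for \<theta>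
  proof -
    have "c + e *\<^sub>R dir \<theta> \<in> K" by (rule subsetD[OF e(2)]) (use e(1) in \<open>simp add: dist_norm\<close>)
    from support_upper[OF K(1) ne this, of c \<theta>] show ?thesis
      using e(1) by (simp add: sup dot_square_norm)
  qed
  have "measure lborel K' = measure lborel K"
  proof -
    have "measure lebesgue K' = measure lebesgue K"
      unfolding K'_def by (rule measure_translation_subtract)
    moreover have "K \<in> sets borel" "K' \<in> sets borel" using K(1) K'(1) by (auto intro: borel_compact)
    ultimately show ?thesis by simp
  qed
  then have "2 * measure lborel K \<le> - energy 0 (2 * pi) (support K c) (deriv (support K c))"
    using area_le_energy_origin[OF K'(1) pos K'(2)] by (simp add: sup)
  also have "energy 0 (2 * pi) (support K c) (deriv (support K c))
      = energy 0 (2 * pi) (support K c) (\<lambda>x. deriv (support K 0) x - c \<bullet> tan_dir x)"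
  proof (rule energy_cong_deriv)
    show "lip_deriv 0 (2 * pi) (support K c) (deriv (support K c))" by (rule support_lip_deriv[OF K(1) ne])
    show "lip_deriv 0 (2 * pi) (support K c) (\<lambda>x. deriv (support K 0) x - c \<bullet> tan_dir x)"
      unfolding support_eq_origin[OF K(1) ne, of c, abs_def]
      by (intro lip_deriv_diff support_lip_deriv[OF K(1) ne] lip_deriv_inner_dir)
  qed
  also have "\<dots> = energy 0 (2 * pi) (support K 0) (deriv (support K 0))"
    unfolding support_eq_origin[OF K(1) ne, of c, abs_def]
    by (rule energy_translate[OF support_lip_deriv[OF K(1) ne]]) (use support_add_2pi[of K 0 0] in simp)
  finally show ?thesis .
qed

text \<open>The energy of \<open>h - r p\<close> is a quadratic polynomial in \<open>r\<close> with middle coefficient \<open>2 \<L>\<close>, and its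
  outer coefficients are the energies of \<open>h\<close> and \<open>p\<close>, at most minus twice the areas.\<close>

lemma bonnesen_ge_energy:
  assumes K: "compact K" "interior K \<noteq> {}" and T: "compact T" "interior T \<noteq> {}"
  shows "2 * bonnesen T K r \<ge> energy 0 (2 * pi) (\<lambda>x. support K c x - r * support T 0 x)
     (\<lambda>x. (deriv (support K 0) x - r * deriv (support T 0) x) - c \<bullet> tan_dir x)"
proof -
  have ne: "K \<noteq> {}" "T \<noteq> {}" using K(2) T(2) by auto
  let ?h = "support K 0" and ?p = "support T 0"
  note lh = support_lip_deriv[OF K(1) ne(1), of 0 "2 * pi" 0] and lp = support_lip_deriv[OF T(1) ne(2), of 0 "2 * pi" 0]
  note lg = lip_deriv_diff[OF lh lip_deriv_cmult[OF lp, of r]]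
  have "(\<lambda>x. support K c x - r * ?p x) = (\<lambda>x. (?h x - r * ?p x) - c \<bullet> dir x)"
    by (rule ext) (simp add: support_eq_origin[OF K(1) ne(1), of c])
  then have "energy 0 (2 * pi) (\<lambda>x. support K c x - r * ?p x) (\<lambda>x. (deriv ?h x - r * deriv ?p x) - c \<bullet> tan_dir x)
     = energy 0 (2 * pi) (\<lambda>x. ?h x - r * ?p x) (\<lambda>x. deriv ?h x - r * deriv ?p x)"
    using energy_translate[OF lg] support_add_2pi[of K 0 0] support_add_2pi[of T 0 0] by simp
  also have "\<dots> = energy 0 (2 * pi) ?h (deriv ?h) + 2 * r * minkowski_length T K + r\<^sup>2 * energy 0 (2 * pi) ?p (deriv ?p)"
  proof -
    have 1: "((\<lambda>x. (deriv ?h x)\<^sup>2 - (?h x)\<^sup>2) has_integral energy 0 (2 * pi) ?h (deriv ?h)) {0..2 * pi}"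
      "((\<lambda>x. (deriv ?p x)\<^sup>2 - (?p x)\<^sup>2) has_integral energy 0 (2 * pi) ?p (deriv ?p)) {0..2 * pi}"
      unfolding energy_def by (intro integrable_integral energy_integrable lh lp; simp)+
    have "(\<lambda>x. ?h x * ?p x) integrable_on {0..2 * pi}"
      by (intro integrable_continuous_real continuous_intros continuous_on_support K T ne)
    then have 2: "((\<lambda>x. ?h x * ?p x - deriv ?h x * deriv ?p x) has_integral minkowski_length T K) {0..2 * pi}"
      unfolding minkowski_length_def
      by (intro integrable_integral integrable_diff lip_deriv_prod_integrable[OF lh lp]) auto
    have I: "((\<lambda>x. ((deriv ?h x)\<^sup>2 - (?h x)\<^sup>2) + 2 * r * (?h x * ?p x - deriv ?h x * deriv ?p x) + r\<^sup>2 * ((deriv ?p x)\<^sup>2 - (?p x)\<^sup>2))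
       has_integral (energy 0 (2 * pi) ?h (deriv ?h) + 2 * r * minkowski_length T K + r\<^sup>2 * energy 0 (2 * pi) ?p (deriv ?p))) {0..2 * pi}"
      by (intro has_integral_add has_integral_mult_right 1 2)
    have eq: "(\<lambda>x. ((deriv ?h x)\<^sup>2 - (?h x)\<^sup>2) + 2 * r * (?h x * ?p x - deriv ?h x * deriv ?p x) + r\<^sup>2 * ((deriv ?p x)\<^sup>2 - (?p x)\<^sup>2))
       = (\<lambda>x. (deriv ?h x - r * deriv ?p x)\<^sup>2 - (?h x - r * ?p x)\<^sup>2)"
      by (auto simp: power2_eq_square algebra_simps)
    show ?thesis
      using integral_unique[OF I] unfolding eq energy_def[of _ _ "\<lambda>x. ?h x - r * ?p x"] by (simp only:)
  qed
  also have "\<dots> \<le> - 2 * measure lborel K + 2 * r * minkowski_length T K + r\<^sup>2 * (- 2 * measure lborel T)"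
  proof -
    have "r\<^sup>2 * energy 0 (2 * pi) ?p (deriv ?p) \<le> r\<^sup>2 * (- 2 * measure lborel T)"
      using area_le_energy[OF T] by (intro mult_left_mono) auto
    then show ?thesis using area_le_energy[OF K] by linarith
  qed
  also have "\<dots> = 2 * bonnesen T K r" by (simp add: bonnesen_def algebra_simps)
  finally show ?thesis .
qed

section \<open>The isoperimetrix\<close>

lemma linear_rot90: "linear rot90"
  by (rule linearI) (simp_all add: rot90_def vec_eq_iff forall_2)

lemma isoperimetrix_body:
  assumes "minkowski_unit_disk U"
  shows "compact (isoperimetrix U)" "convex (isoperimetrix U)" "0 \<in> isoperimetrix U" "interior (isoperimetrix U) \<noteq> {}"
proof -
  have U: "compact U" "convex U" "interior U \<noteq> {}" and sym: "\<And>x. x \<in> U \<Longrightarrow> - x \<in> U"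
    using assms by (auto simp: minkowski_unit_disk_def)
  note 0 = zero_in_interior_symmetric[OF U(2,3) sym]
  obtain e where e: "e > 0" "cball 0 e \<subseteq> U" using 0 mem_interior_cball by blast
  obtain B where B: "B > 0" "\<And>x. x \<in> U \<Longrightarrow> norm x \<le> B"
    using compact_imp_bounded[OF U(1)] bounded_pos by blast
  let ?P = "polar_reciprocal U"
  have P: "?P = (\<Inter>x\<in>U. {y. x \<bullet> y \<le> 1})" by (auto simp: polar_reciprocal_def)
  have "closed ?P" unfolding P by (intro closed_INT ballI closed_halfspace_le)
  moreover have "bounded ?P"
  proof (rule boundedI)
    fix y assume y: "y \<in> ?P"
    show "norm y \<le> 1 / e"
    proof (cases "y = 0")
      case False
      have "(e / norm y) *\<^sub>R y \<in> U" by (rule subsetD[OF e(2)]) (use e(1) False in simp)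
      then have "((e / norm y) *\<^sub>R y) \<bullet> y \<le> 1" using y by (auto simp: polar_reciprocal_def)
      then show ?thesis using False e(1) by (simp add: dot_square_norm power2_eq_square field_simps)
    qed (use e in simp)
  qed
  ultimately have "compact ?P" by (simp add: compact_eq_bounded_closed)
  then show "compact (isoperimetrix U)"
    unfolding isoperimetrix_def by (rule compact_continuous_image[OF linear_continuous_on[OF linear_linear[THEN iffD2, OF linear_rot90]]])
  have "convex ?P" unfolding P by (intro convex_INT convex_halfspace_le)
  then show "convex (isoperimetrix U)" unfolding isoperimetrix_def by (rule convex_linear_image[OF linear_rot90])
  have "0 \<in> ?P" by (simp add: polar_reciprocal_def)
  then show "0 \<in> isoperimetrix U" unfolding isoperimetrix_def using linear_0[OF linear_rot90] by force
  have ball: "ball 0 (1 / B) \<subseteq> isoperimetrix U"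
  proof
    fix z :: "real^2" assume z: "z \<in> ball 0 (1 / B)"
    have n: "norm (- rot90 z) = norm z" by (simp add: norm_eq_sqrt_inner inner_real2 rot90_def)
    have "- rot90 z \<in> ?P"
      unfolding polar_reciprocal_def
    proof safe
      fix x assume "x \<in> U"
      have "x \<bullet> - rot90 z \<le> norm x * norm (- rot90 z)" by (rule norm_cauchy_schwarz)
      also have "\<dots> \<le> B * (1 / B)" unfolding n by (intro mult_mono) (use B z \<open>x \<in> U\<close> in auto)
      finally show "x \<bullet> - rot90 z \<le> 1" using B(1) by simp
    qed
    moreover have "rot90 (- rot90 z) = z" by (simp add: rot90_def vec_eq_iff forall_2)
    ultimately show "z \<in> isoperimetrix U" unfolding isoperimetrix_def by (metis imageI)
  qed
  have "0 \<in> interior (isoperimetrix U)"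
    by (rule interiorI[OF open_ball _ ball]) (use B(1) in simp)
  then show "interior (isoperimetrix U) \<noteq> {}" by blast
qed

lemma isoperimetrix_symmetric_oval:
  assumes "minkowski_unit_disk U"
  shows "\<exists>J. symmetric_oval (support (isoperimetrix U) 0) (deriv (support (isoperimetrix U) 0))
    (deriv (deriv (support (isoperimetrix U) 0))) J"
proof -
  define p where "p = support (isoperimetrix U) 0"
  have sm: "\<And>n x. ((deriv ^^ n) p) differentiable (at x)" and curv: "\<And>x. p x + deriv (deriv p) x > 0"
    using assms by (auto simp: minkowski_unit_disk_def Let_def smooth_fun_def p_def)
  have d: "(p has_real_derivative deriv p x) (at x)" for x
    using sm[of 0 x] by (simp add: DERIV_deriv_iff_real_differentiable)
  have d': "(deriv p has_real_derivative deriv (deriv p) x) (at x)" for x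
    using sm[of 1 x] by (simp add: DERIV_deriv_iff_real_differentiable)
  have c'': "isCont (deriv (deriv p)) x" for x
    using sm[of 2 x] by (simp add: differentiable_imp_continuous_within numeral_2_eq_2)
  have cp: "isCont p x" for x using d DERIV_isCont by blast
  have "\<exists>J. \<forall>x :: real. - \<infinity> < ereal x \<longrightarrow> ereal x < \<infinity> \<longrightarrow>
      (J has_vector_derivative p x * (p x + deriv (deriv p) x)) (at x)"
    by (rule einterval_antiderivative) (auto intro!: continuous_intros cp c'')
  then obtain J where J: "\<And>x. (J has_real_derivative p x * (p x + deriv (deriv p) x)) (at x)"
    by (auto simp: has_real_derivative_iff_has_vector_derivative)
  have "symmetric_oval p (deriv p) (deriv (deriv p)) J"
  proof
    show "continuous_on UNIV (deriv (deriv p))" using c'' by (simp add: continuous_at_imp_continuous_on)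
    show "p (x + pi) = p x" "p x > 0" for x
      unfolding p_def using support_isoperimetrix[OF assms] by auto
  qed (use d d' J curv in auto)
  then show ?thesis unfolding p_def by blast
qed

section \<open>Relative annuli\<close>

lemma mem_convex_body_iff:
  assumes "compact K" "convex K" "K \<noteq> {}"
  shows "x \<in> K \<longleftrightarrow> (\<forall>\<theta>. (x - c) \<bullet> dir \<theta> \<le> support K c \<theta>)"
proof
  assume *: "\<forall>\<theta>. (x - c) \<bullet> dir \<theta> \<le> support K c \<theta>"
  show "x \<in> K"
  proof (rule ccontr)
    assume "x \<notin> K"
    then obtain a b where ab: "a \<bullet> x < b" "\<And>y. y \<in> K \<Longrightarrow> a \<bullet> y > b"
      using separating_hyperplane_closed_point[OF assms(2) compact_imp_closed[OF assms(1)]] by blast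
    obtain \<phi> where \<phi>: "- a = norm (- a) *\<^sub>R dir \<phi>" by (rule polar_form)
    obtain y where y: "y \<in> K" "(y - c) \<bullet> dir \<phi> = support K c \<phi>" using support_attained[OF assms(1,3)] by blast
    have "x \<bullet> dir \<phi> \<le> y \<bullet> dir \<phi>" using *[rule_format, of \<phi>] y(2) by (simp add: inner_diff_left)
    then have "norm (- a) * (x \<bullet> dir \<phi>) \<le> norm (- a) * (y \<bullet> dir \<phi>)" by (intro mult_left_mono) auto
    then have "x \<bullet> (- a) \<le> y \<bullet> (- a)" by (metis \<phi> inner_scaleR_right)
    then show False using ab(1) ab(2)[OF y(1)] by (simp add: inner_commute)
  qed
qed (use support_upper[OF assms(1,3)] in blast)

lemma eq_if_inner_dir_le:
  assumes "\<And>\<theta>. (x - c) \<bullet> dir \<theta> \<le> 0"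
  shows "x = c"
proof -
  obtain \<phi> where \<phi>: "x - c = norm (x - c) *\<^sub>R dir \<phi>" by (rule polar_form)
  have "(x - c) \<bullet> dir \<phi> = norm (x - c)" by (subst \<phi>) (simp add: dot_square_norm)
  then show ?thesis using assms[of \<phi>] by simp
qed

lemma relative_annulus_iff:
  assumes K: "compact K" "convex K" "K \<noteq> {}" and T: "compact T" "convex T" "T \<noteq> {}"
  shows "relative_annulus T K c a b \<longleftrightarrow> 0 \<le> a \<and> a \<le> b \<and>
    (\<forall>\<theta>. a * support T 0 \<theta> \<le> support K c \<theta> \<and> support K c \<theta> \<le> b * support T 0 \<theta>)"
proof -
  have 1: "homothet T c a \<subseteq> K \<longleftrightarrow> (\<forall>\<theta>. a * support T 0 \<theta> \<le> support K c \<theta>)" if "0 \<le> a"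
  proof
    assume *: "homothet T c a \<subseteq> K"
    show "\<forall>\<theta>. a * support T 0 \<theta> \<le> support K c \<theta>"
    proof
      fix \<theta>
      obtain t where t: "t \<in> T" "(t - 0) \<bullet> dir \<theta> = support T 0 \<theta>" using support_attained[OF T(1,3)] by blast
      then have "c + a *\<^sub>R t \<in> K" using * by (auto simp: homothet_def)
      from support_upper[OF K(1,3) this, of c \<theta>] show "a * support T 0 \<theta> \<le> support K c \<theta>" using t(2) by simp
    qed
  next
    assume *: "\<forall>\<theta>. a * support T 0 \<theta> \<le> support K c \<theta>"
    show "homothet T c a \<subseteq> K"
      unfolding homothet_def
    proof (rule image_subsetI)
      fix t assume t: "t \<in> T"
      have "a * (t \<bullet> dir \<theta>) \<le> a * support T 0 \<theta>" for \<theta>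
        using support_upper[OF T(1,3) t, of 0 \<theta>] that by (intro mult_left_mono) auto
      then show "c + a *\<^sub>R t \<in> K"
        unfolding mem_convex_body_iff[OF K, of _ c] using * by (auto intro: order_trans)
    qed
  qed
  have 2: "K \<subseteq> homothet T c b \<longleftrightarrow> (\<forall>\<theta>. support K c \<theta> \<le> b * support T 0 \<theta>)" if b: "0 \<le> b"
  proof
    assume *: "K \<subseteq> homothet T c b"
    show "\<forall>\<theta>. support K c \<theta> \<le> b * support T 0 \<theta>"
      unfolding support_le_iff[OF K(1,3)]
    proof safe
      fix \<theta> x assume "x \<in> K"
      then obtain t where t: "t \<in> T" "x = c + b *\<^sub>R t" using * by (auto simp: homothet_def)
      have "b * (t \<bullet> dir \<theta>) \<le> b * support T 0 \<theta>"
        using support_upper[OF T(1,3) t(1), of 0 \<theta>] b by (intro mult_left_mono) auto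
      then show "(x - c) \<bullet> dir \<theta> \<le> b * support T 0 \<theta>" by (simp add: t(2))
    qed
  next
    assume *: "\<forall>\<theta>. support K c \<theta> \<le> b * support T 0 \<theta>"
    show "K \<subseteq> homothet T c b"
    proof
      fix x assume "x \<in> K"
      then have le: "(x - c) \<bullet> dir \<theta> \<le> b * support T 0 \<theta>" for \<theta>
        using support_upper[OF K(1,3), of x c \<theta>] * by (meson order_trans)
      show "x \<in> homothet T c b"
      proof (cases "b = 0")
        case True
        then have "x = c" using le by (intro eq_if_inner_dir_le) simp
        then show ?thesis using T(3) True by (auto simp: homothet_def)
      next
        case False
        then have "b > 0" using b by simp
        then have "(1 / b) *\<^sub>R (x - c) \<in> T"
          unfolding mem_convex_body_iff[OF T, of _ 0] using le by (simp add: pos_divide_le_eq mult.commute)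
        moreover have "x = c + b *\<^sub>R ((1 / b) *\<^sub>R (x - c))" using False by simp
        ultimately show ?thesis unfolding homothet_def by blast
      qed
    qed
  qed
  show ?thesis unfolding relative_annulus_def using 1 2 by (meson order_trans)
qed

text \<open>In terms of the center and the radii, the two inclusions are linear inequalities, one for each angle,
  hence define a closed set. The center lies in \<open>K\<close>, and annuli at most as wide as a given one have
  bounded radii, so the width is minimized on a compact set.\<close>

lemma exists_minimal_annulus:
  assumes K: "compact K" "convex K" "K \<noteq> {}" and T: "compact T" "convex T" "0 \<in> T"
    and pos: "\<And>\<theta>. support T 0 \<theta> > 0"
  shows "\<exists>c a b. relative_minimal_annulus T K c a b"
proof -
  define h p where "h = support K 0" and "p = support T 0"
  have Tne: "T \<noteq> {}" using T(3) by blast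
  note ann = relative_annulus_iff[OF K T(1,2) Tne]
  have hc: "support K c \<theta> = h \<theta> - c \<bullet> dir \<theta>" for c \<theta>
    unfolding h_def by (rule support_eq_origin[OF K(1,3)])
  have pos': "p \<theta> > 0" for \<theta> unfolding p_def by (rule pos)
  have in_K: "c \<in> K" if "relative_annulus T K c a b" for c a b
  proof -
    have "c + a *\<^sub>R 0 \<in> homothet T c a" unfolding homothet_def using T(3) by (rule imageI)
    then show ?thesis using that by (auto simp: relative_annulus_def)
  qed
  obtain c0 where c0: "c0 \<in> K" using K(3) by blast
  obtain D where D: "\<And>x y. x \<in> K \<Longrightarrow> y \<in> K \<Longrightarrow> norm (x - y) \<le> D"
    using compact_imp_bounded[OF K(1)] bounded_two_points dist_norm by metis
  have hD: "support K c \<theta> \<le> D" if "c \<in> K" for c \<theta>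
    unfolding support_le_iff[OF K(1,3)]
  proof
    fix x assume "x \<in> K"
    have "(x - c) \<bullet> dir \<theta> \<le> norm (x - c)" using norm_cauchy_schwarz[of "x - c" "dir \<theta>"] by simp
    then show "(x - c) \<bullet> dir \<theta> \<le> D" using D[OF \<open>x \<in> K\<close> that] by simp
  qed
  have h0: "0 \<le> support K c \<theta>" if "c \<in> K" for c \<theta>
    using support_upper[OF K(1,3) that, of c \<theta>] by simp
  obtain t where t: "\<And>\<theta>. p t \<le> p \<theta>"
  proof -
    have "continuous_on {0..2 * pi} p" unfolding p_def by (rule continuous_on_support[OF T(1) Tne])
    then obtain t where t: "\<And>\<theta>. \<theta> \<in> {0..2 * pi} \<Longrightarrow> p t \<le> p \<theta>"
      using continuous_attains_inf[OF compact_Icc, of 0 "2 * pi" p] by fastforce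
    have "p t \<le> p \<theta>" for \<theta>
    proof -
      obtain k :: int where "p (\<theta> + of_int k * (2 * pi)) = p \<theta>"
        "0 \<le> \<theta> + of_int k * (2 * pi)" "\<theta> + of_int k * (2 * pi) < 0 + 2 * pi"
        using periodic_representative[of p "2 * pi" \<theta> 0] support_add_2pi[of T 0] by (auto simp: p_def)
      then show ?thesis using t[of "\<theta> + of_int k * (2 * pi)"] by simp
    qed
    then show thesis by (rule that)
  qed
  have D0: "0 \<le> D" using D[OF c0 c0] by simp
  define b0 where "b0 = D / p t"
  have b0: "0 \<le> b0" using D0 pos'[of t] by (simp add: b0_def)
  have ann0: "relative_annulus T K c0 0 b0"
    unfolding ann
  proof (intro conjI allI)
    fix \<theta>
    have "support K c0 \<theta> \<le> b0 * p t" using hD[OF c0] pos'[of t] by (simp add: b0_def)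
    also have "\<dots> \<le> b0 * p \<theta>" using t b0 by (rule mult_left_mono)
    finally show "support K c0 \<theta> \<le> b0 * support T 0 \<theta>" by (simp add: p_def)
    show "0 * support T 0 \<theta> \<le> support K c0 \<theta>" using h0[OF c0] by simp
  qed (use b0 in auto)
  have le_b0: "a \<le> b0" if "relative_annulus T K c a b" for c a b
  proof -
    have "a * p t \<le> D" using that hD[OF in_K[OF that], of t] unfolding ann p_def by (meson order_trans)
    then show ?thesis using pos'[of t] by (simp add: b0_def field_simps)
  qed
  define Z where "Z = (K \<times> {0..b0} \<times> {0..2 * b0}) \<inter> {z. fst (snd z) \<le> snd (snd z)} \<inter>
     (\<Inter>\<theta>. {z. fst (snd z) * p \<theta> \<le> h \<theta> - fst z \<bullet> dir \<theta>}) \<inter>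
     (\<Inter>\<theta>. {z. h \<theta> - fst z \<bullet> dir \<theta> \<le> snd (snd z) * p \<theta>})"
  have Z: "(c, a, b) \<in> Z" if "relative_annulus T K c a b" "b - a \<le> b0" for c a b
    using that(1)[unfolded ann] that(2) le_b0[OF that(1)] in_K[OF that(1)]
    by (auto simp: Z_def hc p_def)
  have Z': "relative_annulus T K c a b" if "(c, a, b) \<in> Z" for c a b
    using that unfolding ann by (auto simp: Z_def hc p_def)
  have "compact Z"
    unfolding Z_def
    by (intro compact_Int_closed compact_Times K(1) compact_Icc closed_INT ballI closed_Collect_le continuous_intros)
  moreover have "(c0, 0, b0) \<in> Z" by (rule Z[OF ann0]) simp
  moreover have "continuous_on Z (\<lambda>z. snd (snd z) - fst (snd z))" by (intro continuous_intros)
  ultimately obtain z where z: "z \<in> Z" "\<And>y. y \<in> Z \<Longrightarrow> snd (snd z) - fst (snd z) \<le> snd (snd y) - fst (snd y)"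
    using continuous_attains_inf[of Z] by blast
  obtain c a b where zc: "z = (c, a, b)" by (metis prod_cases3)
  have "relative_minimal_annulus T K c a b"
    unfolding relative_minimal_annulus_def
  proof (intro conjI allI impI)
    show "relative_annulus T K c a b" using Z' z(1) zc by simp
    fix q s u assume A: "relative_annulus T K q s u"
    show "b - a \<le> u - s"
    proof (cases "u - s \<le> b0")
      case True
      then show ?thesis using z(2)[OF Z[OF A]] zc by simp
    next
      case False
      then show ?thesis using z(2)[OF Z[OF ann0]] zc by simp
    qed
  qed
  then show ?thesis by blast
qed

section \<open>Functions that change sign at two given angles\<close>

text \<open>The determinant of the vectors \<open>(cos, sin, p)\<close> at the angles \<open>a\<close>, \<open>b\<close>, \<open>\<theta>\<close>. After division
  by \<open>p\<close> it is an affine function on the curve \<open>dir \<theta> / p \<theta>\<close>, the boundary of the polar body, and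
  vanishes on its chord from \<open>a\<close> to \<open>b\<close>; hence the sign pattern below expresses strict convexity of this curve.\<close>

definition chord :: "(real \<Rightarrow> real) \<Rightarrow> real \<Rightarrow> real \<Rightarrow> real \<Rightarrow> real" where
  "chord p a b \<theta> = p \<theta> * sin (b - a) - p a * sin (b - \<theta>) - p b * sin (\<theta> - a)"

context oval
begin

text \<open>The chord function \<open>D\<close> satisfies \<open>D'' + D = (p + p'') sin (b - a) > 0\<close> and vanishes at \<open>a\<close>. Its
  Wronskian with \<open>sin (x - a)\<close> therefore increases from \<open>0\<close>, which makes \<open>D / sin (x - a)\<close> increasing;
  this quotient vanishes at \<open>b\<close>.\<close>

lemma chord_sign_half:
  assumes "a < b" "b < a + pi"
  shows "a < \<theta> \<Longrightarrow> \<theta> < b \<Longrightarrow> chord p a b \<theta> < 0"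
    and "b < \<theta> \<Longrightarrow> \<theta> < a + pi \<Longrightarrow> chord p a b \<theta> > 0"
proof -
  have sab: "sin (b - a) > 0" by (rule sin_gt_zero) (use assms in auto)
  define D where "D = chord p a b"
  define D' where "D' = (\<lambda>x. p' x * sin (b - a) + p a * cos (b - x) - p b * cos (x - a))"
  define W where "W = (\<lambda>x. D' x * sin (x - a) - D x * cos (x - a))"
  have dD: "(D has_real_derivative D' x) (at x)" for x
    unfolding D_def chord_def D'_def by (rule derivative_eq_intros dp refl | simp)+
  have dD': "(D' has_real_derivative (p x + p'' x) * sin (b - a) - D x) (at x)" for x
    unfolding D'_def D_def chord_def
    by (rule derivative_eq_intros dp' refl | simp add: algebra_simps)+
  have dW: "(W has_real_derivative (p x + p'' x) * sin (b - a) * sin (x - a)) (at x)" for x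
    unfolding W_def by (rule derivative_eq_intros dD dD' refl | simp add: algebra_simps)+
  have Wa: "W a = 0" by (simp add: W_def D_def chord_def)
  have Wpos: "W x > 0" if "a < x" "x < a + pi" for x
  proof -
    have "W a < W x"
    proof (rule DERIV_pos_imp_increasing_open[OF that(1)])
      fix y assume y: "a < y" "y < x"
      have "sin (y - a) > 0" by (rule sin_gt_zero) (use that y in auto)
      then show "\<exists>z. (W has_real_derivative z) (at y) \<and> 0 < z"
        using dW[of y] curv[of y] sab by (auto intro!: exI mult_pos_pos)
    qed (rule DERIV_continuous_on[OF has_field_derivative_at_within[OF dW]])
    then show ?thesis by (simp add: Wa)
  qed
  define Q where "Q = (\<lambda>x. D x / sin (x - a))"
  have Q: "Q x < Q y" if "a < x" "x < y" "y < a + pi" for x y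
  proof (rule DERIV_pos_imp_increasing[OF that(2)])
    fix z assume z: "x \<le> z" "z \<le> y"
    have s: "sin (z - a) > 0" by (rule sin_gt_zero) (use that z in auto)
    have "(Q has_real_derivative (D' z * sin (z - a) - D z * cos (z - a)) / (sin (z - a) * sin (z - a))) (at z)"
      unfolding Q_def by (rule derivative_eq_intros dD refl | use s in simp)+
    moreover have "(D' z * sin (z - a) - D z * cos (z - a)) / (sin (z - a) * sin (z - a)) > 0"
      using Wpos[of z] that z s by (simp add: W_def)
    ultimately show "\<exists>y. (Q has_real_derivative y) (at z) \<and> 0 < y" by blast
  qed
  have Qb: "Q b = 0" by (simp add: Q_def D_def chord_def)
  show "chord p a b \<theta> < 0" if "a < \<theta>" "\<theta> < b"
  proof -
    have "sin (\<theta> - a) > 0" by (rule sin_gt_zero) (use that assms in auto)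
    moreover have "Q \<theta> < 0" using Q[OF that assms(2)] Qb by simp
    ultimately show ?thesis by (simp add: Q_def D_def divide_less_0_iff)
  qed
  show "chord p a b \<theta> > 0" if "b < \<theta>" "\<theta> < a + pi"
  proof -
    have "sin (\<theta> - a) > 0" by (rule sin_gt_zero) (use that assms in auto)
    moreover have "0 < Q \<theta>" using Q[OF assms(1) that] Qb by simp
    ultimately show ?thesis by (simp add: Q_def D_def zero_less_divide_iff)
  qed
qed

end

context symmetric_oval
begin

lemma p_add_2pi: "p (x + 2 * pi) = p x"
  using sym[of x] sym[of "x + pi"] by (simp add: add.assoc)

lemma chord_add_2pi: "chord p a b (\<theta> + 2 * pi) = chord p a b \<theta>"
proof -
  have "sin (b - (\<theta> + 2 * pi)) = sin (b - \<theta>)" using sin_periodic[of "b - (\<theta> + 2 * pi)"] by simp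
  moreover have "sin (\<theta> + 2 * pi - a) = sin (\<theta> - a)" using sin_periodic[of "\<theta> - a"] by (simp add: algebra_simps)
  ultimately show ?thesis by (simp add: chord_def p_add_2pi)
qed

text \<open>Exchanging the roles of the two arcs changes the sign, so arcs longer than \<open>\<pi>\<close> reduce to shorter ones.\<close>

lemma chord_swap: "chord p b (a + 2 * pi) \<theta> = - chord p a b \<theta>"
proof -
  have "sin (a + 2 * pi - x) = - sin (x - a)" for x
    using sin_periodic[of "a - x"] sin_minus[of "x - a"] by (simp add: algebra_simps)
  moreover have "sin (\<theta> - b) = - sin (b - \<theta>)" using sin_minus[of "b - \<theta>"] by simp
  ultimately show ?thesis by (simp add: chord_def p_add_2pi)
qed

text \<open>Up to \<open>a + \<pi>\<close> this is \<open>chord_sign_half\<close>, and beyond \<open>b + \<pi>\<close> its mirror image. On the antipodal arc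
  in between, the signs of the three sines make every term of the chord function nonnegative and the first
  one positive.\<close>

lemma chord_pos_beyond_half:
  assumes "a < b" "b < a + pi" "b < \<theta>" "\<theta> < a + 2 * pi"
  shows "chord p a b \<theta> > 0"
proof -
  consider "\<theta> < a + pi" | "a + pi \<le> \<theta>" "\<theta> \<le> b + pi" | "b + pi < \<theta>" by linarith
  then show ?thesis
  proof cases
    case 1
    then show ?thesis using chord_sign_half(2) assms by blast
  next
    case 2
    have "sin (\<theta> - b) \<ge> 0" by (rule sin_ge_zero) (use 2 assms in auto)
    moreover have "sin (\<theta> - a - pi) \<ge> 0" by (rule sin_ge_zero) (use 2 assms in auto)
    then have "sin (\<theta> - a) \<le> 0" by (simp add: sin_diff)
    moreover have "sin (b - \<theta>) = - sin (\<theta> - b)" using sin_minus[of "\<theta> - b"] by simp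
    moreover have "sin (b - a) > 0" by (rule sin_gt_zero) (use assms in auto)
    moreover have "p \<theta> * sin (b - a) > 0" using pos calculation by simp
    moreover have "p a * sin (b - \<theta>) \<le> 0" "p b * sin (\<theta> - a) \<le> 0"
      using pos[of a] pos[of b] calculation by (auto simp: mult_le_0_iff)
    ultimately show ?thesis by (simp add: chord_def)
  next
    case 3
    interpret R: oval "\<lambda>x. p (- x)" "\<lambda>x. - p' (- x)" "\<lambda>x. p'' (- x)" "\<lambda>x. - J (- x)"
      by (rule oval_reflected)
    have "chord (\<lambda>x. p (- x)) (- b) (- a) (2 * pi - \<theta>) > 0"
      by (rule R.chord_sign_half(2)) (use assms 3 in auto)
    moreover have "chord (\<lambda>x. p (- x)) (- b) (- a) (2 * pi - \<theta>) = chord p a b (\<theta> - 2 * pi)"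
      by (simp add: chord_def algebra_simps)
    ultimately show ?thesis using chord_add_2pi[of a b "\<theta> - 2 * pi"] by simp
  qed
qed

lemma chord_sign:
  assumes "a < b" "b < a + 2 * pi"
  shows chord_neg: "a < \<theta> \<Longrightarrow> \<theta> < b \<Longrightarrow> chord p a b \<theta> < 0"
    and chord_pos: "b < \<theta> \<Longrightarrow> \<theta> < a + 2 * pi \<Longrightarrow> chord p a b \<theta> > 0"
proof -
  consider "b < a + pi" | "b = a + pi" | "a + pi < b" by linarith
  then have "(a < \<theta> \<longrightarrow> \<theta> < b \<longrightarrow> chord p a b \<theta> < 0) \<and> (b < \<theta> \<longrightarrow> \<theta> < a + 2 * pi \<longrightarrow> chord p a b \<theta> > 0)"
  proof cases
    case 1
    then show ?thesis using chord_sign_half(1) chord_pos_beyond_half assms by blast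
  next
    case 2
    have "sin (b - \<theta>) = sin (\<theta> - a)" unfolding 2 by (simp add: sin_diff sin_add algebra_simps)
    then have e: "chord p a b \<theta> = - 2 * p a * sin (\<theta> - a)" using 2 sym[of a] by (simp add: chord_def)
    have "sin (\<theta> - a) > 0" if "a < \<theta>" "\<theta> < b" by (rule sin_gt_zero) (use that 2 in auto)
    moreover have "sin (\<theta> - a) < 0" if "b < \<theta>" "\<theta> < a + 2 * pi"
    proof -
      have "sin (\<theta> - a - pi) > 0" by (rule sin_gt_zero) (use that 2 in auto)
      then show ?thesis by (simp add: sin_diff)
    qed
    ultimately show ?thesis unfolding e using pos[of a] by (auto simp: mult_less_0_iff zero_less_mult_iff)
  next
    case 3
    have "chord p b (a + 2 * pi) (\<theta> + 2 * pi) > 0" if "a < \<theta>" "\<theta> < b"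
      by (rule chord_pos_beyond_half) (use that 3 assms in auto)
    moreover have "chord p b (a + 2 * pi) \<theta> < 0" if "b < \<theta>" "\<theta> < a + 2 * pi"
      by (rule chord_sign_half(1)) (use that 3 assms in auto)
    ultimately show ?thesis by (auto simp: chord_swap chord_add_2pi)
  qed
  then show "a < \<theta> \<Longrightarrow> \<theta> < b \<Longrightarrow> chord p a b \<theta> < 0" "b < \<theta> \<Longrightarrow> \<theta> < a + 2 * pi \<Longrightarrow> chord p a b \<theta> > 0"
    by auto
qed

lemma continuous_chord: "continuous_on S (chord p a b)"
  unfolding chord_def by (intro continuous_intros cont_p)

end

lemma chord_eq_translation:
  "chord p a b \<theta> = sin (b - a) * p \<theta> - (p b *\<^sub>R tan_dir a - p a *\<^sub>R tan_dir b) \<bullet> dir \<theta>"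
  by (simp add: chord_def inner_real2 tan_dir_nth dir_nth sin_diff algebra_simps)

text \<open>Where \<open>D \<le> 0\<close> the function \<open>f\<close> is bounded away from \<open>0\<close>, and where \<open>D > 0\<close> every positive \<open>e\<close> helps.\<close>

lemma pos_perturb:
  fixes f D :: "real \<Rightarrow> real"
  assumes "continuous_on I f" "continuous_on I D" "compact I"
    and "\<And>x. x \<in> I \<Longrightarrow> f x \<ge> 0" "\<And>x. x \<in> I \<Longrightarrow> f x = 0 \<Longrightarrow> D x > 0"
  shows "\<exists>e0>0. \<forall>e. 0 < e \<and> e < e0 \<longrightarrow> (\<forall>x\<in>I. f x + e * D x > 0)"
proof -
  define C where "C = {x \<in> I. D x \<le> 0}"
  obtain m where m: "m > 0" "\<And>x. x \<in> C \<Longrightarrow> f x \<ge> m"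
  proof (cases "C = {}")
    case False
    have "C = I \<inter> D -` {..0}" by (auto simp: C_def)
    then have "closedin (top_of_set I) C"
      using continuous_closedin_preimage[OF assms(2) closed_atMost] by simp
    then have "compact C" using assms(3) closedin_compact by blast
    then obtain x where x: "x \<in> C" "\<And>y. y \<in> C \<Longrightarrow> f x \<le> f y"
      using continuous_attains_inf[of C f] False continuous_on_subset[OF assms(1), of C] by (auto simp: C_def)
    have "f x > 0" using x(1) assms(4,5)[of x] by (fastforce simp: C_def)
    then show thesis using that x(2) by blast
  qed (use that[of 1] in auto)
  obtain M where M: "\<And>x. x \<in> I \<Longrightarrow> \<bar>D x\<bar> \<le> M"
    using compact_imp_bounded[OF compact_continuous_image[OF assms(2,3)]] unfolding bounded_real by (metis imageI)
  show ?thesis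
  proof (intro exI[of _ "m / (\<bar>M\<bar> + 1)"] conjI allI impI ballI)
    show "m / (\<bar>M\<bar> + 1) > 0" using m(1) by (intro divide_pos_pos) auto
    fix e x assume e: "0 < e \<and> e < m / (\<bar>M\<bar> + 1)" and x: "x \<in> I"
    show "f x + e * D x > 0"
    proof (cases "D x \<le> 0")
      case True
      have "e * \<bar>D x\<bar> \<le> e * (\<bar>M\<bar> + 1)" using M[OF x] e by (intro mult_left_mono) auto
      also have "\<dots> < m" using e by (auto simp: pos_less_divide_eq)
      finally have "e * \<bar>D x\<bar> < m" .
      moreover have "f x \<ge> m" using m(2) x True by (simp add: C_def)
      ultimately show ?thesis using True by simp
    next
      case False
      then show ?thesis using assms(4)[OF x] e by (intro add_nonneg_pos mult_pos_pos) auto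
    qed
  qed
qed

section \<open>Contacts of a minimal annulus\<close>

locale minimal_annulus = symmetric_oval "support T 0" "deriv (support T 0)" "deriv (deriv (support T 0))" J
  for T :: "(real^2) set" and J +
  fixes K :: "(real^2) set" and c :: "real^2" and a b :: real
  assumes K: "compact K" "convex K" "interior K \<noteq> {}" and T: "compact T" "convex T" "T \<noteq> {}"
    and min: "relative_minimal_annulus T K c a b"
begin

abbreviation "p \<equiv> support T 0"
abbreviation "h \<equiv> support K c"

lemma K_ne: "K \<noteq> {}" using K(3) by auto

lemmas annulus_iff = relative_annulus_iff[OF K(1,2) K_ne T]

lemma radii: "0 \<le> a" "a \<le> b" and bounds: "a * p \<theta> \<le> h \<theta>" "h \<theta> \<le> b * p \<theta>"
  using min unfolding relative_minimal_annulus_def annulus_iff by auto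

lemma width_le:
  assumes "0 \<le> s" "\<And>\<theta>. s * p \<theta> \<le> support K q \<theta>" "\<And>\<theta>. support K q \<theta> \<le> t * p \<theta>"
  shows "b - a \<le> t - s"
proof -
  have "s * p 0 \<le> t * p 0" using assms(2,3) order_trans by blast
  then have "s \<le> t" using pos[of 0] by simp
  then have "relative_annulus T K q s t" unfolding annulus_iff using assms by auto
  then show ?thesis using min unfolding relative_minimal_annulus_def by blast
qed

lemma cont_h: "continuous_on S h" by (rule continuous_on_support[OF K(1) K_ne])

text \<open>The best inner and outer radii for \<open>f\<close> are the extrema of the periodic function \<open>f / p\<close>.\<close>

lemma attained_ratio:
  fixes f :: "real \<Rightarrow> real"
  assumes "continuous_on UNIV f" "\<And>x. f (x + 2 * pi) = f x"
  obtains x y where "\<And>\<theta>. (f x / p x) * p \<theta> \<le> f \<theta>" "\<And>\<theta>. f \<theta> \<le> (f y / p y) * p \<theta>"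
proof -
  let ?q = "\<lambda>x. f x / p x"
  have cq: "continuous_on {0..2 * pi} ?q"
    by (intro continuous_intros cont_p continuous_on_subset[OF assms(1)]) (use pos in \<open>auto simp: less_le\<close>)
  have per: "?q (\<theta> + 2 * pi) = ?q \<theta>" for \<theta> by (simp add: assms(2) p_add_2pi)
  obtain x where x: "\<And>\<theta>. \<theta> \<in> {0..2 * pi} \<Longrightarrow> ?q x \<le> ?q \<theta>"
    using continuous_attains_inf[OF compact_Icc _ cq] by fastforce
  obtain y where y: "\<And>\<theta>. \<theta> \<in> {0..2 * pi} \<Longrightarrow> ?q \<theta> \<le> ?q y"
    using continuous_attains_sup[OF compact_Icc _ cq] by fastforce
  have "?q x \<le> ?q \<theta> \<and> ?q \<theta> \<le> ?q y" for \<theta>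
  proof -
    obtain k :: int where k: "?q (\<theta> + of_int k * (2 * pi)) = ?q \<theta>" "0 \<le> \<theta> + of_int k * (2 * pi)" "\<theta> + of_int k * (2 * pi) < 0 + 2 * pi"
      using periodic_representative[of ?q "2 * pi" \<theta> 0] per by auto
    then have "\<theta> + of_int k * (2 * pi) \<in> {0..2 * pi}" by simp
    from x[OF this] y[OF this] show ?thesis unfolding k(1) by simp
  qed
  then show thesis using that[of x y] pos by (metis pos_divide_le_eq pos_le_divide_eq)
qed

lemma outer_contact: "\<exists>\<theta>. h \<theta> = b * p \<theta>" and inner_contact: "\<exists>\<theta>. h \<theta> = a * p \<theta>"
proof -
  obtain x y where xy: "\<And>\<theta>. (h x / p x) * p \<theta> \<le> h \<theta>" "\<And>\<theta>. h \<theta> \<le> (h y / p y) * p \<theta>"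
    using attained_ratio[OF cont_h support_add_2pi] by blast
  have "a \<le> h x / p x" "h y / p y \<le> b" using bounds pos by (simp_all add: pos_le_divide_eq pos_divide_le_eq)
  moreover from this have "b - a \<le> h y / p y - h x / p x" using radii(1) xy by (intro width_le) auto
  ultimately have "h x / p x = a" "h y / p y = b" by auto
  then have "h x = a * p x" "h y = b * p y" using pos[of x] pos[of y] by (auto simp: field_simps)
  then show "\<exists>\<theta>. h \<theta> = b * p \<theta>" "\<exists>\<theta>. h \<theta> = a * p \<theta>" by blast+
qed

text \<open>Subtracting a small multiple of the chord function from \<open>h\<close> pulls \<open>h / p\<close> strictly into the open interval
  \<open>(a, b)\<close>, by \<open>pos_perturb\<close> near the contacts and elsewhere. As the chord function is a multiple of \<open>p\<close> plus
  the support function of a point (\<open>chord_eq_translation\<close>), the result belongs to a new center with both radii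
  shifted by \<open>\<gamma>\<close>. The third assumption keeps the new inner radius nonnegative.\<close>

lemma no_separating_chord:
  assumes "x < y" "y < x + 2 * pi" "a > 0 \<or> sin (y - x) \<ge> 0"
    and inner: "\<And>\<theta>. h \<theta> = a * p \<theta> \<Longrightarrow> chord p x y \<theta> < 0"
    and outer: "\<And>\<theta>. h \<theta> = b * p \<theta> \<Longrightarrow> chord p x y \<theta> > 0"
  shows False
proof -
  let ?D = "chord p x y" and ?I = "{0..2 * pi}"
  have c: "continuous_on S (\<lambda>x. b * p x - h x)" "continuous_on S (\<lambda>x. h x - a * p x)" "continuous_on S ?D"
    "continuous_on S (\<lambda>x. - ?D x)" for S
    by (intro continuous_intros cont_h cont_p continuous_chord)+
  obtain e1 where e1: "e1 > 0" "\<And>e \<theta>. 0 < e \<Longrightarrow> e < e1 \<Longrightarrow> \<theta> \<in> ?I \<Longrightarrow> b * p \<theta> - h \<theta> + e * ?D \<theta> > 0"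
  proof -
    have "\<exists>e0>0. \<forall>e. 0 < e \<and> e < e0 \<longrightarrow> (\<forall>\<theta>\<in>?I. b * p \<theta> - h \<theta> + e * ?D \<theta> > 0)"
    proof (rule pos_perturb[OF c(1,3) compact_Icc])
      show "b * p \<theta> - h \<theta> \<ge> 0" for \<theta> using bounds(2)[of \<theta>] by simp
      show "?D \<theta> > 0" if "b * p \<theta> - h \<theta> = 0" for \<theta> using that by (intro outer) simp
    qed
    then show thesis using that by blast
  qed
  obtain e2 where e2: "e2 > 0" "\<And>e \<theta>. 0 < e \<Longrightarrow> e < e2 \<Longrightarrow> \<theta> \<in> ?I \<Longrightarrow> h \<theta> - a * p \<theta> + e * - ?D \<theta> > 0"
  proof -
    have "\<exists>e0>0. \<forall>e. 0 < e \<and> e < e0 \<longrightarrow> (\<forall>\<theta>\<in>?I. h \<theta> - a * p \<theta> + e * - ?D \<theta> > 0)"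
    proof (rule pos_perturb[OF c(2,4) compact_Icc])
      show "h \<theta> - a * p \<theta> \<ge> 0" for \<theta> using bounds(1)[of \<theta>] by simp
      show "- ?D \<theta> > 0" if "h \<theta> - a * p \<theta> = 0" for \<theta> using inner[of \<theta>] that by simp
    qed
    then show thesis using that by blast
  qed
  define e where "e = (if a > 0 then min (min e1 e2) a else min e1 e2) / 2"
  have e: "0 < e" "e < e1" "e < e2" "a > 0 \<Longrightarrow> e < a" using e1(1) e2(1) by (auto simp: e_def min_def)
  define f where "f = (\<lambda>\<theta>. h \<theta> - e * ?D \<theta>)"
  have f: "a * p \<theta> < f \<theta>" "f \<theta> < b * p \<theta>" if "\<theta> \<in> ?I" for \<theta>
    using e1(2)[OF e(1,2) that] e2(2)[OF e(1,3) that] by (auto simp: f_def)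
  have cf: "continuous_on UNIV f" unfolding f_def by (intro continuous_intros cont_h continuous_chord)
  have pf: "f (\<theta> + 2 * pi) = f \<theta>" for \<theta> by (simp add: f_def support_add_2pi chord_add_2pi)
  have f': "a * p \<theta> < f \<theta> \<and> f \<theta> < b * p \<theta>" for \<theta>
  proof -
    have "(f (\<theta> + 2 * pi), p (\<theta> + 2 * pi)) = (f \<theta>, p \<theta>)" for \<theta> by (simp add: pf p_add_2pi)
    then obtain k :: int where k: "(f (\<theta> + of_int k * (2 * pi)), p (\<theta> + of_int k * (2 * pi))) = (f \<theta>, p \<theta>)"
      "0 \<le> \<theta> + of_int k * (2 * pi)" "\<theta> + of_int k * (2 * pi) < 0 + 2 * pi"
      using periodic_representative[of "\<lambda>\<theta>. (f \<theta>, p \<theta>)" "2 * pi" \<theta> 0] by auto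
    then show ?thesis using f[of "\<theta> + of_int k * (2 * pi)"] by simp
  qed
  obtain u v where uv: "\<And>\<theta>. (f u / p u) * p \<theta> \<le> f \<theta>" "\<And>\<theta>. f \<theta> \<le> (f v / p v) * p \<theta>"
    using attained_ratio[OF cf pf] by blast
  have r: "a < f u / p u" "f v / p v < b" using f' pos by (simp_all add: pos_less_divide_eq pos_divide_less_eq)
  define w where "w = p y *\<^sub>R tan_dir x - p x *\<^sub>R tan_dir y"
  define \<gamma> where "\<gamma> = e * sin (y - x)"
  have sup: "support K (c - e *\<^sub>R w) \<theta> = f \<theta> + \<gamma> * p \<theta>" for \<theta>
  proof -
    have "support K (c - e *\<^sub>R w) \<theta> = support K 0 \<theta> - (c - e *\<^sub>R w) \<bullet> dir \<theta>"
      "h \<theta> = support K 0 \<theta> - c \<bullet> dir \<theta>"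
      by (rule support_eq_origin[OF K(1) K_ne])+
    moreover have "e * ?D \<theta> = \<gamma> * p \<theta> - e * (w \<bullet> dir \<theta>)"
      unfolding chord_eq_translation w_def \<gamma>_def by (simp only: right_diff_distrib mult.assoc)
    ultimately show ?thesis by (simp add: f_def inner_diff_left)
  qed
  have "\<gamma> \<ge> - a"
  proof (cases "a > 0")
    case True
    have "\<bar>\<gamma>\<bar> \<le> e * 1" using e(1) abs_sin_le_one[of "y - x"] unfolding \<gamma>_def abs_mult by (intro mult_mono) auto
    then show ?thesis using e(4)[OF True] by simp
  next
    case False
    then have "\<gamma> \<ge> 0" using assms(3) e(1) by (auto simp: \<gamma>_def)
    then show ?thesis using radii(1) by simp
  qed
  then have "0 \<le> f u / p u + \<gamma>" using r(1) by simp
  moreover have "(f u / p u + \<gamma>) * p \<theta> \<le> support K (c - e *\<^sub>R w) \<theta>" for \<theta>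
    using uv(1)[of \<theta>] by (simp add: sup algebra_simps)
  moreover have "support K (c - e *\<^sub>R w) \<theta> \<le> (f v / p v + \<gamma>) * p \<theta>" for \<theta>
    using uv(2)[of \<theta>] by (simp add: sup algebra_simps)
  ultimately have "b - a \<le> (f v / p v + \<gamma>) - (f u / p u + \<gamma>)" by (rule width_le)
  then show False using r by simp
qed

text \<open>If the inner radius is \<open>0\<close>, then \<open>h\<close> vanishes at inner contacts. Two zeros of \<open>h\<close> that are \<open>\<pi>\<close> apart
  would squeeze \<open>K\<close> into a line. If they were further apart, then \<open>\<theta>\<close> would lie on the arc shorter than \<open>\<pi>\<close>
  from \<open>t\<close> to \<open>s + 2 \<pi>\<close>, where \<open>h \<le> 0\<close> by \<open>dir_combination\<close>.\<close>

lemma inner_contacts_span_less_pi: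
  assumes "a = 0" "b > 0" "h s = 0" "h t = 0" "h \<theta> = b * p \<theta>" "t < \<theta>" "\<theta> < s + 2 * pi"
  shows "t - s < pi"
proof (rule ccontr)
  assume "\<not> t - s < pi"
  have le: "(x - c) \<bullet> dir s \<le> 0" "(x - c) \<bullet> dir t \<le> 0" if "x \<in> K" for x
    using support_upper[OF K(1) K_ne that, of c s] support_upper[OF K(1) K_ne that, of c t] assms by auto
  consider "t = s + pi" | "t - s > pi" using \<open>\<not> t - s < pi\<close> by linarith
  then show False
  proof cases
    case 1
    then have eq: "(x - c) \<bullet> dir s = 0" if "x \<in> K" for x using le[OF that] by (simp add: dir_add_pi)
    obtain z where z: "z \<in> interior K" using K(3) by blast
    then obtain e where e: "e > 0" "cball z e \<subseteq> K" using mem_interior_cball by blast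
    have "z + e *\<^sub>R dir s \<in> K" by (rule subsetD[OF e(2)]) (use e(1) in \<open>simp add: dist_norm\<close>)
    moreover have "z \<in> K" by (rule subsetD[OF e(2)]) (use e(1) in simp)
    ultimately show False
      using eq[of z] eq[of "z + e *\<^sub>R dir s"] e(1) by (simp add: algebra_simps inner_diff_left inner_add_left dot_square_norm)
  next
    case 2
    have s1: "sin (s + 2 * pi - t) > 0" by (rule sin_gt_zero) (use 2 assms in auto)
    have s2: "sin (s + 2 * pi - \<theta>) \<ge> 0" "sin (\<theta> - t) \<ge> 0" by (rule sin_ge_zero; use 2 assms in simp)+
    have "h \<theta> \<le> 0"
      unfolding support_le_iff[OF K(1) K_ne]
    proof
      fix x assume x: "x \<in> K"
      have "sin (s + 2 * pi - t) * ((x - c) \<bullet> dir \<theta>) = (x - c) \<bullet> (sin (s + 2 * pi - t) *\<^sub>R dir \<theta>)" by simp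
      also have "\<dots> = sin (s + 2 * pi - \<theta>) * ((x - c) \<bullet> dir t) + sin (\<theta> - t) * ((x - c) \<bullet> dir s)"
        unfolding dir_combination[of "s + 2 * pi" t \<theta>] dir_add_2pi by (simp add: inner_add_right)
      also have "\<dots> \<le> 0"
        using le[OF x] s2 by (intro add_nonpos_nonpos mult_nonneg_nonpos)
      finally show "(x - c) \<bullet> dir \<theta> \<le> 0" using s1 by (simp add: mult_le_0_iff)
    qed
    then show False using assms(2,5) pos[of \<theta>] by (simp add: mult_le_0_iff)
  qed
qed

text \<open>Start at an outer contact \<open>t1\<close> and let \<open>s\<close>, \<open>t\<close> be the first and the last inner contact in the turn that
  follows. An outer contact between them completes the pattern. Otherwise all inner contacts lie in \<open>[s, t]\<close> and
  all outer ones outside, and the chord function for a slightly larger arc contradicts minimality.\<close>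

lemma alternating_contacts:
  assumes "a < b"
  obtains t1 t2 t3 t4 where "t1 < t2" "t2 < t3" "t3 < t4" "t4 < t1 + 2 * pi"
    "h t1 = b * p t1" "h t2 = a * p t2" "h t3 = b * p t3" "h t4 = a * p t4"
proof (rule ccontr)
  assume no: "\<not> thesis"
  note found = that
  have ne: "h \<theta> = b * p \<theta> \<Longrightarrow> h \<theta> \<noteq> a * p \<theta>" for \<theta> using assms pos[of \<theta>] by simp
  define out where "out = (\<lambda>\<theta>. h \<theta> = b * p \<theta>)"
  define inn where "inn = (\<lambda>\<theta>. h \<theta> = a * p \<theta>)"
  have per: "out (\<theta> + 2 * pi) = out \<theta>" "inn (\<theta> + 2 * pi) = inn \<theta>" for \<theta>
    by (simp_all add: out_def inn_def support_add_2pi p_add_2pi)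
  have clo: "closed {\<theta>. out \<theta>}" "closed {\<theta>. inn \<theta>}"
    unfolding out_def inn_def by (intro closed_Collect_eq continuous_intros cont_h cont_p)+
  have disj: "\<not> (out \<theta> \<and> inn \<theta>)" for \<theta> using ne by (auto simp: out_def inn_def)
  obtain t1 where t1: "out t1" using outer_contact unfolding out_def by blast
  obtain m where m: "inn m" using inner_contact unfolding inn_def by blast
  have ext: "\<exists>x\<in>S. \<forall>y\<in>S. x \<le> y" "\<exists>x\<in>S. \<forall>y\<in>S. y \<le> x"
    if "S = {\<theta>. Q \<theta>} \<inter> {l..u}" "closed {\<theta>. Q \<theta>}" "S \<noteq> {}" for S :: "real set" and Q l u
  proof -
    have "compact S" unfolding that(1) by (intro closed_Int_compact that(2) compact_Icc)
    then show "\<exists>x\<in>S. \<forall>y\<in>S. x \<le> y" "\<exists>x\<in>S. \<forall>y\<in>S. y \<le> x"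
      using compact_attains_inf compact_attains_sup that(3) by blast+
  qed
  have rep: "\<exists>k::int. inn (m + of_int k * (2 * pi)) = inn m \<and> t1 \<le> m + of_int k * (2 * pi) \<and> m + of_int k * (2 * pi) < t1 + 2 * pi" for m
    using periodic_representative[of inn "2 * pi" m t1, OF per(2)] by auto
  have repo: "\<exists>k::int. out (m + of_int k * (2 * pi)) = out m \<and> t1 \<le> m + of_int k * (2 * pi) \<and> m + of_int k * (2 * pi) < t1 + 2 * pi" for m
    using periodic_representative[of out "2 * pi" m t1, OF per(1)] by auto
  let ?S = "{\<theta>. inn \<theta>} \<inter> {t1..t1 + 2 * pi}"
  have "?S \<noteq> {}" using rep[of m] m by fastforce
  then obtain s t where s: "s \<in> ?S" "\<And>y. y \<in> ?S \<Longrightarrow> s \<le> y" and t: "t \<in> ?S" "\<And>y. y \<in> ?S \<Longrightarrow> y \<le> t"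
    using ext[OF refl clo(2)] by blast
  have st: "t1 < s" "s \<le> t" "t < t1 + 2 * pi"
    using s t t1 disj per(1)[of t1] by (auto simp: less_le)
  have gap: "\<not> out \<theta>" if "s \<le> \<theta>" "\<theta> \<le> t" for \<theta>
  proof
    assume "out \<theta>"
    then have "s < \<theta>" "\<theta> < t" using that s t disj by (auto simp: less_le)
    then have thesis
      using st(1,3) t1 \<open>out \<theta>\<close> s(1) t(1)
      by (intro found[of t1 s \<theta> t]) (simp_all add: out_def inn_def)
    with no show False ..
  qed
  let ?A = "{\<theta>. out \<theta>} \<inter> {t1..s}" and ?B = "{\<theta>. out \<theta>} \<inter> {t..t1 + 2 * pi}"
  have ne: "?A \<noteq> {}" "?B \<noteq> {}" using t1 st per(1)[of t1] by auto
  obtain x' where x': "x' \<in> ?A" "\<And>y. y \<in> ?A \<Longrightarrow> y \<le> x'"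
    using ext(2)[OF refl clo(1) ne(1)] by blast
  obtain y' where y': "y' \<in> ?B" "\<And>y. y \<in> ?B \<Longrightarrow> y' \<le> y"
    using ext(1)[OF refl clo(1) ne(2)] by blast
  have xs: "x' < s" "t < y'" using x' y' gap st by (auto simp: less_le)
  have span: "t - s < pi" if "a = 0"
    using that assms s t st t1 per(1)[of t1]
    by (intro inner_contacts_span_less_pi[of s t "t1 + 2 * pi"]) (auto simp: inn_def out_def)
  (* If the inner radius is 0, the arc must stay shorter than pi, so that moving the center does not
     shrink it below 0. *)
  define e where "e = (if a = 0 then min (min (s - x') (y' - t)) (pi - (t - s)) else min (s - x') (y' - t)) / 3"
  have e: "0 < e" "e < s - x'" "e < y' - t" "a = 0 \<Longrightarrow> 2 * e < pi - (t - s)"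
    using xs span by (auto simp: e_def min_def)
  have x'1: "t1 \<le> x'" and y'1: "y' \<le> t1 + 2 * pi" using x' y' by auto
  have xy: "s - e < t + e" "t + e < s - e + 2 * pi" using st e x'1 y'1 by auto
  show False
  proof (rule no_separating_chord[OF xy])
    show "a > 0 \<or> sin (t + e - (s - e)) \<ge> 0"
    proof (cases "a = 0")
      case True
      then show ?thesis using e st by (intro disjI2 sin_ge_zero) auto
    qed (use radii(1) in simp)
    have cper: "chord p (s - e) (t + e) (\<theta> + of_int k * (2 * pi)) = chord p (s - e) (t + e) \<theta>" for \<theta> k
      by (rule periodic_of_int) (rule chord_add_2pi)
    show "chord p (s - e) (t + e) \<theta> < 0" if \<theta>: "h \<theta> = a * p \<theta>" for \<theta>
    proof -
      obtain k :: int where k: "inn (\<theta> + of_int k * (2 * pi))" "t1 \<le> \<theta> + of_int k * (2 * pi)" "\<theta> + of_int k * (2 * pi) < t1 + 2 * pi"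
        using rep[of \<theta>] \<theta> by (auto simp: inn_def)
      have "chord p (s - e) (t + e) (\<theta> + of_int k * (2 * pi)) < 0"
        by (rule chord_neg[OF xy]) (use s(2)[of "\<theta> + of_int k * (2 * pi)"] t(2)[of "\<theta> + of_int k * (2 * pi)"] k e in auto)
      then show ?thesis by (simp only: cper)
    qed
    show "chord p (s - e) (t + e) \<theta> > 0" if \<theta>: "h \<theta> = b * p \<theta>" for \<theta>
    proof -
      obtain k :: int where k: "out (\<theta> + of_int k * (2 * pi))" "t1 \<le> \<theta> + of_int k * (2 * pi)" "\<theta> + of_int k * (2 * pi) < t1 + 2 * pi"
        using repo[of \<theta>] \<theta> by (auto simp: out_def)
      define z where "z = \<theta> + of_int k * (2 * pi)"
      have "z < s \<or> z > t" using gap[of z] k(1) by (force simp: z_def)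
      then have "chord p (s - e) (t + e) z > 0"
      proof
        assume "z < s"
        then have "z \<le> x'" using x'(2)[of z] k by (simp add: z_def)
        have "chord p (s - e) (t + e) (z + 2 * pi) > 0"
          by (rule chord_pos[OF xy]) (use \<open>z \<le> x'\<close> e k y'1 in \<open>auto simp: z_def\<close>)
        then show ?thesis by (simp only: chord_add_2pi)
      next
        assume "z > t"
        then have "y' \<le> z" using y'(2)[of z] k by (simp add: z_def)
        show ?thesis
          by (rule chord_pos[OF xy]) (use \<open>y' \<le> z\<close> e k x'1 in \<open>auto simp: z_def\<close>)
      qed
      then show ?thesis by (simp only: cper z_def)
    qed
  qed
qed

lemma symmetric_oval_scaled:
  assumes "r > 0"
  shows "symmetric_oval (\<lambda>x. r * p x) (\<lambda>x. r * deriv p x) (\<lambda>x. r * deriv (deriv p) x) (\<lambda>x. r\<^sup>2 * J x)"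
proof
  fix x
  show "((\<lambda>x. r * p x) has_real_derivative r * deriv p x) (at x)" by (rule DERIV_cmult[OF dp])
  show "((\<lambda>x. r * deriv p x) has_real_derivative r * deriv (deriv p) x) (at x)" by (rule DERIV_cmult[OF dp'])
  show "((\<lambda>x. r\<^sup>2 * J x) has_real_derivative r * p x * (r * p x + r * deriv (deriv p) x)) (at x)"
    using DERIV_cmult[OF dJ, of "r\<^sup>2" x] by (simp add: power2_eq_square algebra_simps)
  show "r * p x + r * deriv (deriv p) x > 0" using curv[of x] assms by (simp add: distrib_left[symmetric])
  show "r * p x > 0" using pos[of x] assms by simp
  show "r * p (x + pi) = r * p x" by (simp add: sym)
next
  show "continuous_on UNIV (\<lambda>x. r * deriv (deriv p) x)" by (intro continuous_intros cont)
qed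

text \<open>The larger of \<open>b - r\<close> and \<open>r - a\<close> provides the scale \<open>R\<close> with \<open>\<bar>g\<bar> \<le> R p\<close>. In the first case \<open>g\<close>
  touches \<open>R p\<close> at the outer contacts, in the second \<open>- g\<close> touches it at the inner ones.\<close>

lemma bonnesen_nonneg:
  assumes T': "interior T \<noteq> {}" and r: "a \<le> r" "r \<le> b"
  shows "0 \<le> bonnesen T K r"
proof -
  define g where "g = (\<lambda>x. h x - r * p x)"
  define g' where "g' = (\<lambda>x. (deriv (support K 0) x - r * deriv p x) - c \<bullet> tan_dir x)"
  have lip: "lip_deriv u v g g'" for u v
  proof -
    have "g = (\<lambda>x. (support K 0 x - r * p x) - c \<bullet> dir x)"
      unfolding g_def support_eq_origin[OF K(1) K_ne, of c] by auto
    then show ?thesis unfolding g'_def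
      by (simp only:) (intro lip_deriv_diff lip_deriv_cmult support_lip_deriv K(1) K_ne T(1,3) lip_deriv_inner_dir)
  qed
  have perg: "g (x + 2 * pi) = g x" for x by (simp add: g_def support_add_2pi)
  have perg': "g' (x + 2 * pi) = g' x" for x
  proof -
    have "tan_dir (x + 2 * pi) = tan_dir x"
      using dir_add_2pi[of "x + pi / 2"] by (simp add: tan_dir_def algebra_simps)
    then show ?thesis
      unfolding g'_def by (simp add: deriv_periodic[of "support _ 0", OF support_add_2pi])
  qed
  have shift: "energy u (u + 2 * pi) g g' = energy 0 (2 * pi) g g'" for u
    unfolding energy_def
  proof (rule integral_periodic)
    show "(\<lambda>x. (g' x)\<^sup>2 - (g x)\<^sup>2) integrable_on {u..v}" for u v
      by (cases "u \<le> v") (auto intro: energy_integrable[OF lip])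
  qed (simp_all add: perg perg')
  have "0 \<le> energy 0 (2 * pi) g g'"
  proof (cases "a = b")
    case True
    then have "g x = 0" for x using bounds[of x] r by (simp add: g_def)
    then have "g = (\<lambda>_. 0)" by blast
    then show ?thesis unfolding energy_def
      using energy_integrable[OF lip, of 0 "2 * pi"] by (intro integral_nonneg) auto
  next
    case False
    then have "a < b" using radii by simp
    then obtain t1 t2 t3 t4 where t: "t1 < t2" "t2 < t3" "t3 < t4" "t4 < t1 + 2 * pi"
      "h t1 = b * p t1" "h t2 = a * p t2" "h t3 = b * p t3" "h t4 = a * p t4"
      by (rule alternating_contacts)
    have bd: "g x \<le> (b - r) * p x" "- g x \<le> (r - a) * p x" for x
      using bounds[of x] by (auto simp: g_def algebra_simps)
    have np: "- ((r - a) * p x) \<le> 0" "- ((b - r) * p x) \<le> 0" for x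
      using r pos[of x] by (auto intro!: mult_nonneg_nonneg less_imp_le)
    show ?thesis
    proof (cases "r - a \<le> b - r")
      case True
      then have br: "b - r > 0" using \<open>a < b\<close> by simp
      interpret S: symmetric_oval "\<lambda>x. (b - r) * p x" "\<lambda>x. (b - r) * deriv p x"
        "\<lambda>x. (b - r) * deriv (deriv p) x" "\<lambda>x. (b - r)\<^sup>2 * J x"
        by (rule symmetric_oval_scaled[OF br])
      have "\<exists>u. 0 \<le> energy u (u + 2 * pi) g g'"
      proof (rule S.energy_nonneg_alternating[OF t(1-4) lip perg perg'])
        show "\<bar>g x\<bar> \<le> (b - r) * p x" for x
          using bd[of x] mult_right_mono[OF True less_imp_le[OF pos[of x]]] by (auto simp: abs_le_iff)
        show "g t1 = (b - r) * p t1" "g t3 = (b - r) * p t3"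
          using t by (simp_all add: g_def algebra_simps)
        show "g t2 \<le> 0" "g t4 \<le> 0"
          using t np(1)[of t2] np(1)[of t4] by (simp_all add: g_def algebra_simps)
      qed
      then show ?thesis by (auto simp: shift)
    next
      case False
      then have ra: "r - a > 0" using \<open>a < b\<close> by simp
      interpret S: symmetric_oval "\<lambda>x. (r - a) * p x" "\<lambda>x. (r - a) * deriv p x"
        "\<lambda>x. (r - a) * deriv (deriv p) x" "\<lambda>x. (r - a)\<^sup>2 * J x"
        by (rule symmetric_oval_scaled[OF ra])
      have lip': "lip_deriv u v (\<lambda>x. - g x) (\<lambda>x. - g' x)" for u v
        using lip_deriv_cmult[OF lip, of u v "-1"] by simp
      have "\<exists>u. 0 \<le> energy u (u + 2 * pi) (\<lambda>x. - g x) (\<lambda>x. - g' x)"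
      proof (rule S.energy_nonneg_alternating[OF t(2-4) _ lip'])
        show "t1 + 2 * pi < t2 + 2 * pi" using t by simp
        show "\<bar>- g x\<bar> \<le> (r - a) * p x" for x
          using bd[of x] mult_right_mono[OF less_imp_le[OF False[unfolded not_le]] less_imp_le[OF pos[of x]]]
          by (auto simp: abs_le_iff)
        show "- g t2 = (r - a) * p t2" "- g t4 = (r - a) * p t4"
          using t by (simp_all add: g_def algebra_simps)
        show "- g t3 \<le> 0" "- g (t1 + 2 * pi) \<le> 0"
          unfolding perg using t np(2)[of t3] np(2)[of t1] by (simp_all add: g_def algebra_simps)
      qed (simp_all add: perg perg')
      then show ?thesis using shift by (auto simp: energy_def)
    qed
  qed
  also have "\<dots> \<le> 2 * bonnesen T K r"
    unfolding g_def g'_def by (rule bonnesen_ge_energy[OF K(1,3) T(1) T'])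
  finally show ?thesis by simp
qed

end

section \<open>Positive centers\<close>

theorem theorem8:
  fixes U T K :: "(real^2) set"
  assumes "minkowski_unit_disk U" and "T = isoperimetrix U"
    and "compact K" and "convex K" and "interior K \<noteq> {}"
  shows "(\<exists>p \<rho>\<^sub>i \<rho>\<^sub>o. relative_minimal_annulus T K p \<rho>\<^sub>i \<rho>\<^sub>o)
    \<and> (\<forall>p \<rho>\<^sub>i \<rho>\<^sub>o. relative_minimal_annulus T K p \<rho>\<^sub>i \<rho>\<^sub>o \<longrightarrow>
          (\<forall>r\<in>{\<rho>\<^sub>i..\<rho>\<^sub>o}. 0 \<le> bonnesen T K r)
        \<and> (\<forall>\<theta>. \<rho>\<^sub>i \<le> support K p \<theta> / support T 0 \<theta> \<and> support K p \<theta> / support T 0 \<theta> \<le> \<rho>\<^sub>o)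
        \<and> relative_positive_center T K p)
    \<and> (\<exists>p. relative_positive_center T K p)"
proof -
  have T: "compact T" "convex T" "0 \<in> T" "interior T \<noteq> {}"
    using isoperimetrix_body[OF assms(1)] by (simp_all add: assms(2))
  have K: "K \<noteq> {}" using assms(5) by auto
  obtain J where J: "symmetric_oval (support T 0) (deriv (support T 0)) (deriv (deriv (support T 0))) J"
    using isoperimetrix_symmetric_oval[OF assms(1)] assms(2) by blast
  then interpret S: symmetric_oval "support T 0" "deriv (support T 0)" "deriv (deriv (support T 0))" J .
  have ex: "\<exists>p \<rho>\<^sub>i \<rho>\<^sub>o. relative_minimal_annulus T K p \<rho>\<^sub>i \<rho>\<^sub>o"
    by (rule exists_minimal_annulus[OF assms(3,4) K T(1-3) S.pos])
  have main: "(\<forall>r\<in>{a..b}. 0 \<le> bonnesen T K r)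
        \<and> (\<forall>\<theta>. a \<le> support K c \<theta> / support T 0 \<theta> \<and> support K c \<theta> / support T 0 \<theta> \<le> b)
        \<and> relative_positive_center T K c" if "relative_minimal_annulus T K c a b" for c a b
  proof -
    interpret M: minimal_annulus T J K c a b
      by unfold_locales (use that assms T in auto)
    have B: "\<forall>r\<in>{a..b}. 0 \<le> bonnesen T K r" using M.bonnesen_nonneg[OF T(4)] by auto
    moreover have q: "a \<le> support K c \<theta> / support T 0 \<theta> \<and> support K c \<theta> / support T 0 \<theta> \<le> b" for \<theta>
      using M.bounds[of \<theta>] S.pos[of \<theta>] by (simp add: pos_le_divide_eq pos_divide_le_eq)
    ultimately show ?thesis by (auto simp: relative_positive_center_def)
  qed
  show ?thesis using ex main by blast
qed

end
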